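(* Let $\mathcal H$ be a separable complex Hilbert space, let $\Omega\subseteq\mathbb C$ be open and connected, and let $A:\Omega\to\mathcal B(\mathcal H)$ be analytic with $A(z)\in\Phi(\mathcal H)$ for all $z\in\Omega$. Suppose that $A(z)$ is boundedly invertible for some $z\in\Omega$, and let $z_0\in\Omega$ be a pole of $A(\cdot)^{-1}$. Let $Q_1$ be any projection in $\mathcal H$ onto $\operatorname{ran}(A(z_0))$ and let $P_1=I_{\mathcal H}-Q_1$. Then $$A(z)=[Q_1-(z-z_0)P_1]\,A_1(z),\quad z\in\Omega,$$ where: (a) $A_1(\cdot)$ is analytic on $\Omega$; (b) $A_1(z)\in\Phi(\mathcal H)$ for all $z\in\Omega$; (c) $\operatorname{ind}(A(z))=\operatorname{ind}(A_1(z))=0$ for $z\in\Omega$ with $|z-z_0|$ sufficiently small; (d) $\operatorname{def}(A_1(z_0))\le\operatorname{def}(A(z_0))$. If $z_0$ is a pole of $A(\cdot)^{-1}$ of order $n_0\in\mathbb N$, then $z_0$ is a pole of $A_1(\cdot)^{-1}$ of order $n_0-1$. Finally, $[I_{\mathcal H}-A(\cdot)]\in\mathcal F(\mathcal H)$ (resp., $\mathcal B_p(\mathcal H)$ for some $1\le p\le\infty$) if and only if $[I_{\mathcal H}-A_1(\cdot)]\in\mathcal F(\mathcal H)$ (resp., $\mathcal B_p(\mathcal H)$, with the same $p$), where membership of such an operator-valued function means membership of its value at every $z\in\Omega$.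
   Context: $\mathcal B(\mathcal H)$ denotes the bounded linear operators on $\mathcal H$; $\mathcal F(\mathcal H)$ the finite rank operators; $\mathcal B_p(\mathcal H)$, $1\le p<\infty$, the Schatten--von Neumann ideals; and $\mathcal B_\infty(\mathcal H)$ the compact operators. $\Phi(\mathcal H)$ is the set of bounded Fredholm operators, i.e. $T\in\mathcal B(\mathcal H)$ with $\dim\ker(T)<\infty$, $\operatorname{ran}(T)$ closed, and $\dim\ker(T^* )<\infty$; $\operatorname{ind}(T)=\dim\ker(T)-\dim\ker(T^* )$. For an operator $S$ with closed range, $\operatorname{def}(S)=\dim(\operatorname{ran}(S)^\perp)$. A projection is a bounded idempotent, not necessarily orthogonal. If $A(z)$ is boundedly invertible for some $z\in\Omega$, then by the analytic Fredholm theorem $A(\cdot)^{-1}$ is meromorphic on $\Omega$ (with finite rank principal parts at its poles); "pole" and "order of a pole" refer to the norm convergent Laurent expansion of $A(z)^{-1}$ about $z_0$. A "pole of order $0$" means that the function has no pole at $z_0$, i.e. it extends analytically to $z_0$. *)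

theory Defs
  imports "HOL-Analysis.Analysis"
begin

section \<open>Complex Hilbert spaces\<close>

class complex_normed_vector = real_normed_vector +
  fixes scaleC :: "complex \<Rightarrow> 'a \<Rightarrow> 'a"  (infixr "*\<^sub>C" 75)
  assumes scaleC_add_right: "c *\<^sub>C (x + y) = c *\<^sub>C x + c *\<^sub>C y"
    and scaleC_add_left: "(c + d) *\<^sub>C x = c *\<^sub>C x + d *\<^sub>C x"
    and scaleC_scaleC: "c *\<^sub>C (d *\<^sub>C x) = (c * d) *\<^sub>C x"
    and scaleC_of_real: "complex_of_real r *\<^sub>C x = r *\<^sub>R x"
    and norm_scaleC: "norm (c *\<^sub>C x) = cmod c * norm x"

text \<open>The complex inner product is linear in its second argument. The real inner product inherited
  from \<^class>\<open>real_inner\<close> is its real part, so positive definiteness and the relation between norm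
  and inner product come from \<^class>\<open>real_inner\<close>.\<close>

class complex_hilbert_space = complex_normed_vector + real_inner + complete_space +
  fixes cinner :: "'a \<Rightarrow> 'a \<Rightarrow> complex"
  assumes cinner_commute: "cinner x y = cnj (cinner y x)"
    and cinner_add_right: "cinner x (y + z) = cinner x y + cinner x z"
    and cinner_scaleC_right: "cinner x (c *\<^sub>C y) = c * cinner x y"
    and inner_eq_Re_cinner: "inner x y = Re (cinner x y)"

global_interpretation complex_vector:
  vector_space "scaleC :: complex \<Rightarrow> 'a \<Rightarrow> 'a::complex_normed_vector"
proof
  show "1 *\<^sub>C x = x" for x :: 'a
    using scaleC_of_real[of 1 x] by simp
qed (simp_all add: scaleC_add_right scaleC_add_left scaleC_scaleC)

instantiation blinfun :: (real_normed_vector, complex_normed_vector) complex_normed_vector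
begin

lift_definition scaleC_blinfun :: "complex \<Rightarrow> 'a \<Rightarrow>\<^sub>L 'b \<Rightarrow> 'a \<Rightarrow>\<^sub>L 'b" is "\<lambda>c T x. c *\<^sub>C T x"
proof -
  fix c :: complex and T :: "'a \<Rightarrow> 'b"
  assume "bounded_linear T"
  moreover have "bounded_linear (\<lambda>y::'b. c *\<^sub>C y)"
  proof (rule bounded_linear_intro[where K = "cmod c"])
    show "c *\<^sub>C (r *\<^sub>R x) = r *\<^sub>R (c *\<^sub>C x)" for r and x :: 'b
      by (simp only: scaleC_of_real[symmetric] scaleC_scaleC mult.commute)
  qed (simp_all add: scaleC_add_right norm_scaleC mult.commute)
  ultimately show "bounded_linear (\<lambda>x. c *\<^sub>C T x)"
    by (rule bounded_linear_compose[rotated])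
qed

instance
proof
  fix c d :: complex and r :: real and S T :: "'a \<Rightarrow>\<^sub>L 'b"
  show "c *\<^sub>C (S + T) = c *\<^sub>C S + c *\<^sub>C T"
    by transfer (simp add: scaleC_add_right)
  show "(c + d) *\<^sub>C T = c *\<^sub>C T + d *\<^sub>C T"
    by transfer (simp add: scaleC_add_left)
  show "c *\<^sub>C (d *\<^sub>C T) = (c * d) *\<^sub>C T"
    by transfer (simp add: scaleC_scaleC)
  show "complex_of_real r *\<^sub>C T = r *\<^sub>R T"
    by transfer (simp add: scaleC_of_real)
  have le: "norm (c *\<^sub>C T) \<le> cmod c * norm T" for c and T :: "'a \<Rightarrow>\<^sub>L 'b"
  proof (rule norm_blinfun_bound)
    show "norm (blinfun_apply (c *\<^sub>C T) x) \<le> cmod c * norm T * norm x" for x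
      using norm_blinfun[of T x]
      by (simp add: scaleC_blinfun.rep_eq norm_scaleC mult.assoc mult_left_mono)
  qed simp
  show "norm (c *\<^sub>C T) = cmod c * norm T"
  proof (cases "c = 0")
    case True
    then show ?thesis using le[of 0 T] by simp
  next
    case False
    have "inverse c *\<^sub>C (c *\<^sub>C T) = T"
      by (rule blinfun_eqI) (simp add: False scaleC_blinfun.rep_eq)
    then have "norm T \<le> inverse (cmod c) * norm (c *\<^sub>C T)"
      using le[of "inverse c" "c *\<^sub>C T"] by (simp add: norm_inverse)
    then have "cmod c * norm T \<le> norm (c *\<^sub>C T)"
      using False by (simp add: field_simps)
    then show ?thesis using le[of c T] by simp
  qed
qed

end

section \<open>Bounded operators\<close>

text \<open>\<^type>\<open>blinfun\<close> consists of the bounded real-linear maps; the bounded operators of a complex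
  space are the complex-linear ones among them, with the same norm.\<close>

definition bounded_ops :: "('a::complex_normed_vector \<Rightarrow>\<^sub>L 'a) set" where
  "bounded_ops = {T. \<forall>c x. blinfun_apply T (c *\<^sub>C x) = c *\<^sub>C blinfun_apply T x}"

definition ker_op :: "('a::complex_normed_vector \<Rightarrow>\<^sub>L 'a) \<Rightarrow> 'a set" where
  "ker_op T = {x. blinfun_apply T x = 0}"

definition ran_op :: "('a::complex_normed_vector \<Rightarrow>\<^sub>L 'a) \<Rightarrow> 'a set" where
  "ran_op T = range (blinfun_apply T)"

definition cadjoint :: "('a::complex_hilbert_space \<Rightarrow>\<^sub>L 'a) \<Rightarrow> ('a \<Rightarrow>\<^sub>L 'a)" where
  "cadjoint T = (THE S. \<forall>x y. cinner (blinfun_apply T x) y = cinner x (blinfun_apply S y))"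

definition boundedly_invertible :: "('a::complex_normed_vector \<Rightarrow>\<^sub>L 'a) \<Rightarrow> bool" where
  "boundedly_invertible T \<longleftrightarrow>
    T \<in> bounded_ops \<and> (\<exists>S\<in>bounded_ops. S o\<^sub>L T = id_blinfun \<and> T o\<^sub>L S = id_blinfun)"

definition inverse_op :: "('a::complex_normed_vector \<Rightarrow>\<^sub>L 'a) \<Rightarrow> ('a \<Rightarrow>\<^sub>L 'a)" where
  "inverse_op T = (THE S. S o\<^sub>L T = id_blinfun \<and> T o\<^sub>L S = id_blinfun)"

definition projection_onto :: "('a::complex_normed_vector \<Rightarrow>\<^sub>L 'a) \<Rightarrow> 'a set \<Rightarrow> bool" where
  "projection_onto Q M \<longleftrightarrow> Q \<in> bounded_ops \<and> Q o\<^sub>L Q = Q \<and> ran_op Q = M"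

section \<open>Fredholm operators\<close>

text \<open>\<^term>\<open>complex_vector.dim\<close> is a natural number, and is 0 on infinite dimensional subspaces.\<close>

definition finite_cdim :: "'a::complex_normed_vector set \<Rightarrow> bool" where
  "finite_cdim S \<longleftrightarrow> (\<exists>B. finite B \<and> S \<subseteq> complex_vector.span B)"

definition orth_compl :: "'a::complex_hilbert_space set \<Rightarrow> 'a set" where
  "orth_compl M = {y. \<forall>x\<in>M. cinner x y = 0}"

definition fredholm_ops :: "('a::complex_hilbert_space \<Rightarrow>\<^sub>L 'a) set" where
  "fredholm_ops = {T \<in> bounded_ops.
     finite_cdim (ker_op T) \<and> closed (ran_op T) \<and> finite_cdim (ker_op (cadjoint T))}"

definition ind_op :: "('a::complex_hilbert_space \<Rightarrow>\<^sub>L 'a) \<Rightarrow> int" where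
  "ind_op T = int (complex_vector.dim (ker_op T)) - int (complex_vector.dim (ker_op (cadjoint T)))"

definition def_op :: "('a::complex_hilbert_space \<Rightarrow>\<^sub>L 'a) \<Rightarrow> nat" where
  "def_op T = complex_vector.dim (orth_compl (ran_op T))"

section \<open>Operator ideals\<close>

definition finite_rank_ops :: "('a::complex_normed_vector \<Rightarrow>\<^sub>L 'a) set" where
  "finite_rank_ops = {T \<in> bounded_ops. finite_cdim (ran_op T)}"

definition compact_ops :: "('a::complex_normed_vector \<Rightarrow>\<^sub>L 'a) set" where
  "compact_ops = {T \<in> bounded_ops. compact (closure (blinfun_apply T ` cball 0 1))}"

text \<open>The nonzero singular values are the positive square roots of the eigenvalues of \<open>T\<^sup>*T\<close>; the
  eigenspace dimension is the multiplicity of a singular value.\<close>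

definition sv_eigenspace :: "('a::complex_hilbert_space \<Rightarrow>\<^sub>L 'a) \<Rightarrow> real \<Rightarrow> 'a set" where
  "sv_eigenspace T s = {x. blinfun_apply (cadjoint T o\<^sub>L T) x = complex_of_real (s\<^sup>2) *\<^sub>C x}"

definition singular_values :: "('a::complex_hilbert_space \<Rightarrow>\<^sub>L 'a) \<Rightarrow> real set" where
  "singular_values T = {s. s > 0 \<and> (\<exists>x\<in>sv_eigenspace T s. x \<noteq> 0)}"

text \<open>The case \<open>p = \<infinity>\<close> is the ideal of compact operators. For finite \<open>p\<close> the \<open>p\<close>-th powers of the
  singular values, repeated according to multiplicity, are summable; multiplicities are finite
  because the operator is compact.\<close>

definition schatten_ops :: "ereal \<Rightarrow> ('a::complex_hilbert_space \<Rightarrow>\<^sub>L 'a) set" where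
  "schatten_ops p = {T \<in> compact_ops. p \<noteq> \<infinity> \<longrightarrow>
     (\<lambda>s. real (complex_vector.dim (sv_eigenspace T s)) * s powr real_of_ereal p)
       summable_on singular_values T}"

section \<open>Vector-valued analytic functions and poles\<close>

text \<open>Used for open sets only.\<close>

definition vec_analytic_on :: "(complex \<Rightarrow> 'v::complex_normed_vector) \<Rightarrow> complex set \<Rightarrow> bool" where
  "vec_analytic_on f S \<longleftrightarrow>
     (\<forall>z\<in>S. \<exists>D. ((\<lambda>w. inverse (w - z) *\<^sub>C (f w - f z)) \<longlongrightarrow> D) (at z))"

text \<open>Order \<open>n > 0\<close>: near \<open>z0\<close> the function has a norm convergent Laurent expansion whose lowest
  power is exactly \<open>(z - z0) powi (- n)\<close>. Order 0: the function extends analytically to \<open>z0\<close>.\<close>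

definition pole_of_order :: "(complex \<Rightarrow> 'v::complex_normed_vector) \<Rightarrow> complex \<Rightarrow> nat \<Rightarrow> bool" where
  "pole_of_order f z0 n \<longleftrightarrow>
    (if n = 0
     then \<exists>r>0. \<exists>g. vec_analytic_on g (ball z0 r) \<and> (\<forall>z\<in>ball z0 r - {z0}. g z = f z)
     else \<exists>r>0. \<exists>C. C 0 \<noteq> 0 \<and>
       (\<forall>z\<in>ball z0 r - {z0}. (\<lambda>k. (z - z0) powi (int k - int n) *\<^sub>C C k) sums f z))"

text \<open>\<^const>\<open>inverse_op\<close> is meaningful at invertible operators only, hence the first conjunct.\<close>

definition inverse_pole_of_order ::
    "(complex \<Rightarrow> 'a::complex_normed_vector \<Rightarrow>\<^sub>L 'a) \<Rightarrow> complex \<Rightarrow> nat \<Rightarrow> bool" where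
  "inverse_pole_of_order A z0 n \<longleftrightarrow>
    (\<forall>\<^sub>F z in at z0. boundedly_invertible (A z)) \<and> pole_of_order (\<lambda>z. inverse_op (A z)) z0 n"

definition inverse_pole :: "(complex \<Rightarrow> 'a::complex_normed_vector \<Rightarrow>\<^sub>L 'a) \<Rightarrow> complex \<Rightarrow> bool" where
  "inverse_pole A z0 \<longleftrightarrow> (\<exists>n\<ge>1. inverse_pole_of_order A z0 n)"

end

theory Submission
  imports Defs "HOL-Complex_Analysis.Complex_Analysis"
begin

text \<open>Put \<open>A\<^sub>1(z) = [Q\<^sub>1 - (z - z\<^sub>0)\<^sup>-\<^sup>1 P\<^sub>1] A(z)\<close>. Since \<open>P\<^sub>1 A(z\<^sub>0) = 0\<close>, the singularity at \<open>z\<^sub>0\<close> is removable,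
  with \<open>A\<^sub>1(z\<^sub>0) = A(z\<^sub>0) - P\<^sub>1 A'(z\<^sub>0)\<close>, a finite rank perturbation of \<open>A(z\<^sub>0)\<close>. All index statements follow
  from the fact that \<open>A(z\<^sub>0)\<close> is an invertible operator minus one of finite rank. To see this, let
  \<open>A(z)\<^sup>-\<^sup>1 = \<Sum>\<^sub>k (z - z\<^sub>0)\<^bsup>k - n\<^esup> C\<^sub>k\<close>; comparing coefficients in \<open>A(z)\<^sup>-\<^sup>1 A(z) = I\<close> shows inductively that
  \<open>C\<^sub>k A(z\<^sub>0)\<close>, hence \<open>C\<^sub>k\<close>, has finite rank for \<open>k < n\<close>, so \<open>A(z)\<^sup>-\<^sup>1 A(z\<^sub>0)\<close> is near \<open>z\<^sub>0\<close> a finite rank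
  perturbation of an operator close to \<open>I\<close>. The pole order drops because
  \<open>A\<^sub>1(z)\<^sup>-\<^sup>1 = A(z)\<^sup>-\<^sup>1 [Q\<^sub>1 - (z - z\<^sub>0) P\<^sub>1]\<close> and \<open>C\<^sub>0 Q\<^sub>1 = 0\<close>. Finally \<open>A\<^sub>1(z) - A(z)\<close> equals
  \<open>(1 + z - z\<^sub>0) P\<^sub>1 A\<^sub>1(z)\<close>, which has finite rank, so the ideal statements reduce to the stability of
  the Schatten classes under finite rank perturbations.\<close>

section \<open>Hilbert spaces\<close>

text \<open>Two obstacles shape the proof. Analyticity means differentiability in operator norm,
  whereas the removable singularity theorem is scalar; it is applied to the functions
  \<open>cinner x (f z y)\<close>, and estimates uniform in unit vectors carry the result back to
  operators. The Schatten condition sums over the set of singular values, weighted by eigenspace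
  dimensions, so there is no decreasing sequence to which Weyl's inequality could be applied
  termwise. The inequality therefore bounds the number of singular values above a threshold
  \<open>s\<close>: adding a finite rank operator raises it by at most a constant independent of
  \<open>s\<close>, and summation by parts transfers summability. No spectral decomposition enters:
  a violation produces a nonzero \<open>x\<close> with \<open>s * norm x \<le> norm (T x)\<close>
  that is orthogonal to all eigenspaces for values at least \<open>s\<close>, and maximizing on
  their orthogonal complement yields one more such eigenvector. For the deficiency, index zero
  replaces cokernels by kernels, which the factorization at \<open>z0\<close> compares.\<close>

instance complex_hilbert_space \<subseteq> banach ..

lemma scaleC_zero_left [simp]: "0 *\<^sub>C x = (0::'a::complex_normed_vector)"
  and scaleC_zero_right [simp]: "c *\<^sub>C (0::'a) = 0"
  and scaleC_one [simp]: "1 *\<^sub>C x = (x::'a)"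
  and scaleC_minus_left [simp]: "(- c) *\<^sub>C x = - (c *\<^sub>C (x::'a))"
  and scaleC_minus_right [simp]: "c *\<^sub>C (- x) = - (c *\<^sub>C (x::'a))"
  and scaleC_diff_right: "c *\<^sub>C (x - y) = c *\<^sub>C x - c *\<^sub>C (y::'a)"
  by (simp_all add: complex_vector.scale_right_diff_distrib complex_vector.scale_left_diff_distrib)

lemma bounded_bilinear_scaleC:
  "bounded_bilinear (scaleC :: complex \<Rightarrow> 'a \<Rightarrow> 'a::complex_normed_vector)"
proof (unfold_locales, goal_cases)
  case (3 r a b)
  then show ?case
    by (metis scaleC_scaleC scaleC_of_real scaleR_conv_of_real)
next
  case (4 a r b)
  then show ?case
    by (metis scaleC_scaleC scaleC_of_real mult.commute)
next
  case 5
  show ?case by (rule exI[of _ 1]) (simp add: norm_scaleC)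
qed (simp_all add: scaleC_add_left scaleC_add_right)

lemmas tendsto_scaleC [tendsto_intros] = bounded_bilinear.tendsto[OF bounded_bilinear_scaleC]

lemma cinner_zero_right [simp]: "cinner x 0 = (0::complex)"
  using cinner_scaleC_right[of x 0 0] by simp

lemma cinner_zero_left [simp]: "cinner 0 x = (0::complex)"
  using cinner_commute[of 0 x] by simp

lemma cinner_minus_right [simp]: "cinner x (- y) = - cinner x y"
  using cinner_scaleC_right[of x "-1" y] by simp

lemma cinner_diff_right: "cinner x (y - z) = cinner x y - cinner x z"
  using cinner_add_right[of x y "- z"] by simp

lemma cinner_add_left: "cinner (x + y) z = cinner x z + cinner y z"
  by (metis cinner_add_right cinner_commute complex_cnj_add)

lemma cinner_scaleC_left: "cinner (c *\<^sub>C x) y = cnj c * cinner x y"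
  by (metis cinner_scaleC_right cinner_commute complex_cnj_mult)

lemma cinner_self: "cinner x x = of_real ((norm x)\<^sup>2)"
proof -
  have "Im (cinner x x) = 0"
    by (metis cinner_commute cnj.simps(2) equal_neg_zero)
  then show ?thesis
    by (simp add: complex_eq_iff flip: inner_eq_Re_cinner power2_norm_eq_inner)
qed

lemma cinner_self_eq_0 [simp]: "cinner x x = 0 \<longleftrightarrow> x = 0"
  by (simp add: cinner_self)

lemma cinner_eq_0_commute: "cinner x y = 0 \<longleftrightarrow> cinner y x = 0"
  by (metis cinner_commute complex_cnj_zero)

lemma cinner_left_eqI: "(\<And>z. cinner z x = cinner z y) \<Longrightarrow> x = y"
  using cinner_diff_right[of "x - y" x y] by simp

lemma Cauchy_Schwarz_cinner: "cmod (cinner x y) \<le> norm x * norm y"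
proof (cases "cinner x y = 0")
  case False
  \<comment> \<open>A phase: it has modulus one and makes \<open>c * cinner x y\<close> real and
    nonnegative, so the real Cauchy-Schwarz inequality applies to \<open>x\<close> and
    \<open>c *\<^sub>C y\<close>.\<close>
  define c where "c = cnj (sgn (cinner x y))"
  have "cmod c = 1"
    using False by (simp add: c_def norm_sgn)
  have "complex_of_real (cmod (cinner x y)) = c * cinner x y"
    using False by (simp add: c_def sgn_eq field_simps power2_eq_square flip: complex_norm_square)
  then have "cmod (cinner x y) = Re (cinner x (c *\<^sub>C y))"
    by (metis cinner_scaleC_right Re_complex_of_real)
  also have "\<dots> = inner x (c *\<^sub>C y)"
    by (simp add: inner_eq_Re_cinner)
  also have "\<dots> \<le> norm x * norm (c *\<^sub>C y)"
    by (rule norm_cauchy_schwarz)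
  finally show ?thesis
    using \<open>cmod c = 1\<close> by (simp add: norm_scaleC)
qed simp

lemma bounded_bilinear_cinner: "bounded_bilinear cinner"
proof (unfold_locales, goal_cases)
  case (3 r a b)
  then show ?case
    by (metis cinner_scaleC_left complex_cnj_complex_of_real scaleC_of_real scaleR_conv_of_real)
next
  case (4 a r b)
  then show ?case
    by (metis cinner_scaleC_right scaleC_of_real scaleR_conv_of_real)
next
  case 5
  show ?case by (rule exI[of _ 1]) (simp add: Cauchy_Schwarz_cinner)
qed (simp_all add: cinner_add_left cinner_add_right)

lemmas tendsto_cinner [tendsto_intros] = bounded_bilinear.tendsto[OF bounded_bilinear_cinner]

lemma norm_add_orthogonal:
  assumes "cinner x y = 0"
  shows "(norm (x + y))\<^sup>2 = (norm x)\<^sup>2 + (norm y)\<^sup>2"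
proof -
  have "inner x y = 0" "inner y x = 0"
    using assms cinner_eq_0_commute[of x y] by (simp_all add: inner_eq_Re_cinner)
  then show ?thesis
    by (simp add: power2_norm_eq_inner inner_add_left inner_add_right)
qed

lemma csubspace_subspace: "complex_vector.subspace M \<Longrightarrow> subspace M"
  by (metis complex_vector.subspace_def scaleC_of_real subspace_def)

text \<open>A minimizing sequence is Cauchy by the parallelogram law.\<close>

lemma orthogonal_decomposition:
  fixes M :: "'a::{real_inner,complete_space} set"
  assumes "closed M" "subspace M"
  obtains y where "y \<in> M" "\<And>m. m \<in> M \<Longrightarrow> inner (x - y) m = 0"
proof -
  define f where "f m = (norm (x - m))\<^sup>2" for m
  define d where "d = Inf (f ` M)"
  have "M \<noteq> {}"
    using assms(2) subspace_0 by blast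
  have bdd: "bdd_below (f ` M)"
    by (rule bdd_belowI2[of _ 0]) (simp add: f_def)
  have d_le: "d \<le> f m" if "m \<in> M" for m
    unfolding d_def using bdd that by (intro cInf_lower) auto
  have "\<exists>m\<in>M. f m < d + 1 / Suc n" for n
    using cInf_less_iff[of "f ` M" "d + 1 / Suc n"] \<open>M \<noteq> {}\<close> bdd by (simp add: d_def[symmetric])
  then obtain y where y: "\<And>n. y n \<in> M" "\<And>n. f (y n) < d + 1 / Suc n"
    by metis
  have par: "(norm (y m - y n))\<^sup>2 \<le> 2 * (1 / Suc m + 1 / Suc n)" for m n
  proof -
    define c where "c = (1/2) *\<^sub>R (y m + y n)"
    have "c \<in> M"
      unfolding c_def by (intro subspace_scale subspace_add assms y)
    have "(norm (y m - y n))\<^sup>2 = 2 * f (y m) + 2 * f (y n) - 4 * f c"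
      unfolding f_def c_def power2_norm_eq_inner
      by (simp add: inner_diff_left inner_diff_right inner_add_left inner_add_right inner_commute
          algebra_simps)
    then show ?thesis
      using y(2)[of m] y(2)[of n] d_le[OF \<open>c \<in> M\<close>] by argo
  qed
  have "Cauchy y"
  proof (rule CauchyI)
    fix e :: real
    assume "e > 0"
    obtain N where N: "4 / e\<^sup>2 < real N"
      using reals_Archimedean2 by blast
    have "norm (y m - y n) < e" if "m \<ge> N" "n \<ge> N" for m n
    proof -
      have "N > 0"
        using N \<open>e > 0\<close> by (metis divide_nonneg_nonneg gr0I not_less of_nat_0 zero_le_numeral zero_le_power2)
      have "1 / Suc m < 1 / N" "1 / Suc n < 1 / N"
        using that \<open>N > 0\<close> by (auto simp: frac_less2)
      then have "(norm (y m - y n))\<^sup>2 < 4 / N"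
        using par[of m n] by argo
      also have "\<dots> < e\<^sup>2"
        using N \<open>e > 0\<close> \<open>N > 0\<close> by (simp add: field_simps)
      finally show ?thesis
        using \<open>e > 0\<close> by (simp add: power2_less_imp_less)
    qed
    then show "\<exists>N. \<forall>m\<ge>N. \<forall>n\<ge>N. norm (y m - y n) < e"
      by blast
  qed
  then obtain l where l: "y \<longlonglongrightarrow> l"
    using Cauchy_convergent convergentD by blast
  have "l \<in> M"
    using closed_sequentially[OF assms(1)] y(1) l by blast
  have "f l \<le> d"
  proof (rule LIMSEQ_le)
    show "(\<lambda>n. f (y n)) \<longlonglongrightarrow> f l"
      unfolding f_def by (intro tendsto_intros l)
    show "(\<lambda>n. d + 1 / Suc n) \<longlonglongrightarrow> d"
      using LIMSEQ_inverse_real_of_nat_add[of d] by (simp add: inverse_eq_divide)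
  qed (use y(2) less_imp_le in blast)
  have "inner (x - l) m = 0" if "m \<in> M" for m
  proof (rule ccontr)
    assume ne: "inner (x - l) m \<noteq> 0"
    then have "m \<noteq> 0" by auto
    \<comment> \<open>This \<open>t\<close> minimizes the quadratic polynomial
      \<open>f (l + t *\<^sub>R m)\<close>; a nonzero inner product would push its value strictly
      below the minimum \<open>f l\<close>.\<close>
    define t where "t = inner (x - l) m / inner m m"
    have "l + t *\<^sub>R m \<in> M"
      by (intro subspace_add subspace_scale assms \<open>l \<in> M\<close> that)
    then have "f l \<le> f (l + t *\<^sub>R m)"
      using d_le \<open>f l \<le> d\<close> by force
    also have "f (l + t *\<^sub>R m) = f l - 2 * t * inner (x - l) m + t\<^sup>2 * inner m m"
      unfolding f_def power2_norm_eq_inner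
      by (simp add: inner_diff_left inner_diff_right inner_add_left inner_add_right inner_commute
          algebra_simps power2_eq_square)
    also have "\<dots> = f l - (inner (x - l) m)\<^sup>2 / inner m m"
      using \<open>m \<noteq> 0\<close> by (simp add: t_def power2_eq_square field_simps)
    finally have "(inner (x - l) m)\<^sup>2 / inner m m \<le> 0"
      by simp
    moreover have "(inner (x - l) m)\<^sup>2 / inner m m > 0"
      using ne \<open>m \<noteq> 0\<close> by simp
    ultimately show False
      by simp
  qed
  then show thesis
    using that \<open>l \<in> M\<close> by blast
qed

text \<open>The choice is meaningful for closed complex subspaces, where such a \<open>y\<close>
  exists and is unique (\<open>cproj_eqI\<close>).\<close>

definition cproj :: "'a::complex_hilbert_space set \<Rightarrow> 'a \<Rightarrow> 'a" where
  "cproj M x = (SOME y. y \<in> M \<and> x - y \<in> orth_compl M)"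

lemma cproj:
  assumes "closed M" "complex_vector.subspace M"
  shows cproj_in: "cproj M x \<in> M" and cproj_orth: "x - cproj M x \<in> orth_compl M"
proof -
  obtain y where y: "y \<in> M" "\<And>m. m \<in> M \<Longrightarrow> inner (x - y) m = 0"
    using orthogonal_decomposition[OF assms(1) csubspace_subspace[OF assms(2)]] by blast
  have "cinner (x - y) m = 0" if "m \<in> M" for m
  proof -
    \<comment> \<open>The real decomposition only controls real parts; testing with
      \<open>\<i> *\<^sub>C m\<close> as well captures the imaginary part.\<close>
    have "Re (cinner (x - y) m) = 0" "Re (cinner (x - y) (\<i> *\<^sub>C m)) = 0"
      using y(2)[OF that] y(2)[OF complex_vector.subspace_scale[OF assms(2) that]]
      by (simp_all add: inner_eq_Re_cinner)
    then show ?thesis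
      by (simp add: cinner_scaleC_right complex_eq_iff)
  qed
  then have "y \<in> M \<and> x - y \<in> orth_compl M"
    using y(1) cinner_eq_0_commute by (auto simp: orth_compl_def)
  then have "cproj M x \<in> M \<and> x - cproj M x \<in> orth_compl M"
    unfolding cproj_def by (rule someI)
  then show "cproj M x \<in> M" "x - cproj M x \<in> orth_compl M"
    by auto
qed

lemma csubspace_orth_compl: "complex_vector.subspace (orth_compl M)"
  by (auto simp: complex_vector.subspace_def orth_compl_def cinner_add_right cinner_scaleC_right)

lemma closed_orth_compl: "closed (orth_compl M)"
proof -
  have "orth_compl M = (\<Inter>x\<in>M. (\<lambda>y. cinner x y) -` {0})"
    by (auto simp: orth_compl_def)
  moreover have "closed ((\<lambda>y. cinner x y) -` {0})" for x :: 'a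
    by (intro continuous_closed_vimage bounded_linear.isCont[OF
          bounded_bilinear.bounded_linear_right[OF bounded_bilinear_cinner]] continuous_ident) auto
  ultimately show ?thesis by auto
qed

lemma Int_orth_compl: "x \<in> M \<Longrightarrow> x \<in> orth_compl M \<Longrightarrow> x = 0"
  by (auto simp: orth_compl_def)

lemma cproj_eqI:
  assumes "closed M" "complex_vector.subspace M" "y \<in> M" "x - y \<in> orth_compl M"
  shows "cproj M x = y"
proof -
  have "cproj M x - y \<in> M"
    using assms cproj_in complex_vector.subspace_diff by blast
  moreover have "(x - y) - (x - cproj M x) \<in> orth_compl M"
    using assms cproj_orth complex_vector.subspace_diff[OF csubspace_orth_compl] by blast
  ultimately show ?thesis
    using Int_orth_compl[of "cproj M x - y" M] by simp
qed

lemma linear_cproj: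
  assumes "closed M" "complex_vector.subspace M"
  shows "Vector_Spaces.linear scaleC scaleC (cproj M)"
proof (unfold_locales, goal_cases)
  case (1 x y)
  have "(x - cproj M x) + (y - cproj M y) \<in> orth_compl M"
    using cproj_orth[OF assms] complex_vector.subspace_add[OF csubspace_orth_compl] by blast
  then show ?case
    using cproj_in[OF assms] complex_vector.subspace_add[OF assms(2)]
    by (intro cproj_eqI[OF assms]) (auto simp: algebra_simps)
next
  case (2 c x)
  have "c *\<^sub>C (x - cproj M x) \<in> orth_compl M"
    using cproj_orth[OF assms] complex_vector.subspace_scale[OF csubspace_orth_compl] by blast
  then show ?case
    using cproj_in[OF assms] complex_vector.subspace_scale[OF assms(2)]
    by (intro cproj_eqI[OF assms]) (auto simp: scaleC_diff_right)
qed

section \<open>Finite dimensional subspaces\<close>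

interpretation complex_vector_pair: vector_space_pair
  "scaleC :: complex \<Rightarrow> 'a \<Rightarrow> 'a::complex_normed_vector"
  "scaleC :: complex \<Rightarrow> 'b \<Rightarrow> 'b::complex_normed_vector"
  by unfold_locales

text \<open>Induction over \<open>B\<close>. If \<open>v\<close> is the component of
  \<open>b\<close> orthogonal to the old span \<open>M\<close>, then a vector lies in the new span
  exactly if subtracting its component along \<open>v\<close> leads into \<open>M\<close>. The new
  span is thus the preimage of a closed set under a continuous map.\<close>

lemma closed_cspan:
  fixes B :: "'a::complex_hilbert_space set"
  assumes "finite B"
  shows "closed (complex_vector.span B)"
  using assms
proof induction
  case (insert b B)
  define M where "M = complex_vector.span B"
  have M: "closed M" "complex_vector.subspace M"
    using insert by (simp_all add: M_def)
  define v where "v = b - cproj M b"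
  have v: "cinner v m = 0" if "m \<in> M" for m
    using cproj_orth[OF M, of b] that cinner_eq_0_commute by (auto simp: v_def orth_compl_def)
  have vb: "cinner v b = cinner v v"
    using v[OF cproj_in[OF M, of b]] by (simp add: v_def cinner_diff_right)
  show ?case
  proof (cases "v = 0")
    case True
    then have "b \<in> M"
      using cproj_in[OF M, of b] by (simp add: v_def)
    then show ?thesis
      using insert by (simp add: M_def complex_vector.span_redundant)
  next
    case False
    define g where "g x = x - (cinner v x / cinner v v) *\<^sub>C v" for x
    have g: "g x - (x - k *\<^sub>C b) \<in> M" if "k = cinner v x / cinner v v" for x k
    proof -
      have "g x - (x - k *\<^sub>C b) = k *\<^sub>C cproj M b"
        by (simp add: g_def that v_def scaleC_diff_right)
      then show ?thesis
        using M cproj_in complex_vector.subspace_scale by metis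
    qed
    have "x - k *\<^sub>C b \<in> M \<Longrightarrow> k = cinner v x / cinner v v" for x k
      using v[of "x - k *\<^sub>C b"] vb False by (simp add: cinner_diff_right cinner_scaleC_right)
    then have "(\<exists>k. x - k *\<^sub>C b \<in> M) \<longleftrightarrow> g x \<in> M" for x
      using complex_vector.subspace_add[OF M(2) g, of _ x] complex_vector.subspace_diff[OF M(2) _ g]
      by (metis diff_add_cancel diff_diff_eq2 add_diff_cancel_left')
    then have "complex_vector.span (insert b B) = g -` M"
      by (auto simp: complex_vector.span_insert M_def[symmetric])
    moreover have "isCont g x" for x
      unfolding g_def isCont_def by (intro tendsto_intros) (simp add: False)
    ultimately show ?thesis
      using M(1) by (simp add: continuous_closed_vimage)
  qed
qed simp

lemma finite_cdim_span: "finite B \<Longrightarrow> finite_cdim (complex_vector.span B)"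
  by (auto simp: finite_cdim_def)

lemma finite_cdim_subset: "finite_cdim T \<Longrightarrow> S \<subseteq> T \<Longrightarrow> finite_cdim S"
  by (auto simp: finite_cdim_def)

lemma finite_cdim_Un:
  assumes "finite_cdim S" "finite_cdim T"
  shows "finite_cdim (S \<union> T)"
proof -
  obtain B C where "finite B" "S \<subseteq> complex_vector.span B" "finite C" "T \<subseteq> complex_vector.span C"
    using assms unfolding finite_cdim_def by metis
  then have "finite (B \<union> C)" "S \<union> T \<subseteq> complex_vector.span (B \<union> C)"
    using complex_vector.span_mono[of B "B \<union> C"] complex_vector.span_mono[of C "B \<union> C"] by auto
  then show ?thesis
    unfolding finite_cdim_def by metis
qed

lemma finite_cdim_cspan: "finite_cdim S \<Longrightarrow> finite_cdim (complex_vector.span S)"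
  unfolding finite_cdim_def
  using complex_vector.span_minimal complex_vector.subspace_span by blast

lemma finite_cdim_UN:
  assumes "finite I" "\<And>i. i \<in> I \<Longrightarrow> finite_cdim (S i)"
  shows "finite_cdim (\<Union>i\<in>I. S i)"
  using assms
proof (induction rule: finite_induct)
  case empty
  then show ?case by (auto simp: finite_cdim_def)
qed (simp add: finite_cdim_Un)

lemma finite_cdim_image:
  assumes "Vector_Spaces.linear scaleC scaleC f" "finite_cdim S"
  shows "finite_cdim (f ` S)"
proof -
  obtain B where "finite B" "S \<subseteq> complex_vector.span B"
    using assms(2) by (auto simp: finite_cdim_def)
  then show ?thesis
    unfolding finite_cdim_def using complex_vector_pair.linear_span_image[OF assms(1), of B]
    by (metis finite_imageI image_mono)
qed

lemma finite_cdim_basis: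
  assumes "finite_cdim S"
  obtains B where "finite B" "B \<subseteq> S" "complex_vector.independent B"
    "S \<subseteq> complex_vector.span B" "card B = complex_vector.dim S"
proof -
  obtain B where B: "B \<subseteq> S" "complex_vector.independent B"
    "S \<subseteq> complex_vector.span B" "card B = complex_vector.dim S"
    using complex_vector.basis_exists by blast
  obtain C where "finite C" "S \<subseteq> complex_vector.span C"
    using assms by (auto simp: finite_cdim_def)
  then have "finite B"
    using complex_vector.independent_span_bound[of C B] B by blast
  then show thesis
    using that B by blast
qed

lemma cdim_mono:
  assumes "S \<subseteq> T" "finite_cdim T"
  shows "complex_vector.dim S \<le> complex_vector.dim T"
proof -
  obtain B where "finite B" "B \<subseteq> T" "complex_vector.independent B"
    "T \<subseteq> complex_vector.span B" "card B = complex_vector.dim T"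
    by (rule finite_cdim_basis[OF assms(2)])
  then show ?thesis
    using complex_vector.dim_le_card[OF order_trans[OF assms(1)], of B] by simp
qed

lemma orth_compl_cspan: "orth_compl (complex_vector.span B) = orth_compl B"
proof
  show "orth_compl B \<subseteq> orth_compl (complex_vector.span B)"
  proof
    fix y
    assume y: "y \<in> orth_compl B"
    have "cinner y x = 0" if "x \<in> complex_vector.span B" for x
      using that
    proof (induction rule: complex_vector.span_induct_alt)
      case (step c x z)
      then show ?case
        using y cinner_eq_0_commute[of y x]
        by (simp add: orth_compl_def cinner_add_right cinner_scaleC_right)
    qed simp
    then show "y \<in> orth_compl (complex_vector.span B)"
      using cinner_eq_0_commute by (auto simp: orth_compl_def)
  qed
qed (auto simp: orth_compl_def complex_vector.span_base)

section \<open>Orthonormal bases and dimension counts\<close>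

definition orthonormal :: "'a::complex_hilbert_space set \<Rightarrow> bool" where
  "orthonormal B \<longleftrightarrow> (\<forall>b\<in>B. norm b = 1) \<and> (\<forall>b\<in>B. \<forall>c\<in>B. b \<noteq> c \<longrightarrow> cinner b c = 0)"

lemma orthonormal_independent:
  assumes "orthonormal B"
  shows "complex_vector.independent B"
proof
  assume "complex_vector.dependent B"
  then obtain b where b: "b \<in> B" "b \<in> complex_vector.span (B - {b})"
    by (auto simp: complex_vector.dependent_def)
  have "b \<in> orth_compl (B - {b})"
    using assms b(1) by (auto simp: orth_compl_def orthonormal_def)
  then have "b \<in> orth_compl (complex_vector.span (B - {b}))"
    by (simp only: orth_compl_cspan)
  then have "b = 0"
    using Int_orth_compl b(2) by blast
  then show False
    using assms b(1) by (auto simp: orthonormal_def)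
qed

lemma gram_schmidt:
  fixes C :: "'a::complex_hilbert_space set"
  assumes "finite C"
  shows "\<exists>B. finite B \<and> orthonormal B \<and> complex_vector.span B = complex_vector.span C"
  using assms
proof induction
  case empty
  then show ?case by (intro exI[of _ "{}"]) (simp add: orthonormal_def)
next
  case (insert c C)
  then obtain B where B: "finite B" "orthonormal B" "complex_vector.span B = complex_vector.span C"
    by blast
  define M where "M = complex_vector.span B"
  have M: "closed M" "complex_vector.subspace M"
    unfolding M_def using closed_cspan[OF B(1)] by simp_all
  define v where "v = c - cproj M c"
  show ?case
  proof (cases "v = 0")
    case True
    then have "c \<in> complex_vector.span C"
      using cproj_in[OF M, of c] B by (simp add: v_def M_def)
    then show ?thesis
      using B by (metis complex_vector.span_redundant)
  next
    case False
    define u where "u = complex_of_real (1 / norm v) *\<^sub>C v"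
    have "v \<in> orth_compl M"
      using cproj_orth[OF M] by (simp add: v_def)
    then have "u \<in> orth_compl M"
      unfolding u_def by (intro complex_vector.subspace_scale csubspace_orth_compl)
    then have u: "cinner u b = 0" "cinner b u = 0" if "b \<in> B" for b
      using that cinner_eq_0_commute[of u b]
      by (auto simp: M_def orth_compl_def complex_vector.span_base)
    have "norm u = 1"
      using False by (simp add: u_def norm_scaleC norm_divide)
    then have "orthonormal (insert u B)"
      using B(2) u by (auto simp: orthonormal_def)
    moreover have "complex_vector.span (insert u B) = complex_vector.span (insert c C)"
    proof -
      have 1: "v = complex_of_real (norm v) *\<^sub>C u"
        using False by (simp add: u_def scaleC_scaleC)
      have "v \<in> complex_vector.span (insert u B)"
        by (subst 1) (simp add: complex_vector.span_base complex_vector.span_scale)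
      moreover have "cproj M c \<in> complex_vector.span (insert u B)"
        using cproj_in[OF M, of c] complex_vector.span_mono[of B "insert u B"] by (auto simp: M_def)
      ultimately have "c \<in> complex_vector.span (insert u B)"
        using complex_vector.span_add[of v _ "cproj M c"] by (simp add: v_def)
      moreover have "C \<subseteq> complex_vector.span (insert u B)"
        using B(3) complex_vector.span_mono[of B "insert u B"] complex_vector.span_superset[of C]
        by auto
      ultimately have "complex_vector.span (insert c C) \<subseteq> complex_vector.span (insert u B)"
        by (intro complex_vector.span_minimal) auto
      moreover have "cproj M c \<in> complex_vector.span (insert c C)"
        using cproj_in[OF M, of c] complex_vector.span_mono[of C "insert c C"] B(3)
        by (auto simp: M_def)
      then have "u \<in> complex_vector.span (insert c C)"
        unfolding u_def v_def
        by (intro complex_vector.span_scale complex_vector.span_diff)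
          (auto simp: complex_vector.span_base)
      then have "complex_vector.span (insert u B) \<subseteq> complex_vector.span (insert c C)"
        using B(3) complex_vector.span_mono[of C "insert c C"] complex_vector.span_superset[of B]
        by (intro complex_vector.span_minimal) auto
      ultimately show ?thesis by blast
    qed
    ultimately show ?thesis
      using B(1) by blast
  qed
qed

lemma orthonormal_basis:
  fixes E :: "'a::complex_hilbert_space set"
  assumes "finite_cdim E" "complex_vector.subspace E"
  obtains B where "finite B" "orthonormal B" "complex_vector.span B = E"
    "card B = complex_vector.dim E"
proof -
  obtain C where C: "finite C" "C \<subseteq> E" "complex_vector.independent C"
    "E \<subseteq> complex_vector.span C" "card C = complex_vector.dim E"
    by (rule finite_cdim_basis[OF assms(1)])
  have "complex_vector.span C = E"
    by (rule subset_antisym[OF complex_vector.span_minimal[OF C(2) assms(2)] C(4)])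
  with gram_schmidt[OF C(1)] obtain B
    where "finite B" "orthonormal B" "complex_vector.span B = E"
    by metis
  then show thesis
    using that complex_vector.dim_span_eq_card_independent orthonormal_independent by metis
qed

lemma closed_finite_cdim:
  fixes E :: "'a::complex_hilbert_space set"
  assumes "finite_cdim E" "complex_vector.subspace E"
  shows "closed E"
  using orthonormal_basis[OF assms] closed_cspan by metis

lemma cdim_image_inj:
  assumes "Vector_Spaces.linear scaleC scaleC f" "complex_vector.subspace E" "inj_on f E"
  shows "complex_vector.dim (f ` E) = complex_vector.dim E"
proof -
  obtain B where B: "B \<subseteq> E" "complex_vector.independent B" "E \<subseteq> complex_vector.span B"
    "card B = complex_vector.dim E"
    using complex_vector.basis_exists by blast
  have span: "complex_vector.span B = E"
    by (rule subset_antisym[OF complex_vector.span_minimal[OF B(1) assms(2)] B(3)])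
  have "complex_vector.independent (f ` B)"
    using complex_vector_pair.linear_independent_injective_image[OF assms(1) B(2)] assms(3) span
    by simp
  moreover have "complex_vector.span (f ` B) = f ` E"
    using complex_vector_pair.linear_span_image[OF assms(1), of B] span by simp
  ultimately have "complex_vector.dim (f ` E) = card (f ` B)"
    using complex_vector.dim_span_eq_card_independent by metis
  then show ?thesis
    using B(1,4) assms(3) card_image inj_on_subset by metis
qed

text \<open>The orthogonal complement \<open>L\<close> of the kernel inside \<open>M\<close> is
  mapped bijectively onto the image, and orthonormal bases of the kernel and of \<open>L\<close>
  together form one of \<open>M\<close>.\<close>

lemma cdim_rank_nullity:
  fixes f :: "'a::complex_hilbert_space \<Rightarrow> 'b::complex_normed_vector"
  assumes f: "Vector_Spaces.linear scaleC scaleC f"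
    and M: "complex_vector.subspace M" "finite_cdim M"
  shows "complex_vector.dim M = complex_vector.dim {x \<in> M. f x = 0} + complex_vector.dim (f ` M)"
proof -
  interpret f: Vector_Spaces.linear scaleC scaleC f by fact
  define K where "K = {x \<in> M. f x = 0}"
  define L where "L = M \<inter> orth_compl K"
  have K: "complex_vector.subspace K"
    unfolding K_def complex_vector.subspace_def
    using M(1) by (auto simp: complex_vector.subspace_def f.add f.scale f.zero)
  have L: "complex_vector.subspace L"
    unfolding L_def by (intro complex_vector.subspace_inter M csubspace_orth_compl)
  have fin: "finite_cdim K" "finite_cdim L"
    using M(2) by (auto intro: finite_cdim_subset simp: K_def L_def)
  have closed: "closed K"
    using closed_finite_cdim K fin by blast
  have dec: "cproj K x \<in> K" "x - cproj K x \<in> L" if "x \<in> M" for x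
  proof -
    show "cproj K x \<in> K"
      using cproj_in closed K by blast
    then show "x - cproj K x \<in> L"
      using cproj_orth[OF closed K, of x] that complex_vector.subspace_diff[OF M(1)]
      by (auto simp: L_def K_def)
  qed
  have "f ` M = f ` L"
  proof
    show "f ` M \<subseteq> f ` L"
    proof
      fix y assume "y \<in> f ` M"
      then obtain x where x: "x \<in> M" "y = f x" by blast
      have "f (x - cproj K x) = y"
        using dec[OF x(1)] x(2) by (simp add: f.diff K_def)
      then show "y \<in> f ` L"
        using dec[OF x(1)] by blast
    qed
  qed (auto simp: L_def)
  moreover have "inj_on f L"
  proof (rule inj_onI)
    fix x y assume "x \<in> L" "y \<in> L" "f x = f y"
    then have "x - y \<in> L" "f (x - y) = 0"
      using complex_vector.subspace_diff[OF L] by (auto simp: f.diff)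
    then show "x = y"
      using Int_orth_compl[of "x - y" K] by (simp add: K_def L_def)
  qed
  ultimately have 1: "complex_vector.dim (f ` M) = complex_vector.dim L"
    using cdim_image_inj[OF f L] by simp
  obtain B where B: "finite B" "orthonormal B" "complex_vector.span B = K"
    "card B = complex_vector.dim K"
    using orthonormal_basis fin K by metis
  obtain C where C: "finite C" "orthonormal C" "complex_vector.span C = L"
    "card C = complex_vector.dim L"
    using orthonormal_basis fin L by metis
  have BC: "cinner b c = 0" "cinner c b = 0" if "b \<in> B" "c \<in> C" for b c
  proof -
    have "b \<in> K" "c \<in> L"
      using B C that complex_vector.span_base by blast+
    then show "cinner b c = 0" "cinner c b = 0"
      using cinner_eq_0_commute[of b c] by (auto simp: L_def orth_compl_def)
  qed
  have "B \<inter> C = {}"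
    using BC B(2) by (fastforce simp: orthonormal_def)
  moreover have "orthonormal (B \<union> C)"
    using B C BC by (auto simp: orthonormal_def)
  moreover have "complex_vector.span (B \<union> C) = M"
  proof
    show "complex_vector.span (B \<union> C) \<subseteq> M"
      using B C complex_vector.span_superset M(1)
      by (intro complex_vector.span_minimal) (auto simp: K_def L_def)
    show "M \<subseteq> complex_vector.span (B \<union> C)"
    proof
      fix x assume "x \<in> M"
      then have "cproj K x \<in> complex_vector.span (B \<union> C)"
        "x - cproj K x \<in> complex_vector.span (B \<union> C)"
        using dec B(3) C(3) complex_vector.span_mono[of B "B \<union> C"]
          complex_vector.span_mono[of C "B \<union> C"] by auto
      then show "x \<in> complex_vector.span (B \<union> C)"
        using complex_vector.span_add[of "cproj K x" _ "x - cproj K x"] by simp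
    qed
  qed
  ultimately have "complex_vector.dim M = card B + card C"
    using B(1) C(1) card_Un_disjoint complex_vector.dim_span_eq_card_independent
      orthonormal_independent by metis
  then show ?thesis
    using 1 B(4) C(4) by (simp add: K_def)
qed

section \<open>Bounded operators and adjoints\<close>

lemma bounded_opsD: "T \<in> bounded_ops \<Longrightarrow> blinfun_apply T (c *\<^sub>C x) = c *\<^sub>C blinfun_apply T x"
  by (simp add: bounded_ops_def)

lemma linear_bounded_ops:
  "T \<in> bounded_ops \<Longrightarrow> Vector_Spaces.linear scaleC scaleC (blinfun_apply T)"
  by unfold_locales (simp_all add: blinfun.add_right bounded_opsD)

lemma bounded_ops_intros [intro]:
  "id_blinfun \<in> bounded_ops"
  "0 \<in> bounded_ops"
  "S \<in> bounded_ops \<Longrightarrow> T \<in> bounded_ops \<Longrightarrow> S + T \<in> bounded_ops"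
  "S \<in> bounded_ops \<Longrightarrow> T \<in> bounded_ops \<Longrightarrow> S - T \<in> bounded_ops"
  "T \<in> bounded_ops \<Longrightarrow> - T \<in> bounded_ops"
  "T \<in> bounded_ops \<Longrightarrow> c *\<^sub>C T \<in> bounded_ops"
  "S \<in> bounded_ops \<Longrightarrow> T \<in> bounded_ops \<Longrightarrow> S o\<^sub>L T \<in> bounded_ops"
  by (auto simp: bounded_ops_def blinfun.add_left blinfun.diff_left blinfun.minus_left
      scaleC_add_right scaleC_diff_right scaleC_blinfun.rep_eq scaleC_scaleC mult.commute)

lemma bounded_ops_sum: "(\<And>i. i \<in> I \<Longrightarrow> f i \<in> bounded_ops) \<Longrightarrow> sum f I \<in> bounded_ops"
  by (induction I rule: infinite_finite_induct) auto

text \<open>Laurent coefficients and derivatives arise as limits in the type of real-linear maps;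
  closedness is what makes them complex-linear.\<close>

lemma closed_bounded_ops: "closed (bounded_ops :: ('a::complex_normed_vector \<Rightarrow>\<^sub>L 'a) set)"
proof -
  have *: "bounded_ops = (\<Inter>c. \<Inter>x. (\<lambda>T :: 'a \<Rightarrow>\<^sub>L 'a. T (c *\<^sub>C x) - c *\<^sub>C T x) -` {0})"
    by (auto simp: bounded_ops_def)
  have "closed ((\<lambda>T :: 'a \<Rightarrow>\<^sub>L 'a. T (c *\<^sub>C x) - c *\<^sub>C T x) -` {0})" for c and x :: 'a
    by (rule continuous_closed_vimage) (auto simp: isCont_def intro!: tendsto_intros)
  then show ?thesis
    unfolding * by (intro closed_INT ballI)
qed

lemma blinfun_compose_simps:
  "(S + T) o\<^sub>L U = (S o\<^sub>L U) + (T o\<^sub>L U)"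
  "(S - T) o\<^sub>L U = (S o\<^sub>L U) - (T o\<^sub>L U)"
  "U o\<^sub>L (S + T) = (U o\<^sub>L S) + (U o\<^sub>L T)"
  "U o\<^sub>L (S - T) = (U o\<^sub>L S) - (U o\<^sub>L T)"
  "id_blinfun o\<^sub>L T = T" "T o\<^sub>L id_blinfun = T"
  "0 o\<^sub>L T = 0" "T o\<^sub>L 0 = 0"
  "(- S) o\<^sub>L T = - (S o\<^sub>L T)" "S o\<^sub>L (- T) = - (S o\<^sub>L T)"
  "(S o\<^sub>L T) o\<^sub>L U = S o\<^sub>L (T o\<^sub>L U)"
  by (rule blinfun_eqI, simp add: blinfun.bilinear_simps)+

lemma blinfun_compose_scaleC_left: "(c *\<^sub>C S) o\<^sub>L T = c *\<^sub>C (S o\<^sub>L T)"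
  by (rule blinfun_eqI) (simp add: scaleC_blinfun.rep_eq)

lemma blinfun_compose_scaleC_right:
  "S \<in> bounded_ops \<Longrightarrow> S o\<^sub>L (c *\<^sub>C T) = c *\<^sub>C (S o\<^sub>L T)"
  by (intro blinfun_eqI) (simp add: scaleC_blinfun.rep_eq bounded_opsD)

lemmas tendsto_blinfun_compose [tendsto_intros] =
  bounded_bilinear.tendsto[OF bounded_bilinear_blinfun_compose]

text \<open>A vector \<open>z\<close> orthogonal to the kernel with \<open>f z \<noteq> 0\<close>
  determines \<open>f\<close>: since \<open>x - (f x / f z) *\<^sub>C z\<close> lies in the kernel,
  \<open>cinner z x\<close> is a fixed multiple of \<open>f x\<close>.\<close>

lemma riesz_representation:
  fixes f :: "'a::complex_hilbert_space \<Rightarrow> complex"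
  assumes "bounded_linear f" "\<And>c x. f (c *\<^sub>C x) = c * f x"
  obtains y where "\<And>x. f x = cinner y x"
proof (cases "\<forall>x. f x = 0")
  case True
  then show thesis
    using that[of 0] by simp
next
  case False
  then obtain a where a: "f a \<noteq> 0" by blast
  interpret f: bounded_linear f by fact
  define M where "M = f -` {0}"
  have "closed M"
    unfolding M_def by (intro continuous_closed_vimage f.isCont continuous_ident) auto
  moreover have "complex_vector.subspace M"
    by (auto simp: M_def complex_vector.subspace_def f.add f.zero assms(2))
  ultimately have M: "closed M" "complex_vector.subspace M" .
  define z where "z = a - cproj M a"
  have fz: "f z \<noteq> 0"
    using cproj_in[OF M, of a] a by (simp add: z_def M_def f.diff)
  then have z0: "cinner z z \<noteq> 0"
    using f.zero by auto
  have zM: "cinner z m = 0" if "m \<in> M" for m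
    using cproj_orth[OF M, of a] that cinner_eq_0_commute by (auto simp: z_def orth_compl_def)
  have "f x = cinner (cnj (f z / cinner z z) *\<^sub>C z) x" for x
  proof -
    have "x - (f x / f z) *\<^sub>C z \<in> M"
      using fz by (simp add: M_def f.diff assms(2))
    then have "cinner z x = (f x / f z) * cinner z z"
      using zM by (force simp: cinner_diff_right cinner_scaleC_right)
    then show ?thesis
      using fz z0 by (simp add: cinner_scaleC_left)
  qed
  then show thesis
    using that by blast
qed

lemma adjoint_exists:
  fixes T :: "'a::complex_hilbert_space \<Rightarrow>\<^sub>L 'a"
  assumes "T \<in> bounded_ops"
  obtains S where "S \<in> bounded_ops" "\<And>x y. cinner (T x) y = cinner x (blinfun_apply S y)"
proof -
  have "\<exists>g. \<forall>x. cinner y (T x) = cinner g x" for y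
  proof -
    have "bounded_linear (\<lambda>x. cinner y (T x))"
      by (intro bounded_linear_compose[OF bounded_bilinear.bounded_linear_right[OF
              bounded_bilinear_cinner]] blinfun.bounded_linear_right)
    then show ?thesis
      by (rule riesz_representation[of "\<lambda>x. cinner y (T x)"])
        (auto simp: bounded_opsD[OF assms] cinner_scaleC_right)
  qed
  then obtain S where "\<And>y x. cinner y (T x) = cinner (S y) x"
    by metis
  then have S: "cinner (T x) y = cinner x (S y)" for x y
    by (metis cinner_commute)
  have add: "S (x + y) = S x + S y" for x y
    by (rule cinner_left_eqI) (simp add: cinner_add_right flip: S)
  have scale: "S (c *\<^sub>C x) = c *\<^sub>C S x" for c x
    by (rule cinner_left_eqI) (simp add: cinner_scaleC_right flip: S)
  have "norm (S y) \<le> norm y * norm T" for y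
  proof (cases "S y = 0")
    case False
    have "(norm (S y))\<^sup>2 = cmod (cinner (S y) (S y))"
      by (simp add: cinner_self norm_power)
    also have "\<dots> = cmod (cinner (T (S y)) y)"
      by (simp add: S)
    also have "\<dots> \<le> norm (T (S y)) * norm y"
      by (rule Cauchy_Schwarz_cinner)
    also have "\<dots> \<le> norm T * norm (S y) * norm y"
      by (intro mult_right_mono norm_blinfun) auto
    finally show ?thesis
      using False by (simp add: power2_eq_square algebra_simps)
  qed simp
  then have bl: "bounded_linear S"
    by (intro bounded_linear_intro add) (metis scale scaleC_of_real)
  show thesis
    by (rule that[of "Blinfun S"])
      (simp_all add: bounded_ops_def bounded_linear_Blinfun_apply[OF bl] scale S)
qed

lemma cadjoint:
  fixes T :: "'a::complex_hilbert_space \<Rightarrow>\<^sub>L 'a"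
  assumes "T \<in> bounded_ops"
  shows cinner_cadjoint: "cinner (T x) y = cinner x (cadjoint T y)"
    and cadjoint_bounded_ops: "cadjoint T \<in> bounded_ops"
proof -
  obtain S where S: "S \<in> bounded_ops" "\<And>x y. cinner (T x) y = cinner x (blinfun_apply S y)"
    using adjoint_exists[OF assms] by blast
  have "cadjoint T = S"
    unfolding cadjoint_def
  proof (rule the_equality)
    fix U :: "'a \<Rightarrow>\<^sub>L 'a"
    assume "\<forall>x y. cinner (T x) y = cinner x (U y)"
    then show "U = S"
      using S(2) by (intro blinfun_eqI cinner_left_eqI) metis
  qed (use S in blast)
  then show "cinner (T x) y = cinner x (cadjoint T y)" "cadjoint T \<in> bounded_ops"
    using S by auto
qed

lemma cinner_cadjoint': "T \<in> bounded_ops \<Longrightarrow> cinner (cadjoint T x) y = cinner x (T y)"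
  by (metis cinner_cadjoint cinner_commute)

text \<open>Through this identity the Fredholm property and the index can be read off from ranges,
  without computing adjoints.\<close>

lemma ker_cadjoint: "T \<in> bounded_ops \<Longrightarrow> ker_op (cadjoint T) = orth_compl (ran_op T)"
  using cinner_left_eqI[of _ 0]
  by (fastforce simp: ker_op_def orth_compl_def ran_op_def cinner_cadjoint)

lemma csubspace_ker_op: "T \<in> bounded_ops \<Longrightarrow> complex_vector.subspace (ker_op T)"
  by (auto simp: complex_vector.subspace_def ker_op_def blinfun.add_right bounded_opsD)

lemma csubspace_ran_op: "T \<in> bounded_ops \<Longrightarrow> complex_vector.subspace (ran_op T)"
  unfolding ran_op_def
  by (intro complex_vector_pair.linear_subspace_image linear_bounded_ops complex_vector.subspace_UNIV)

section \<open>Inverses and small perturbations of the identity\<close>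

lemma inverse_op_eqI:
  assumes "S o\<^sub>L T = id_blinfun" "T o\<^sub>L S = id_blinfun"
  shows "inverse_op T = S"
  unfolding inverse_op_def
proof (rule the_equality)
  fix U assume "U o\<^sub>L T = id_blinfun \<and> T o\<^sub>L U = id_blinfun"
  then show "U = S"
    by (metis assms(2) blinfun_compose_simps(5,6,11))
qed (use assms in blast)

lemma boundedly_invertible_inverse_op:
  assumes "boundedly_invertible T"
  shows "inverse_op T \<in> bounded_ops" "inverse_op T o\<^sub>L T = id_blinfun" "T o\<^sub>L inverse_op T = id_blinfun"
proof -
  obtain S where S: "S \<in> bounded_ops" "S o\<^sub>L T = id_blinfun" "T o\<^sub>L S = id_blinfun"
    using assms by (auto simp: boundedly_invertible_def)
  have "inverse_op T = S"
    using S(2,3) by (rule inverse_op_eqI)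
  then show "inverse_op T \<in> bounded_ops" "inverse_op T o\<^sub>L T = id_blinfun"
    "T o\<^sub>L inverse_op T = id_blinfun"
    using S by auto
qed

lemma boundedly_invertible_bounded_ops: "boundedly_invertible T \<Longrightarrow> T \<in> bounded_ops"
  by (simp add: boundedly_invertible_def)

lemma boundedly_invertible_compose:
  assumes "boundedly_invertible S" "boundedly_invertible T"
  shows "boundedly_invertible (S o\<^sub>L T)"
    and "inverse_op (S o\<^sub>L T) = inverse_op T o\<^sub>L inverse_op S"
proof -
  note S = boundedly_invertible_inverse_op[OF assms(1)]
  note T = boundedly_invertible_inverse_op[OF assms(2)]
  have *: "(inverse_op T o\<^sub>L inverse_op S) o\<^sub>L (S o\<^sub>L T) = id_blinfun"
    "(S o\<^sub>L T) o\<^sub>L (inverse_op T o\<^sub>L inverse_op S) = id_blinfun"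
    using S T by (metis blinfun_compose_simps(5,11))+
  then show "boundedly_invertible (S o\<^sub>L T)"
    unfolding boundedly_invertible_def
    using S T assms boundedly_invertible_bounded_ops by blast
  show "inverse_op (S o\<^sub>L T) = inverse_op T o\<^sub>L inverse_op S"
    using * by (rule inverse_op_eqI)
qed

text \<open>Solving \<open>x - X x = y\<close> is a fixed point problem for the contraction
  \<open>x \<mapsto> y + X x\<close>. Uniqueness of the fixed point makes the solution map linear,
  and the contraction constant bounds it.\<close>

lemma neumann:
  fixes X :: "'a::complex_hilbert_space \<Rightarrow>\<^sub>L 'a"
  assumes X: "X \<in> bounded_ops" and less: "norm X < 1"
  shows "boundedly_invertible (id_blinfun - X)"
proof -
  have "\<exists>!x. y + X x = x" for y
  proof (rule banach_fix_type)
    show "\<forall>x z. dist (y + X x) (y + X z) \<le> norm X * dist x z"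
      by (metis add_diff_cancel_left blinfun.diff_right dist_norm norm_blinfun)
  qed (use less in auto)
  then obtain g where g: "y + X (g y) = g y" and uniq: "y + X x = x \<Longrightarrow> x = g y" for x y
    by metis
  have add: "g (x + y) = g x + g y" for x y
  proof (rule uniq[symmetric])
    have "x + y + X (g x + g y) = (x + X (g x)) + (y + X (g y))"
      by (simp add: blinfun.add_right)
    then show "x + y + X (g x + g y) = g x + g y"
      by (simp only: g)
  qed
  have scale: "g (c *\<^sub>C x) = c *\<^sub>C g x" for c x
    using g[of x] by (intro uniq[symmetric]) (metis bounded_opsD[OF X] scaleC_add_right)
  have "norm (g y) \<le> norm y * (1 / (1 - norm X))" for y
  proof -
    have "norm (g y) \<le> norm y + norm X * norm (g y)"
      by (metis g norm_blinfun norm_triangle_le add_left_mono)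
    then show ?thesis
      using less by (simp add: field_simps)
  qed
  then have bl: "bounded_linear g"
    by (intro bounded_linear_intro add) (metis scale scaleC_of_real)
  note app = bounded_linear_Blinfun_apply[OF bl]
  have "Blinfun g \<in> bounded_ops"
    by (simp add: bounded_ops_def app scale)
  moreover have "Blinfun g o\<^sub>L (id_blinfun - X) = id_blinfun"
    by (rule blinfun_eqI) (simp add: app blinfun.diff_left uniq[symmetric])
  moreover have "(id_blinfun - X) o\<^sub>L Blinfun g = id_blinfun"
    using g by (intro blinfun_eqI) (simp add: app blinfun.diff_left diff_eq_eq)
  ultimately show ?thesis
    using X unfolding boundedly_invertible_def by blast
qed

section \<open>The ideal of finite rank operators\<close>

lemma finite_rank_bounded_ops: "F \<in> finite_rank_ops \<Longrightarrow> F \<in> bounded_ops"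
  by (simp add: finite_rank_ops_def)

lemma finite_rank_ops_compose_right:
  assumes "F \<in> finite_rank_ops" "T \<in> bounded_ops"
  shows "F o\<^sub>L T \<in> finite_rank_ops"
proof -
  have "ran_op (F o\<^sub>L T) \<subseteq> ran_op F"
    by (auto simp: ran_op_def)
  then have "finite_cdim (ran_op (F o\<^sub>L T))"
    using assms(1) finite_cdim_subset[of "ran_op F"] by (simp add: finite_rank_ops_def)
  then show ?thesis
    using assms by (auto simp: finite_rank_ops_def)
qed

lemma finite_rank_ops_compose_left:
  assumes "F \<in> finite_rank_ops" "T \<in> bounded_ops"
  shows "T o\<^sub>L F \<in> finite_rank_ops"
proof -
  have "ran_op (T o\<^sub>L F) = blinfun_apply T ` ran_op F"
    by (auto simp: ran_op_def)
  then have "finite_cdim (ran_op (T o\<^sub>L F))"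
    using assms(1) finite_cdim_image[OF linear_bounded_ops[OF assms(2)]]
    by (simp add: finite_rank_ops_def)
  then show ?thesis
    using assms by (auto simp: finite_rank_ops_def)
qed

lemma finite_rank_ops_ranI:
  assumes "T \<in> bounded_ops" "finite_cdim M" "\<And>x. blinfun_apply T x \<in> complex_vector.span M"
  shows "T \<in> finite_rank_ops"
  using assms(1,3) finite_cdim_subset[OF finite_cdim_cspan[OF assms(2)], of "ran_op T"]
  by (simp add: finite_rank_ops_def ran_op_def image_subset_iff)

lemma finite_rank_ops_add:
  assumes "F \<in> finite_rank_ops" "G \<in> finite_rank_ops"
  shows "F + G \<in> finite_rank_ops"
proof (rule finite_rank_ops_ranI)
  show "finite_cdim (ran_op F \<union> ran_op G)"
    using assms by (auto simp: finite_rank_ops_def intro: finite_cdim_Un)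
  show "blinfun_apply (F + G) x \<in> complex_vector.span (ran_op F \<union> ran_op G)" for x
    unfolding blinfun.add_left ran_op_def
    by (intro complex_vector.span_add complex_vector.span_base) auto
qed (use assms finite_rank_bounded_ops in blast)

lemma finite_rank_ops_scaleC: "F \<in> finite_rank_ops \<Longrightarrow> c *\<^sub>C F \<in> finite_rank_ops"
proof (rule finite_rank_ops_ranI)
  show "F \<in> finite_rank_ops \<Longrightarrow> finite_cdim (ran_op F)"
    by (simp add: finite_rank_ops_def)
  show "blinfun_apply (c *\<^sub>C F) x \<in> complex_vector.span (ran_op F)" for x
    unfolding scaleC_blinfun.rep_eq ran_op_def
    by (intro complex_vector.span_scale complex_vector.span_base) auto
qed (use finite_rank_bounded_ops in blast)

lemma finite_rank_ops_uminus: "F \<in> finite_rank_ops \<Longrightarrow> - F \<in> finite_rank_ops"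
  using finite_rank_ops_scaleC[of F "-1"] by simp

lemma zero_finite_rank_ops: "0 \<in> finite_rank_ops"
  by (rule finite_rank_ops_ranI[of _ "{}"]) (auto simp: finite_cdim_def)

lemma finite_rank_ops_sum:
  "(\<And>i. i \<in> I \<Longrightarrow> f i \<in> finite_rank_ops) \<Longrightarrow> sum f I \<in> finite_rank_ops"
  by (induction I rule: infinite_finite_induct)
    (simp_all add: zero_finite_rank_ops finite_rank_ops_add)

section \<open>Fredholm operators of index zero\<close>

text \<open>The range of \<open>T = I - F\<close> is the preimage under \<open>F\<close> of \<open>T M\<close>, where \<open>M = ran F\<close> is invariant
  under \<open>T\<close>; both the kernel and the cokernel of \<open>T\<close> are those of its restriction to \<open>M\<close>.\<close>

lemma id_minus_finite_rank:
  fixes F :: "'a::complex_hilbert_space \<Rightarrow>\<^sub>L 'a"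
  assumes "F \<in> finite_rank_ops"
  defines "T \<equiv> id_blinfun - F"
  shows "finite_cdim (ker_op T)" "closed (ran_op T)" "finite_cdim (orth_compl (ran_op T))"
    "complex_vector.dim (ker_op T) = complex_vector.dim (orth_compl (ran_op T))"
proof -
  have F: "F \<in> bounded_ops"
    using assms(1) by (rule finite_rank_bounded_ops)
  then have T: "T \<in> bounded_ops"
    unfolding T_def by blast
  have Tx: "T x = x - F x" for x
    by (simp add: T_def blinfun.diff_left)
  define M where "M = ran_op F"
  have M: "complex_vector.subspace M" "finite_cdim M"
    using assms(1) csubspace_ran_op[OF F] by (auto simp: M_def finite_rank_ops_def)
  have FM: "F x \<in> M" for x
    by (simp add: M_def ran_op_def)
  have ker: "ker_op T = {x \<in> M. T x = 0}"
    using FM by (auto simp: ker_op_def Tx) (metis)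
  then show "finite_cdim (ker_op T)"
    using finite_cdim_subset[OF M(2)] by auto
  define N where "N = blinfun_apply T ` M"
  have N: "complex_vector.subspace N" "finite_cdim N"
    unfolding N_def using M linear_bounded_ops[OF T]
    by (auto intro: complex_vector_pair.linear_subspace_image finite_cdim_image)
  have ran: "ran_op T = blinfun_apply F -` N"
  proof (intro set_eqI iffI)
    fix y assume "y \<in> ran_op T"
    then obtain x where "y = T x"
      by (auto simp: ran_op_def)
    then have "F y = T (F x)"
      by (simp add: Tx blinfun.diff_right)
    then show "y \<in> blinfun_apply F -` N"
      using FM by (auto simp: N_def)
  next
    fix y assume "y \<in> blinfun_apply F -` N"
    then obtain m where "F y = T m"
      by (auto simp: N_def)
    \<comment> \<open>Indeed \<open>T y = y - F y = y - T m\<close>.\<close>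
    then have "y = T (y + m)"
      by (simp add: Tx[of y] blinfun.add_right)
    then show "y \<in> ran_op T"
      by (metis ran_op_def rangeI)
  qed
  show closed: "closed (ran_op T)"
    unfolding ran using closed_finite_cdim[OF N(2,1)]
    by (intro continuous_closed_vimage blinfun.isCont continuous_ident) auto
  define R where "R = ran_op T"
  have R: "closed R" "complex_vector.subspace R"
    using closed csubspace_ran_op[OF T] by (simp_all add: R_def)
  interpret c: Vector_Spaces.linear scaleC scaleC "cproj R"
    by (rule linear_cproj[OF R])
  define p where "p x = x - cproj R x" for x
  have p: "Vector_Spaces.linear scaleC scaleC p"
    by unfold_locales (simp_all add: p_def c.add c.scale scaleC_diff_right)
  interpret p: Vector_Spaces.linear scaleC scaleC p by fact
  have p0: "p x = 0 \<longleftrightarrow> x \<in> R" for x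
    using cproj_in[OF R, of x] cproj_eqI[OF R, of x x]
      complex_vector.subspace_0[OF csubspace_orth_compl[of R]] by (auto simp: p_def)
  \<comment> \<open>Modulo the range \<open>R\<close> every \<open>y\<close> equals
    \<open>F y\<close>, because the difference is \<open>T y\<close>; hence \<open>p\<close> already
    attains all its values on \<open>M\<close>.\<close>
  have "orth_compl R = p ` M"
  proof (intro set_eqI iffI)
    fix y assume "y \<in> orth_compl R"
    then have "cproj R y = 0"
      using complex_vector.subspace_0[OF R(2)] by (intro cproj_eqI[OF R]) auto
    then have "y = p (T y + F y)"
      by (simp add: Tx p_def)
    also have "\<dots> = p (F y)"
      using p0[of "T y"] by (simp add: p.add R_def ran_op_def)
    finally show "y \<in> p ` M"
      using FM by blast
  next
    fix y assume "y \<in> p ` M"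
    then show "y \<in> orth_compl R"
      using cproj_orth[OF R] by (auto simp: p_def)
  qed
  moreover have "{x \<in> M. p x = 0} = N"
  proof (intro set_eqI iffI)
    fix x assume "x \<in> {x \<in> M. p x = 0}"
    then obtain y where y: "x = T y" "x \<in> M"
      by (auto simp: p0 R_def ran_op_def)
    then have "x + F y \<in> M"
      using FM complex_vector.subspace_add[OF M(1)] by blast
    then show "x \<in> N"
      using y by (auto simp: N_def Tx)
  next
    fix x assume "x \<in> N"
    then obtain m where "m \<in> M" "x = T m"
      by (auto simp: N_def)
    then show "x \<in> {x \<in> M. p x = 0}"
      using FM complex_vector.subspace_diff[OF M(1)] by (auto simp: p0 R_def ran_op_def Tx)
  qed
  \<comment> \<open>Rank-nullity is used twice on \<open>M\<close>: for \<open>p\<close>, whose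
    kernel is \<open>N\<close>, and for \<open>T\<close>, whose image is \<open>N\<close>.
    Deficiency and nullity of \<open>T\<close> both come out as
    \<open>dim M - dim N\<close>.\<close>
  ultimately have "complex_vector.dim M = complex_vector.dim N + complex_vector.dim (orth_compl R)"
    using cdim_rank_nullity[OF p M] by simp
  moreover have "complex_vector.dim M = complex_vector.dim (ker_op T) + complex_vector.dim N"
    using cdim_rank_nullity[OF linear_bounded_ops[OF T] M] by (simp add: ker N_def)
  ultimately show "complex_vector.dim (ker_op T) = complex_vector.dim (orth_compl (ran_op T))"
    by (simp add: R_def)
  show "finite_cdim (orth_compl (ran_op T))"
    using \<open>orth_compl R = p ` M\<close> finite_cdim_image[OF p M(2)] by (simp add: R_def)
qed

text \<open>Factoring out \<open>V\<close> on the right gives \<open>V - F = (I - G) V\<close> with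
  \<open>G\<close> of finite rank. The range is that of \<open>I - G\<close>, and the inverse of
  \<open>V\<close> carries the kernel of \<open>I - G\<close> isomorphically onto the kernel of
  \<open>V - F\<close>.\<close>

lemma invertible_minus_finite_rank:
  fixes V :: "'a::complex_hilbert_space \<Rightarrow>\<^sub>L 'a"
  assumes V: "boundedly_invertible V" and F: "F \<in> finite_rank_ops"
  shows "V - F \<in> fredholm_ops" "ind_op (V - F) = 0"
proof -
  note inv = boundedly_invertible_inverse_op[OF V]
  define G where "G = F o\<^sub>L inverse_op V"
  have G: "G \<in> finite_rank_ops"
    unfolding G_def using F inv(1) by (rule finite_rank_ops_compose_right)
  define T where "T = id_blinfun - G"
  have T: "T \<in> bounded_ops"
    unfolding T_def using finite_rank_bounded_ops[OF G] by blast
  have TV: "V - F = T o\<^sub>L V"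
    by (simp add: T_def G_def blinfun_compose_simps inv)
  have b: "V - F \<in> bounded_ops"
    unfolding TV using T boundedly_invertible_bounded_ops[OF V] by blast
  have Vx: "V (inverse_op V x) = x" "inverse_op V (V x) = x" for x
    using inv by (metis blinfun_apply_blinfun_compose blinfun_apply_id_blinfun)+
  have ran: "ran_op (V - F) = ran_op T"
  proof -
    have "range (\<lambda>x. T (V x)) = range (blinfun_apply T)"
      by (auto, metis Vx(1) rangeI)
    then show ?thesis
      by (simp add: TV ran_op_def)
  qed
  have ker: "ker_op (V - F) = blinfun_apply (inverse_op V) ` ker_op T"
    using Vx by (auto simp: TV ker_op_def image_iff) metis
  have "inj_on (blinfun_apply (inverse_op V)) (ker_op T)"
    using Vx by (metis inj_onI)
  then have dim: "complex_vector.dim (ker_op (V - F)) = complex_vector.dim (ker_op T)"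
    unfolding ker by (intro cdim_image_inj linear_bounded_ops inv csubspace_ker_op T)
  note T_props = id_minus_finite_rank[OF G, folded T_def]
  show "V - F \<in> fredholm_ops"
    using b T_props finite_cdim_image[OF linear_bounded_ops[OF inv(1)] T_props(1)]
    by (simp add: fredholm_ops_def ker_cadjoint[OF b] ran) (simp add: ker)
  show "ind_op (V - F) = 0"
    by (simp add: ind_op_def ker_cadjoint[OF b] ran dim T_props)
qed

lemma boundedly_invertible_ind_0:
  fixes V :: "'a::complex_hilbert_space \<Rightarrow>\<^sub>L 'a"
  shows "boundedly_invertible V \<Longrightarrow> ind_op V = 0"
  using invertible_minus_finite_rank(2)[of V 0] zero_finite_rank_ops by simp

text \<open>This serves \<open>A1 z\<close> for \<open>z \<noteq> z0\<close>. The kernel is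
  unchanged, the range is a preimage under the inverse of \<open>U\<close>, and the complement of
  the new range is contained in the image of the old one under the adjoint \<open>W\<close> of that
  inverse.\<close>

lemma fredholm_compose_invertible:
  fixes U :: "'a::complex_hilbert_space \<Rightarrow>\<^sub>L 'a"
  assumes U: "boundedly_invertible U" and T: "T \<in> fredholm_ops"
  shows "U o\<^sub>L T \<in> fredholm_ops"
proof -
  note inv = boundedly_invertible_inverse_op[OF U]
  have Ux: "U (inverse_op U x) = x" "inverse_op U (U x) = x" for x
    using inv by (metis blinfun_apply_blinfun_compose blinfun_apply_id_blinfun)+
  have bT: "T \<in> bounded_ops" and bU: "U \<in> bounded_ops"
    using T U boundedly_invertible_bounded_ops by (auto simp: fredholm_ops_def)
  then have b: "U o\<^sub>L T \<in> bounded_ops"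
    by blast
  have "U x = 0 \<longleftrightarrow> x = 0" for x
    by (metis Ux(2) blinfun.zero_right)
  then have ker: "ker_op (U o\<^sub>L T) = ker_op T"
    by (simp add: ker_op_def)
  have "ran_op (U o\<^sub>L T) = blinfun_apply (inverse_op U) -` ran_op T"
    using Ux by (auto simp: ran_op_def image_iff) metis
  then have closed: "closed (ran_op (U o\<^sub>L T))"
    using T by (simp add: fredholm_ops_def continuous_closed_vimage blinfun.isCont)
  define W where "W = cadjoint (inverse_op U)"
  have W: "W \<in> bounded_ops"
    unfolding W_def using inv(1) by (rule cadjoint_bounded_ops)
  have "y \<in> blinfun_apply W ` orth_compl (ran_op T)" if "y \<in> orth_compl (ran_op (U o\<^sub>L T))" for y
  proof
    show "y = W (cadjoint U y)"
      by (rule cinner_left_eqI)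
        (simp add: W_def Ux flip: cinner_cadjoint[OF bU] cinner_cadjoint[OF inv(1)])
    show "cadjoint U y \<in> orth_compl (ran_op T)"
      using that by (auto simp: orth_compl_def ran_op_def simp flip: cinner_cadjoint[OF bU])
  qed
  then have "finite_cdim (orth_compl (ran_op (U o\<^sub>L T)))"
    using T finite_cdim_subset[OF finite_cdim_image[OF linear_bounded_ops[OF W]]]
    by (metis (no_types, lifting) bT fredholm_ops_def ker_cadjoint mem_Collect_eq subsetI)
  then show ?thesis
    using T closed b by (simp add: fredholm_ops_def ker ker_cadjoint[OF b])
qed

section \<open>Operator-valued analytic functions\<close>

lemma vec_analytic_on_isCont:
  assumes "vec_analytic_on f S" "z \<in> S"
  shows "isCont f z"
proof -
  obtain D where D: "((\<lambda>w. inverse (w - z) *\<^sub>C (f w - f z)) \<longlongrightarrow> D) (at z)"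
    using assms by (auto simp: vec_analytic_on_def)
  have "((\<lambda>w. (w - z) *\<^sub>C (inverse (w - z) *\<^sub>C (f w - f z))) \<longlongrightarrow> 0) (at z)"
    by (rule tendsto_eq_intros D refl)+ simp
  then have "((\<lambda>w. f w - f z) \<longlongrightarrow> 0) (at z)"
    by (rule Lim_transform_eventually)
      (auto simp: eventually_at_filter scaleC_scaleC)
  then show ?thesis
    by (simp add: isCont_def LIM_zero_iff)
qed

lemma vec_analytic_on_functional:
  assumes f: "vec_analytic_on f S" "open S"
    and \<phi>: "bounded_linear \<phi>" "\<And>c v. \<phi> (c *\<^sub>C v) = c * \<phi> v"
  shows "(\<lambda>z. \<phi> (f z)) holomorphic_on S"
proof -
  interpret \<phi>: bounded_linear \<phi> by fact
  have "(\<lambda>z. \<phi> (f z)) field_differentiable (at z)" if z: "z \<in> S" for z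
  proof -
    obtain D where "((\<lambda>w. inverse (w - z) *\<^sub>C (f w - f z)) \<longlongrightarrow> D) (at z)"
      using f(1) z by (auto simp: vec_analytic_on_def)
    then have "((\<lambda>w. \<phi> (inverse (w - z) *\<^sub>C (f w - f z))) \<longlongrightarrow> \<phi> D) (at z)"
      by (rule \<phi>.tendsto)
    then have "((\<lambda>z. \<phi> (f z)) has_field_derivative \<phi> D) (at z)"
      by (simp add: has_field_derivative_iff \<phi>(2) \<phi>.diff divide_inverse mult.commute)
    then show ?thesis
      by (auto simp: field_differentiable_def)
  qed
  then show ?thesis
    by (simp add: holomorphic_on_def field_differentiable_at_within)
qed

lemma holomorphic_on_cinner_blinfun:
  fixes f :: "complex \<Rightarrow> 'a::complex_hilbert_space \<Rightarrow>\<^sub>L 'a"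
  assumes "vec_analytic_on f S" "open S"
  shows "(\<lambda>z. cinner x (f z y)) holomorphic_on S"
proof (rule vec_analytic_on_functional[OF assms])
  show "bounded_linear (\<lambda>T :: 'a \<Rightarrow>\<^sub>L 'a. cinner x (T y))"
    by (intro bounded_linear_compose[OF bounded_bilinear.bounded_linear_right[OF
            bounded_bilinear_cinner]] blinfun.bounded_linear_left)
qed (simp add: scaleC_blinfun.rep_eq cinner_scaleC_right)

lemma norm_blinfun_le_cinner:
  fixes T :: "'a::complex_hilbert_space \<Rightarrow>\<^sub>L 'a"
  assumes "c \<ge> 0" "\<And>x y. cmod (cinner x (T y)) \<le> c * norm x * norm y"
  shows "norm T \<le> c"
proof (rule norm_blinfun_bound[OF assms(1)])
  fix y
  have "norm (T y) * norm (T y) \<le> norm (T y) * (c * norm y)"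
    using assms(2)[of "T y" y] by (simp add: cinner_self power2_eq_square norm_mult mult.assoc mult.left_commute)
  then show "norm (T y) \<le> c * norm y"
    using assms(1) by (cases "T y = 0") auto
qed

text \<open>First order Taylor expansion, with the second derivative bounded by Cauchy's inequality
  on discs of radius \<open>r / 3\<close>; these stay inside the given ball, and \<open>18\<close>
  is \<open>2! * 3 ^ 2\<close>. What matters is that \<open>h\<close> enters the bound only through
  the factor \<open>B\<close>, which makes the estimate uniform over families of functions.\<close>

lemma difference_quotient_bound:
  assumes h: "h holomorphic_on ball z0 r" and B: "\<And>z. z \<in> ball z0 r \<Longrightarrow> cmod (h z) \<le> B"
    and w: "w \<in> ball z0 (r / 3)" "w \<noteq> z0"
  shows "cmod ((h w - h z0) / (w - z0) - deriv h z0) \<le> 18 * B / r\<^sup>2 * cmod (w - z0)"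
proof -
  have r: "r > 0"
    using w zero_le_dist[of z0 w] by (auto simp del: zero_le_dist)
  have bound: "cmod ((deriv ^^ 2) h z) \<le> 18 * B / r\<^sup>2" if "z \<in> ball z0 (r / 3)" for z
  proof -
    have sub: "cball z (r / 3) \<subseteq> ball z0 r"
    proof
      fix u assume "u \<in> cball z (r / 3)"
      then show "u \<in> ball z0 r"
        using that dist_triangle[of z0 u z] r by simp
    qed
    have "cmod ((deriv ^^ 2) h z) \<le> fact 2 * B / (r / 3) ^ 2"
    proof (rule Cauchy_inequality)
      show "h holomorphic_on ball z (r / 3)"
        using h sub by (meson ball_subset_cball holomorphic_on_subset order_trans)
      show "continuous_on (cball z (r / 3)) h"
        using h sub by (meson holomorphic_on_imp_continuous_on holomorphic_on_subset)
      show "cmod (h x) \<le> B" if "cmod (z - x) = r / 3" for x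
        using B sub that by (simp add: subset_iff dist_norm)
    qed (use r in simp)
    then show ?thesis
      by (simp add: power_divide fact_numeral)
  qed
  have hol: "(deriv ^^ n) h holomorphic_on ball z0 r" for n
    using h by (intro holomorphic_higher_deriv) auto
  have "cmod (h w - (\<Sum>i\<le>1. (deriv ^^ i) h z0 * (w - z0) ^ i / fact i))
    \<le> 18 * B / r\<^sup>2 * cmod (w - z0) ^ Suc 1 / fact 1"
  proof (rule complex_Taylor[where f = "\<lambda>n. (deriv ^^ n) h" and S = "ball z0 (r / 3)" and n = 1,
        simplified funpow_0])
    show "((deriv ^^ i) h has_field_derivative (deriv ^^ Suc i) h x) (at x within ball z0 (r / 3))"
      if "x \<in> ball z0 (r / 3)" for x i
      using holomorphic_derivI[OF hol[of i] open_ball, of x] that r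
      by (auto intro: DERIV_subset)
  qed (use bound w r in \<open>auto simp: numeral_2_eq_2\<close>)
  then have "cmod (h w - h z0 - deriv h z0 * (w - z0)) \<le> 18 * B / r\<^sup>2 * cmod (w - z0) ^ 2"
    by (simp add: diff_diff_eq numeral_2_eq_2)
  moreover have "h w - h z0 - deriv h z0 * (w - z0) = ((h w - h z0) / (w - z0) - deriv h z0) * (w - z0)"
    using w(2) by (simp add: field_simps)
  ultimately have "cmod ((h w - h z0) / (w - z0) - deriv h z0) * cmod (w - z0)
      \<le> (18 * B / r\<^sup>2) * (cmod (w - z0))\<^sup>2"
    by (simp only: norm_mult)
  also have "\<dots> = (18 * B / r\<^sup>2 * cmod (w - z0)) * cmod (w - z0)"
    by (simp only: power2_eq_square[of "cmod (w - z0)"] mult.assoc)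
  finally show ?thesis
    by (rule mult_right_le_imp_le) (use w(2) in simp)
qed

text \<open>The difference quotients of all functions \<open>z \<mapsto> \<langle>x, f z y\<rangle>\<close> converge at a rate that is uniform in
  unit vectors \<open>x\<close> and \<open>y\<close>, so the operator difference quotients are Cauchy.\<close>

lemma weakly_holomorphic_imp_differentiable:
  fixes f :: "complex \<Rightarrow> 'a::complex_hilbert_space \<Rightarrow>\<^sub>L 'a"
  assumes r: "r > 0" and M: "\<And>z. z \<in> ball z0 r \<Longrightarrow> norm (f z) \<le> M"
    and hol: "\<And>x y. (\<lambda>z. cinner x (f z y)) holomorphic_on ball z0 r"
  shows "\<exists>D. ((\<lambda>w. inverse (w - z0) *\<^sub>C (f w - f z0)) \<longlongrightarrow> D) (at z0)"
proof -
  define q where "q w = inverse (w - z0) *\<^sub>C (f w - f z0)" for w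
  define K where "K = 18 * M / r\<^sup>2"
  have "M \<ge> 0"
    using M[of z0] r norm_ge_zero order_trans by (metis centre_in_ball)
  then have "K \<ge> 0"
    by (simp add: K_def)
  have q: "norm (q w - q z) \<le> K * (cmod (w - z0) + cmod (z - z0))"
    if w: "w \<in> ball z0 (r / 3)" "w \<noteq> z0" and z: "z \<in> ball z0 (r / 3)" "z \<noteq> z0" for w z
  proof (rule norm_blinfun_le_cinner)
    fix x y
    define h where "h u = cinner x (f u y)" for u
    have h: "h holomorphic_on ball z0 r"
      unfolding h_def by (rule hol)
    have hB: "cmod (h u) \<le> M * (norm x * norm y)" if "u \<in> ball z0 r" for u
    proof -
      have "cmod (h u) \<le> norm x * norm (f u y)"
        unfolding h_def by (rule Cauchy_Schwarz_cinner)
      also have "\<dots> \<le> norm x * (norm (f u) * norm y)"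
        by (intro mult_left_mono norm_blinfun) auto
      also have "\<dots> \<le> norm x * (M * norm y)"
        by (intro mult_left_mono mult_right_mono M that) auto
      finally show ?thesis
        by (simp add: algebra_simps)
    qed
    have qh: "cinner x (q u y) = (h u - h z0) / (u - z0)" for u
      by (simp add: q_def h_def scaleC_blinfun.rep_eq blinfun.diff_left cinner_scaleC_right
          cinner_diff_right divide_inverse mult.commute)
    have "cmod (cinner x (blinfun_apply (q w - q z) y))
        = cmod ((cinner x (q w y) - deriv h z0) - (cinner x (q z y) - deriv h z0))"
      by (simp add: blinfun.diff_left cinner_diff_right)
    also have "\<dots> \<le> cmod (cinner x (q w y) - deriv h z0) + cmod (cinner x (q z y) - deriv h z0)"
      by (rule norm_triangle_ineq4)
    also have "\<dots> \<le> 18 * (M * (norm x * norm y)) / r\<^sup>2 * cmod (w - z0)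
        + 18 * (M * (norm x * norm y)) / r\<^sup>2 * cmod (z - z0)"
      unfolding qh by (intro add_mono difference_quotient_bound[OF h hB] w z)
    finally show "cmod (cinner x (blinfun_apply (q w - q z) y))
        \<le> K * (cmod (w - z0) + cmod (z - z0)) * norm x * norm y"
      by (simp add: K_def algebra_simps add_divide_distrib)
  qed (use \<open>K \<ge> 0\<close> in simp)
  \<comment> \<open>An auxiliary sequence tending to \<open>z0\<close>, used to produce the limit
    from completeness. The double successor keeps every term strictly inside the ball of radius
    \<open>r / 3\<close>.\<close>
  define u where "u n = z0 + of_real (r / 3 * inverse (real (Suc (Suc n))))" for n
  have du: "cmod (u n - z0) = r / 3 * inverse (real (Suc (Suc n)))" for n
    unfolding u_def using r by (simp only: add_diff_cancel_left' norm_of_real) simp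
  have u: "u n \<in> ball z0 (r / 3)" "u n \<noteq> z0" for n
  proof -
    have "r / 3 * inverse (real (Suc (Suc n))) < r / 3 * 1"
      using r by (intro mult_strict_left_mono) (auto simp: field_simps)
    then show "u n \<in> ball z0 (r / 3)"
      using du[of n] by (simp add: dist_norm norm_minus_commute)
    show "u n \<noteq> z0"
      using du[of n] r by auto
  qed
  have u0: "(\<lambda>n. cmod (u n - z0)) \<longlonglongrightarrow> 0"
    unfolding du using tendsto_mult_right_zero[OF LIMSEQ_Suc[OF LIMSEQ_inverse_real_of_nat]] by blast
  have "Cauchy (\<lambda>n. q (u n))"
  proof (rule CauchyI)
    fix e :: real
    assume "e > 0"
    \<comment> \<open>\<open>K\<close> may be zero, so the threshold is divided by
      \<open>K + 1\<close>.\<close>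
    then have "e / (2 * (K + 1)) > 0"
      using \<open>K \<ge> 0\<close> by simp
    then obtain N where N: "\<And>n. n \<ge> N \<Longrightarrow> cmod (u n - z0) < e / (2 * (K + 1))"
      using LIMSEQ_D[OF u0] by force
    have "norm (q (u m) - q (u n)) < e" if "m \<ge> N" "n \<ge> N" for m n
    proof -
      have "norm (q (u m) - q (u n)) \<le> K * (cmod (u m - z0) + cmod (u n - z0))"
        by (intro q u)
      also have "\<dots> \<le> (K + 1) * (cmod (u m - z0) + cmod (u n - z0))"
        by (intro mult_right_mono) auto
      also have "\<dots> < (K + 1) * (e / (2 * (K + 1)) + e / (2 * (K + 1)))"
        using \<open>K \<ge> 0\<close> that by (intro mult_strict_left_mono add_strict_mono N) auto
      also have "\<dots> = e"
      proof -
        have *: "c * (e / (2 * c) + e / (2 * c)) = e" if "c > 0" for c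
          using that by (simp add: field_simps)
        show ?thesis
          by (rule *) (use \<open>K \<ge> 0\<close> in simp)
      qed
      finally show ?thesis .
    qed
    then show "\<exists>N. \<forall>m\<ge>N. \<forall>n\<ge>N. norm (q (u m) - q (u n)) < e"
      by blast
  qed
  then obtain D where D: "(\<lambda>n. q (u n)) \<longlonglongrightarrow> D"
    using Cauchy_convergent convergentD by blast
  \<comment> \<open>Letting the second argument of the estimate \<open>q\<close> run along
    \<open>u\<close> turns convergence along one sequence into convergence at a linear rate for all
    \<open>w\<close>.\<close>
  have qD: "norm (q w - D) \<le> K * cmod (w - z0)" if "w \<in> ball z0 (r / 3)" "w \<noteq> z0" for w
  proof (rule LIMSEQ_le)
    show "(\<lambda>n. norm (q w - q (u n))) \<longlonglongrightarrow> norm (q w - D)"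
      by (intro tendsto_intros D)
    show "(\<lambda>n. K * (cmod (w - z0) + cmod (u n - z0))) \<longlonglongrightarrow> K * cmod (w - z0)"
      by (rule tendsto_eq_intros u0 refl)+ simp
  qed (use q that u in blast)
  have "((\<lambda>w. q w - D) \<longlongrightarrow> 0) (at z0)"
  proof (rule Lim_null_comparison)
    show "\<forall>\<^sub>F w in at z0. norm (q w - D) \<le> K * cmod (w - z0)"
      unfolding eventually_at using qD r
      by (intro exI[of _ "r / 3"]) (auto simp: dist_norm norm_minus_commute)
    show "((\<lambda>w. K * cmod (w - z0)) \<longlongrightarrow> 0) (at z0)"
      by (rule tendsto_eq_intros refl)+ simp
  qed
  then show ?thesis
    unfolding q_def by (auto simp: LIM_zero_iff)
qed

text \<open>Scalar holomorphy together with a local norm bound gives norm analyticity, since the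
  norm bound makes the scalar estimates uniform. Both the removable singularity and the power series
  below pass through this criterion.\<close>

lemma vec_analytic_onI_weak:
  fixes f :: "complex \<Rightarrow> 'a::complex_hilbert_space \<Rightarrow>\<^sub>L 'a"
  assumes S: "open S" and hol: "\<And>x y. (\<lambda>z. cinner x (f z y)) holomorphic_on S"
    and bdd: "\<And>z. z \<in> S \<Longrightarrow> \<exists>M. \<forall>\<^sub>F w in nhds z. norm (f w) \<le> M"
  shows "vec_analytic_on f S"
  unfolding vec_analytic_on_def
proof
  fix z assume z: "z \<in> S"
  obtain M where "\<forall>\<^sub>F w in nhds z. norm (f w) \<le> M"
    using bdd[OF z] by blast
  moreover have "\<forall>\<^sub>F w in nhds z. w \<in> S"
    using S z by (rule eventually_nhds_in_open)
  ultimately have "\<forall>\<^sub>F w in nhds z. w \<in> S \<and> norm (f w) \<le> M"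
    by eventually_elim simp
  then obtain r where r: "r > 0" "\<And>w. w \<in> ball z r \<Longrightarrow> w \<in> S \<and> norm (f w) \<le> M"
    by (auto simp: eventually_nhds_metric dist_commute)
  then show "\<exists>D. ((\<lambda>w. inverse (w - z) *\<^sub>C (f w - f z)) \<longlongrightarrow> D) (at z)"
    using holomorphic_on_subset[OF hol]
    by (intro weakly_holomorphic_imp_differentiable[of r z f M]) (auto simp: subset_iff)
qed

lemma isCont_imp_locally_bounded:
  assumes "isCont f z"
  shows "\<exists>M. \<forall>\<^sub>F w in nhds z. norm (f w) \<le> M"
proof -
  have "((\<lambda>w. norm (f w)) \<longlongrightarrow> norm (f z)) (nhds z)"
    using assms by (intro tendsto_norm) (simp add: continuous_within tendsto_nhds_iff)
  then have "\<forall>\<^sub>F w in nhds z. norm (f w) < norm (f z) + 1"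
    by (rule order_tendstoD) simp
  then show ?thesis
    by (intro exI[of _ "norm (f z) + 1"]) (auto elim: eventually_mono)
qed

lemma vec_analytic_on_diff:
  assumes "vec_analytic_on f S" "vec_analytic_on g S"
  shows "vec_analytic_on (\<lambda>z. f z - g z) S"
  unfolding vec_analytic_on_def
proof
  fix z assume "z \<in> S"
  then obtain D E where D: "((\<lambda>w. inverse (w - z) *\<^sub>C (f w - f z)) \<longlongrightarrow> D) (at z)"
    and E: "((\<lambda>w. inverse (w - z) *\<^sub>C (g w - g z)) \<longlongrightarrow> E) (at z)"
    using assms unfolding vec_analytic_on_def by blast
  from tendsto_diff[OF D E]
  show "\<exists>D. ((\<lambda>w. inverse (w - z) *\<^sub>C (f w - g w - (f z - g z))) \<longlongrightarrow> D) (at z)"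
    by (auto simp: algebra_simps scaleC_diff_right)
qed

lemma vec_analytic_on_compose_left:
  fixes f :: "complex \<Rightarrow> 'a::complex_normed_vector \<Rightarrow>\<^sub>L 'a"
  assumes "vec_analytic_on f S" "L \<in> bounded_ops"
  shows "vec_analytic_on (\<lambda>z. L o\<^sub>L f z) S"
  unfolding vec_analytic_on_def
proof
  fix z assume "z \<in> S"
  then obtain D where "((\<lambda>w. inverse (w - z) *\<^sub>C (f w - f z)) \<longlongrightarrow> D) (at z)"
    using assms unfolding vec_analytic_on_def by blast
  from tendsto_blinfun_compose[OF tendsto_const[of L] this]
  show "\<exists>D. ((\<lambda>w. inverse (w - z) *\<^sub>C ((L o\<^sub>L f w) - (L o\<^sub>L f z))) \<longlongrightarrow> D) (at z)"
    by (auto simp: blinfun_compose_scaleC_right[OF assms(2)] blinfun_compose_simps)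
qed

text \<open>The removable singularity theorem for operators. Continuity of the quotient supplies the
  local norm bound; for fixed \<open>x\<close> and \<open>y\<close> the quotient is a scalar
  difference quotient completed by the derivative at \<open>z0\<close>, to which the scalar theorem
  applies.\<close>

lemma vec_analytic_on_divide:
  fixes G :: "complex \<Rightarrow> 'a::complex_hilbert_space \<Rightarrow>\<^sub>L 'a"
  assumes G: "vec_analytic_on G S" "open S" and z0: "z0 \<in> S" "G z0 = 0"
    and D: "((\<lambda>w. inverse (w - z0) *\<^sub>C G w) \<longlongrightarrow> D) (at z0)"
  shows "vec_analytic_on (\<lambda>z. if z = z0 then D else inverse (z - z0) *\<^sub>C G z) S"
proof (rule vec_analytic_onI_weak[OF G(2)])
  define q where "q z = (if z = z0 then D else inverse (z - z0) *\<^sub>C G z)" for z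
  show "\<exists>M. \<forall>\<^sub>F w in nhds z. norm (if w = z0 then D else inverse (w - z0) *\<^sub>C G w) \<le> M"
    if "z \<in> S" for z
    unfolding q_def[symmetric]
  proof (rule isCont_imp_locally_bounded)
    show "isCont q z"
    proof (cases "z = z0")
      case True
      have "(q \<longlongrightarrow> D) (at z0)"
        using D by (rule Lim_transform_eventually) (auto simp: q_def eventually_at_filter)
      then show ?thesis
        by (simp add: True isCont_def q_def)
    next
      case False
      have "(G \<longlongrightarrow> G z) (at z)"
        using vec_analytic_on_isCont[OF G(1) that] by (simp add: isCont_def)
      then have "((\<lambda>w. inverse (w - z0) *\<^sub>C G w) \<longlongrightarrow> inverse (z - z0) *\<^sub>C G z) (at z)"
        using False by (intro tendsto_intros) auto
      moreover have "\<forall>\<^sub>F w in at z. w \<noteq> z0"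
        using t1_space_nhds[OF False] by (auto simp: eventually_at_filter elim: eventually_mono)
      then have "\<forall>\<^sub>F w in at z. inverse (w - z0) *\<^sub>C G w = q w"
        by eventually_elim (simp add: q_def)
      ultimately have "(q \<longlongrightarrow> inverse (z - z0) *\<^sub>C G z) (at z)"
        by (rule Lim_transform_eventually)
      then show ?thesis
        using False by (simp add: isCont_def q_def)
    qed
  qed
  fix x y
  define h where "h z = cinner x (G z y)" for z
  have h: "h holomorphic_on S"
    unfolding h_def by (rule holomorphic_on_cinner_blinfun[OF G])
  have "h z0 = 0"
    by (simp add: h_def z0)
  have "(h has_field_derivative cinner x (D y)) (at z0)"
  proof -
    have "((\<lambda>w. cinner x ((inverse (w - z0) *\<^sub>C G w) y)) \<longlongrightarrow> cinner x (D y)) (at z0)"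
      by (intro tendsto_intros D)
    then show ?thesis
      using \<open>h z0 = 0\<close>
      by (simp add: has_field_derivative_iff h_def scaleC_blinfun.rep_eq cinner_scaleC_right field_simps)
  qed
  then have "deriv h z0 = cinner x (D y)"
    by (rule DERIV_imp_deriv)
  then have "(\<lambda>z. cinner x ((if z = z0 then D else inverse (z - z0) *\<^sub>C G z) y))
      = (\<lambda>z. if z = z0 then deriv h z0 else (h z - h z0) / (z - z0))"
    using \<open>h z0 = 0\<close>
    by (auto simp: fun_eq_iff h_def scaleC_blinfun.rep_eq cinner_scaleC_right field_simps)
  then show "(\<lambda>z. cinner x ((if z = z0 then D else inverse (z - z0) *\<^sub>C G z) y)) holomorphic_on S"
    using pole_lemma_open[OF h G(2), of z0] by simp
qed

text \<open>Scalar power series are holomorphic; the local norm bound comes from comparison with a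
  geometric series.\<close>

lemma vec_analytic_on_power_series:
  fixes C :: "nat \<Rightarrow> 'a::complex_hilbert_space \<Rightarrow>\<^sub>L 'a"
  assumes sums: "\<And>z. z \<in> ball z0 r \<Longrightarrow> (\<lambda>k. (z - z0) ^ k *\<^sub>C C k) sums f z"
  shows "vec_analytic_on f (ball z0 r)"
proof (rule vec_analytic_onI_weak)
  show "(\<lambda>z. cinner x (f z y)) holomorphic_on ball z0 r" for x y
  proof (rule power_series_holomorphic)
    fix z assume "z \<in> ball z0 r"
    from sums[OF this] have "(\<lambda>k. cinner x (((z - z0) ^ k *\<^sub>C C k) y)) sums cinner x (f z y)"
      by (intro bounded_linear.sums[OF bounded_bilinear.bounded_linear_right[OF
              bounded_bilinear_cinner]] bounded_linear.sums[OF blinfun.bounded_linear_left])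
    then show "(\<lambda>k. cinner x (C k y) * (z - z0) ^ k) sums cinner x (f z y)"
      by (simp add: scaleC_blinfun.rep_eq cinner_scaleC_right mult.commute)
  qed
  fix z1 assume z1: "z1 \<in> ball z0 r"
  \<comment> \<open>The radii \<open>s\<close> and \<open>t\<close> divide the interval from
    \<open>cmod (z1 - z0)\<close> to \<open>r\<close> into thirds. Boundedness of the terms at
    radius \<open>t\<close> dominates the series inside radius \<open>s\<close> by a geometric
    series of ratio \<open>s / t\<close>.\<close>
  define s where "s = (2 * cmod (z1 - z0) + r) / 3"
  define t where "t = (cmod (z1 - z0) + 2 * r) / 3"
  have less: "cmod (z1 - z0) < s" "s < t" "t < r" "0 \<le> s" "0 < t"
    using z1 norm_ge_zero[of "z1 - z0"]
    by (auto simp: s_def t_def dist_norm norm_minus_commute simp del: norm_ge_zero)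
  have "summable (\<lambda>k. (of_real t) ^ k *\<^sub>C C k)"
    using sums[of "z0 + of_real t"] less by (auto simp: dist_norm sums_iff)
  then obtain K where K: "\<And>k. norm ((complex_of_real t) ^ k *\<^sub>C C k) \<le> K"
    using summable_imp_Bseq unfolding Bseq_def by blast
  have "norm (f w) \<le> (\<Sum>k. K * (s / t) ^ k)" if w: "cmod (w - z0) < s" for w
  proof -
    have wb: "w \<in> ball z0 r"
      using w less by (simp add: dist_norm norm_minus_commute)
    have bound: "norm ((w - z0) ^ k *\<^sub>C C k) \<le> K * (s / t) ^ k" for k
    proof -
      have "t ^ k * norm (C k) \<le> K"
        using K[of k] less by (simp add: norm_scaleC norm_power)
      have "norm ((w - z0) ^ k *\<^sub>C C k) \<le> s ^ k * norm (C k)"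
        using w by (simp add: norm_scaleC norm_power mult_right_mono power_mono)
      also have "\<dots> = (t ^ k * norm (C k)) * (s / t) ^ k"
        using less by (simp add: power_divide)
      also have "\<dots> \<le> K * (s / t) ^ k"
        using less \<open>t ^ k * norm (C k) \<le> K\<close> by (intro mult_right_mono) auto
      finally show ?thesis .
    qed
    have summ: "summable (\<lambda>k. K * (s / t) ^ k)"
      using less by (intro summable_mult summable_geometric) auto
    then have summ': "summable (\<lambda>k. norm ((w - z0) ^ k *\<^sub>C C k))"
      by (rule summable_comparison_test'[where N = 0]) (use bound in simp)
    have "f w = (\<Sum>k. (w - z0) ^ k *\<^sub>C C k)"
      using sums[OF wb] by (simp add: sums_iff)
    then have "norm (f w) \<le> (\<Sum>k. norm ((w - z0) ^ k *\<^sub>C C k))"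
      using summable_norm[OF summ'] by simp
    also have "\<dots> \<le> (\<Sum>k. K * (s / t) ^ k)"
      by (rule suminf_le[OF bound summ' summ])
    finally show ?thesis .
  qed
  moreover have "\<forall>\<^sub>F w in nhds z1. w \<in> ball z0 s"
    using less by (intro eventually_nhds_in_open) (auto simp: dist_norm norm_minus_commute)
  ultimately show "\<exists>M. \<forall>\<^sub>F w in nhds z1. norm (f w) \<le> M"
    by (intro exI[of _ "\<Sum>k. K * (s / t) ^ k"])
      (auto simp: dist_norm norm_minus_commute elim: eventually_mono)
qed simp

section \<open>Laurent coefficients of the inverse\<close>

text \<open>\<open>P\<close> vanishes on the range \<open>R\<close> of \<open>T\<close>, so all its
  values are attained on the orthogonal complement of \<open>R\<close>, which is finite-dimensional
  because \<open>T\<close> is Fredholm.\<close>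

lemma finite_rank_complementary_projection:
  fixes Q :: "'a::complex_hilbert_space \<Rightarrow>\<^sub>L 'a"
  assumes T: "T \<in> fredholm_ops" and Q: "projection_onto Q (ran_op T)"
  shows "id_blinfun - Q \<in> finite_rank_ops"
proof -
  define R where "R = ran_op T"
  define P where "P = id_blinfun - Q"
  have bT: "T \<in> bounded_ops" and bQ: "Q \<in> bounded_ops" and QQ: "Q o\<^sub>L Q = Q" and ran: "ran_op Q = R"
    using T Q by (auto simp: fredholm_ops_def projection_onto_def R_def)
  have R: "closed R" "complex_vector.subspace R"
    using T csubspace_ran_op[OF bT] by (simp_all add: fredholm_ops_def R_def)
  have P: "P \<in> bounded_ops"
    unfolding P_def using bQ by blast
  have "Q (Q y) = Q y" for y
    by (metis QQ blinfun_apply_blinfun_compose)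
  then have PR: "P r = 0" if "r \<in> R" for r
    using that by (auto simp: ran[symmetric] P_def ran_op_def blinfun.diff_left)
  have "finite_cdim (orth_compl R)"
    using T by (simp add: fredholm_ops_def ker_cadjoint[OF bT] R_def)
  then have "finite_cdim (blinfun_apply P ` orth_compl R)"
    by (rule finite_cdim_image[OF linear_bounded_ops[OF P]])
  moreover have "ran_op P \<subseteq> blinfun_apply P ` orth_compl R"
  proof
    fix y assume "y \<in> ran_op P"
    then obtain x where "y = P x"
      by (auto simp: ran_op_def)
    then have "y = P (x - cproj R x)"
      using PR cproj_in[OF R] by (simp add: blinfun.diff_right)
    then show "y \<in> blinfun_apply P ` orth_compl R"
      using cproj_orth[OF R] by blast
  qed
  ultimately have "finite_cdim (ran_op P)"
    by (rule finite_cdim_subset)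
  with P show ?thesis
    by (simp add: finite_rank_ops_def P_def)
qed

text \<open>The definition of a pole supplies bare coefficients \<open>C\<close>; their
  complex-linearity, and finite rank below index \<open>n\<close>, are derived from the expansion.
  \<open>Q\<close> will be the projection onto the range of \<open>A z0\<close>.\<close>

locale inverse_laurent =
  fixes A :: "complex \<Rightarrow> 'h::complex_hilbert_space \<Rightarrow>\<^sub>L 'h" and z0 :: complex
    and n :: nat and r :: real and C :: "nat \<Rightarrow> 'h \<Rightarrow>\<^sub>L 'h" and Q :: "'h \<Rightarrow>\<^sub>L 'h"
  assumes cont: "isCont A z0"
    and r: "r > 0"
    and n: "n \<ge> 1"
    and invertible: "\<And>z. z \<in> ball z0 r - {z0} \<Longrightarrow> boundedly_invertible (A z)"
    and laurent: "\<And>z. z \<in> ball z0 r - {z0} \<Longrightarrow>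
      (\<lambda>k. (z - z0) powi (int k - int n) *\<^sub>C C k) sums inverse_op (A z)"
    and Q: "Q \<in> bounded_ops" "ran_op Q \<subseteq> ran_op (A z0)" "id_blinfun - Q \<in> finite_rank_ops"
begin

text \<open>The series from index \<open>j\<close> on, shifted so that it starts with
  \<open>C j\<close>; \<open>tail n\<close> is the regular part of the inverse. The closed form away
  from \<open>z0\<close> involves only the inverse and the coefficients before \<open>C j\<close>,
  which lets properties pass from these to the limit \<open>C j\<close>.\<close>

definition tail :: "nat \<Rightarrow> complex \<Rightarrow> 'h \<Rightarrow>\<^sub>L 'h" where
  "tail j z = (if z = z0 then C j else
    (z - z0) powi (int n - int j) *\<^sub>C inverse_op (A z)
      - (\<Sum>i<j. (z - z0) powi (int i - int j) *\<^sub>C C i))"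

lemma tail_sums:
  assumes z: "z \<in> ball z0 r"
  shows "(\<lambda>k. (z - z0) ^ k *\<^sub>C C (k + j)) sums tail j z"
proof (cases "z = z0")
  case True
  have "(\<lambda>k. (z - z0) ^ k *\<^sub>C C (k + j)) = (\<lambda>k. if k = 0 then C (k + j) else 0)"
    by (auto simp: True)
  then show ?thesis
    using sums_single[of 0 "\<lambda>k. C (k + j)"] True by (simp add: tail_def)
next
  case False
  define w where "w = z - z0"
  have w: "w \<noteq> 0"
    using False by (simp add: w_def)
  have "(\<lambda>k. w powi (int n - int j) *\<^sub>C (w powi (int k - int n) *\<^sub>C C k))
      sums (w powi (int n - int j) *\<^sub>C inverse_op (A z))"
    unfolding w_def using z False
    by (intro bounded_linear.sums[OF bounded_bilinear.bounded_linear_right[OF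
            bounded_bilinear_scaleC]] laurent) auto
  moreover have "w powi (int n - int j) * w powi (int k - int n) = w powi (int k - int j)" for k
    using power_int_add[OF disjI1[OF w], of "int n - int j" "int k - int n"] by simp
  ultimately have "(\<lambda>k. w powi (int k - int j) *\<^sub>C C k)
      sums (w powi (int n - int j) *\<^sub>C inverse_op (A z))"
    by (simp add: scaleC_scaleC)
  from sums_split_initial_segment[OF this, of j]
  show ?thesis
    using False by (simp add: tail_def w_def)
qed

lemma tendsto_tail: "(tail j \<longlongrightarrow> C j) (at z0)"
proof -
  have "vec_analytic_on (tail j) (ball z0 r)"
    by (rule vec_analytic_on_power_series[OF tail_sums])
  then have "isCont (tail j) z0"
    by (rule vec_analytic_on_isCont) (use r in simp)
  then show ?thesis
    by (simp add: isCont_def tail_def)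
qed

lemma eventually_punctured: "\<forall>\<^sub>F z in at z0. z \<in> ball z0 r - {z0}"
  unfolding eventually_at using r by (intro exI[of _ r]) (auto simp: dist_commute)

text \<open>Strong induction: \<open>C j\<close> is the limit of \<open>tail j\<close>, which is
  built from the inverse and earlier coefficients.\<close>

lemma C_bounded_ops: "C j \<in> bounded_ops"
proof (induction j rule: less_induct)
  case (less j)
  show ?case
  proof (rule Lim_in_closed_set[OF closed_bounded_ops _ _ tendsto_tail])
    show "\<forall>\<^sub>F z in at z0. tail j z \<in> bounded_ops"
      using eventually_punctured
    proof eventually_elim
      case (elim z)
      have "(\<Sum>i<j. (z - z0) powi (int i - int j) *\<^sub>C C i) \<in> bounded_ops"
        using less by (intro bounded_ops_sum bounded_ops_intros) auto
      then show ?case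
        using elim boundedly_invertible_inverse_op(1)[OF invertible[OF elim]]
        by (auto simp: tail_def)
    qed
  qed simp
qed

lemma tail_bounded_ops: "z \<in> ball z0 r \<Longrightarrow> tail j z \<in> bounded_ops"
proof (cases "z = z0")
  case False
  have "(\<Sum>i<j. (z - z0) powi (int i - int j) *\<^sub>C C i) \<in> bounded_ops"
    by (intro bounded_ops_sum bounded_ops_intros C_bounded_ops)
  moreover assume "z \<in> ball z0 r"
  ultimately show ?thesis
    using boundedly_invertible_inverse_op(1)[OF invertible, of z] False by (auto simp: tail_def)
qed (simp add: tail_def C_bounded_ops)

text \<open>For \<open>z \<noteq> z0\<close> the operator \<open>tail j z A(z) - (z - z0)\<^bsup>n - j\<^esup>\<close> maps into the span of the ranges of
  the earlier coefficients. That span is closed, and for \<open>j < n\<close> the limit is \<open>C j A(z0)\<close>.\<close>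

lemma C_A_in_span:
  assumes j: "j < n" and fin: "\<And>i. i < j \<Longrightarrow> C i \<in> finite_rank_ops"
  shows "C j (A z0 x) \<in> complex_vector.span (\<Union>i<j. ran_op (C i))" (is "_ \<in> ?M")
proof -
  have "finite_cdim (\<Union>i<j. ran_op (C i))"
    using fin by (intro finite_cdim_UN) (auto simp: finite_rank_ops_def)
  then have "closed ?M"
    by (intro closed_finite_cdim finite_cdim_cspan complex_vector.subspace_span)
  moreover have "((\<lambda>z. tail j z (A z x) - (z - z0) ^ (n - j) *\<^sub>C x) \<longlongrightarrow> C j (A z0 x)) (at z0)"
  proof -
    have "((\<lambda>z. A z) \<longlongrightarrow> A z0) (at z0)"
      using cont by (simp add: isCont_def)
    then have "((\<lambda>z. tail j z (A z x) - (z - z0) ^ (n - j) *\<^sub>C x)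
        \<longlongrightarrow> C j (A z0 x) - (z0 - z0) ^ (n - j) *\<^sub>C x) (at z0)"
      by (intro tendsto_intros tendsto_tail)
    then show ?thesis
      using j by (simp add: zero_power)
  qed
  moreover have "\<forall>\<^sub>F z in at z0. tail j z (A z x) - (z - z0) ^ (n - j) *\<^sub>C x \<in> ?M"
    using eventually_punctured
  proof eventually_elim
    case (elim z)
    note inv = boundedly_invertible_inverse_op[OF invertible[OF elim]]
    have "inverse_op (A z) (A z x) = x"
      by (metis inv(2) blinfun_apply_blinfun_compose blinfun_apply_id_blinfun)
    moreover have "(z - z0) powi (int n - int j) = (z - z0) ^ (n - j)"
      using j by (metis less_imp_le of_nat_diff power_int_of_nat)
    ultimately have "tail j z (A z x) - (z - z0) ^ (n - j) *\<^sub>C x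
        = - (\<Sum>i<j. (z - z0) powi (int i - int j) *\<^sub>C C i (A z x))"
      using elim by (simp add: tail_def blinfun.diff_left scaleC_blinfun.rep_eq blinfun.sum_left)
    also have "\<dots> \<in> ?M"
      by (intro complex_vector.span_neg complex_vector.span_sum complex_vector.span_scale
          complex_vector.span_base) (auto simp: ran_op_def)
    finally show ?case .
  qed
  ultimately show ?thesis
    by (intro Lim_in_closed_set[where F = "at z0"]) simp_all
qed

text \<open>Split \<open>C j\<close> as \<open>C j Q + C j (I - Q)\<close>. The values of
  \<open>Q\<close> are values of \<open>A z0\<close>, which \<open>C j\<close> sends into the span
  of the earlier ranges; the second summand inherits finite rank from \<open>I - Q\<close>.\<close>

lemma C_finite_rank: "j < n \<Longrightarrow> C j \<in> finite_rank_ops"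
proof (induction j rule: less_induct)
  case (less j)
  then have fin: "C i \<in> finite_rank_ops" if "i < j" for i
    using that by simp
  have "(C j o\<^sub>L Q) \<in> finite_rank_ops"
  proof (rule finite_rank_ops_ranI)
    show "finite_cdim (\<Union>i<j. ran_op (C i))"
      using fin by (intro finite_cdim_UN) (auto simp: finite_rank_ops_def)
    show "blinfun_apply (C j o\<^sub>L Q) x \<in> complex_vector.span (\<Union>i<j. ran_op (C i))" for x
    proof -
      obtain y where "Q x = A z0 y"
        using Q(2) by (auto simp: ran_op_def)
      then show ?thesis
        using C_A_in_span[OF less.prems fin, of y] by simp
    qed
  qed (use C_bounded_ops Q in blast)
  moreover have "C j o\<^sub>L (id_blinfun - Q) \<in> finite_rank_ops"
    by (rule finite_rank_ops_compose_left[OF Q(3) C_bounded_ops])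
  ultimately have "(C j o\<^sub>L Q) + (C j o\<^sub>L (id_blinfun - Q)) \<in> finite_rank_ops"
    by (rule finite_rank_ops_add)
  then show ?case
    by (simp add: blinfun_compose_simps)
qed

text \<open>The case \<open>j = 0\<close> of \<open>C_A_in_span\<close>, where the span of the empty
  union is zero. This is the cancellation that lowers the order of the pole.\<close>

lemma C_0_Q: "C 0 o\<^sub>L Q = 0"
proof (rule blinfun_eqI)
  fix x
  obtain y where "Q x = A z0 y"
    using Q(2) by (auto simp: ran_op_def)
  then show "blinfun_apply (C 0 o\<^sub>L Q) x = blinfun_apply 0 x"
    using C_A_in_span[of 0 y] n by simp
qed

text \<open>With \<open>A(z)\<^sup>-\<^sup>1 = G + F\<close>, where \<open>G\<close> is the regular and \<open>F\<close> the principal part,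
  \<open>A(z)\<^sup>-\<^sup>1 A(z0) = I - G (A(z) - A(z0)) - F (A(z) - A(z0))\<close>, and \<open>G (A(z) - A(z0))\<close> is small near \<open>z0\<close>.\<close>

lemma invertible_minus_finite_rank_center:
  assumes A0: "A z0 \<in> bounded_ops"
  obtains V F where "boundedly_invertible V" "F \<in> finite_rank_ops" "A z0 = V - F"
proof -
  have "((\<lambda>z. norm (tail n z o\<^sub>L (A z - A z0))) \<longlongrightarrow> norm (C n o\<^sub>L (A z0 - A z0))) (at z0)"
    using cont by (intro tendsto_intros tendsto_tail) (simp add: isCont_def)
  then have "((\<lambda>z. norm (tail n z o\<^sub>L (A z - A z0))) \<longlongrightarrow> 0) (at z0)"
    by (simp add: blinfun_compose_simps)
  then have "\<forall>\<^sub>F z in at z0. norm (tail n z o\<^sub>L (A z - A z0)) < 1"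
    by (rule order_tendstoD) simp
  with eventually_punctured
  have "\<forall>\<^sub>F z in at z0. z \<in> ball z0 r - {z0} \<and> norm (tail n z o\<^sub>L (A z - A z0)) < 1"
    by eventually_elim simp
  then obtain z where z: "z \<in> ball z0 r - {z0}" and small: "norm (tail n z o\<^sub>L (A z - A z0)) < 1"
    using eventually_happens' trivial_limit_at by blast
  define B where "B = inverse_op (A z)"
  define D where "D = A z - A z0"
  define F where "F = (\<Sum>i<n. (z - z0) powi (int i - int n) *\<^sub>C C i)"
  note inv = boundedly_invertible_inverse_op[OF invertible[OF z], folded B_def]
  have Az: "A z \<in> bounded_ops"
    using invertible[OF z] by (rule boundedly_invertible_bounded_ops)
  then have D: "D \<in> bounded_ops"
    unfolding D_def using A0 by blast
  have "tail n z = B - F"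
    using z by (simp add: tail_def B_def F_def)
  have "F \<in> finite_rank_ops"
    unfolding F_def by (intro finite_rank_ops_sum finite_rank_ops_scaleC C_finite_rank) simp
  define X where "X = tail n z o\<^sub>L D"
  have "X \<in> bounded_ops"
    unfolding X_def using tail_bounded_ops z D by blast
  then have "boundedly_invertible (id_blinfun - X)"
    using small neumann by (simp add: X_def D_def)
  then have "boundedly_invertible (A z o\<^sub>L (id_blinfun - X))"
    using boundedly_invertible_compose invertible[OF z] by blast
  moreover have "A z o\<^sub>L (F o\<^sub>L D) \<in> finite_rank_ops"
    by (intro finite_rank_ops_compose_left finite_rank_ops_compose_right \<open>F \<in> finite_rank_ops\<close> D Az)
  \<comment> \<open>The regular and the principal part recombine: together the two corrections
    subtract \<open>A z o\<^sub>L (B o\<^sub>L D)\<close>, which is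
    \<open>D = A z - A z0\<close>.\<close>
  moreover have "A z0 = (A z o\<^sub>L (id_blinfun - X)) - (A z o\<^sub>L (F o\<^sub>L D))"
  proof -
    have "A z o\<^sub>L (B o\<^sub>L D) = D"
      using inv by (metis blinfun_compose_simps(5,11))
    then show ?thesis
      by (simp add: X_def \<open>tail n z = B - F\<close> blinfun_compose_simps) (simp add: D_def)
  qed
  ultimately show thesis
    using that by blast
qed

end

section \<open>Compact operators and singular values\<close>

text \<open>By Pythagoras, the coefficient of the new vector and the remaining part both have norm
  at most \<open>R\<close>. The enlarged ball therefore lies in a sum of two compact sets.\<close>

lemma cspan_cball_compact:
  fixes B :: "'a::complex_hilbert_space set"
  assumes "finite B" "orthonormal B"
  shows "\<exists>K. compact K \<and> complex_vector.span B \<inter> cball 0 R \<subseteq> K"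
  using assms
proof induction
  case empty
  then show ?case by (intro exI[of _ "{0}"]) auto
next
  case (insert b B)
  then have "orthonormal B"
    by (auto simp: orthonormal_def)
  then obtain K where K: "compact K" "complex_vector.span B \<inter> cball 0 R \<subseteq> K"
    using insert.IH by blast
  define L where "L = (\<lambda>k. k *\<^sub>C b) ` cball (0::complex) R"
  have "continuous_on (cball 0 R) (\<lambda>k. k *\<^sub>C b)"
    by (rule bounded_linear.continuous_on[OF bounded_bilinear.bounded_linear_left[OF
            bounded_bilinear_scaleC] continuous_on_id])
  then have "compact {x + y |x y. x \<in> L \<and> y \<in> K}"
    unfolding L_def by (intro compact_sums compact_continuous_image K compact_cball)
  moreover have "x \<in> {x + y |x y. x \<in> L \<and> y \<in> K}"
    if x: "x \<in> complex_vector.span (insert b B)" "norm x \<le> R" for x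
  proof -
    obtain k where k: "x - k *\<^sub>C b \<in> complex_vector.span B"
      using x by (auto simp: complex_vector.span_insert)
    have "norm b = 1" and "b \<in> orth_compl B"
      using insert.prems insert.hyps by (auto simp: orthonormal_def orth_compl_def)
    then have "b \<in> orth_compl (complex_vector.span B)"
      by (simp only: orth_compl_cspan)
    then have "cinner (x - k *\<^sub>C b) (k *\<^sub>C b) = 0"
      using k by (simp add: orth_compl_def cinner_scaleC_right)
    from norm_add_orthogonal[OF this]
    have "(norm x)\<^sup>2 = (norm (x - k *\<^sub>C b))\<^sup>2 + (cmod k)\<^sup>2"
      by (simp add: norm_scaleC \<open>norm b = 1\<close>)
    moreover have "0 \<le> R"
      using x(2) norm_ge_zero order_trans by blast
    moreover have "(norm x)\<^sup>2 \<le> R\<^sup>2"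
      using x(2) by (simp add: power_mono)
    ultimately have "(norm (x - k *\<^sub>C b))\<^sup>2 \<le> R\<^sup>2" "(cmod k)\<^sup>2 \<le> R\<^sup>2"
      by (smt (verit) zero_le_power2)+
    then have "norm (x - k *\<^sub>C b) \<le> R" "cmod k \<le> R"
      using \<open>0 \<le> R\<close> power2_le_imp_le by blast+
    then have "x - k *\<^sub>C b \<in> K" "k *\<^sub>C b \<in> L"
      using K k by (auto simp: L_def)
    then show ?thesis
      by (intro CollectI exI[of _ "k *\<^sub>C b"] exI[of _ "x - k *\<^sub>C b"]) simp
  qed
  ultimately show ?case
    by (intro exI[of _ "{x + y |x y. x \<in> L \<and> y \<in> K}"]) (auto simp: subset_iff)
qed

lemma compact_ops_add_finite_rank:
  fixes T :: "'a::complex_hilbert_space \<Rightarrow>\<^sub>L 'a"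
  assumes T: "T \<in> compact_ops" and F: "F \<in> finite_rank_ops"
  shows "T + F \<in> compact_ops"
proof -
  have bF: "F \<in> bounded_ops"
    using F by (rule finite_rank_bounded_ops)
  obtain B where B: "finite B" "orthonormal B" "complex_vector.span B = ran_op F"
    using F csubspace_ran_op[OF bF] by (auto simp: finite_rank_ops_def elim: orthonormal_basis)
  obtain K where K: "compact K" "complex_vector.span B \<inter> cball 0 (norm F) \<subseteq> K"
    using cspan_cball_compact[OF B(1,2)] by blast
  define L where "L = {x + y |x y. x \<in> closure (blinfun_apply T ` cball 0 1) \<and> y \<in> K}"
  have L: "compact L"
    unfolding L_def using T K(1) by (intro compact_sums) (auto simp: compact_ops_def)
  have "blinfun_apply (T + F) x \<in> L" if "x \<in> cball 0 1" for x
  proof -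
    have "norm (F x) \<le> norm F * norm x"
      by (rule norm_blinfun)
    also have "\<dots> \<le> norm F"
      using that by (simp add: mult_left_le)
    finally have "F x \<in> K"
      using K(2) B(3) by (auto simp: ran_op_def)
    moreover have "T x \<in> closure (blinfun_apply T ` cball 0 1)"
      by (intro subsetD[OF closure_subset] imageI that)
    ultimately show ?thesis
      unfolding L_def blinfun.add_left by blast
  qed
  then have "closure (blinfun_apply (T + F) ` cball 0 1) \<subseteq> L"
    using L by (intro closure_minimal compact_imp_closed) auto
  then have "compact (closure (blinfun_apply (T + F) ` cball 0 1))"
    using compact_Int_closed[OF L closed_closure] by (metis inf.absorb_iff2)
  then show ?thesis
    using T bF by (auto simp: compact_ops_def)
qed

section \<open>Singular values and their eigenvectors\<close>

lemma sv_eigenspace_iff: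
  fixes T :: "'a::complex_hilbert_space \<Rightarrow>\<^sub>L 'a"
  assumes T: "T \<in> bounded_ops"
  shows "x \<in> sv_eigenspace T s \<longleftrightarrow>
    (\<forall>y. cinner (T x) (T y) = complex_of_real (s\<^sup>2) * cinner x y)"
proof
  assume "x \<in> sv_eigenspace T s"
  then have "cadjoint T (T x) = complex_of_real (s\<^sup>2) *\<^sub>C x"
    by (simp add: sv_eigenspace_def)
  then show "\<forall>y. cinner (T x) (T y) = complex_of_real (s\<^sup>2) * cinner x y"
    by (simp add: cinner_scaleC_left flip: cinner_cadjoint'[OF T])
next
  assume *: "\<forall>y. cinner (T x) (T y) = complex_of_real (s\<^sup>2) * cinner x y"
  have "cadjoint T (T x) = complex_of_real (s\<^sup>2) *\<^sub>C x"
  proof (rule cinner_left_eqI)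
    fix y
    have "cinner y (cadjoint T (T x)) = cnj (cinner (T x) (T y))"
      by (metis cinner_cadjoint[OF T] cinner_commute)
    also have "\<dots> = cinner y (complex_of_real (s\<^sup>2) *\<^sub>C x)"
      using * by (simp add: cinner_scaleC_right flip: cinner_commute)
    finally show "cinner y (cadjoint T (T x)) = cinner y (complex_of_real (s\<^sup>2) *\<^sub>C x)" .
  qed
  then show "x \<in> sv_eigenspace T s"
    by (simp add: sv_eigenspace_def)
qed

lemma csubspace_sv_eigenspace:
  "T \<in> bounded_ops \<Longrightarrow> complex_vector.subspace (sv_eigenspace T s)"
  by (auto simp: complex_vector.subspace_def sv_eigenspace_iff blinfun.add_right bounded_opsD
      cinner_add_left cinner_scaleC_left algebra_simps)

lemma norm_sv_eigenvector:
  assumes T: "T \<in> bounded_ops" and x: "x \<in> sv_eigenspace T s" and s: "s \<ge> 0"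
  shows "norm (T x) = s * norm x"
proof -
  have "cinner (T x) (T x) = complex_of_real (s\<^sup>2) * cinner x x"
    using x sv_eigenspace_iff[OF T] by blast
  then have "complex_of_real ((norm (T x))\<^sup>2) = complex_of_real ((s * norm x)\<^sup>2)"
    by (simp add: cinner_self power_mult_distrib)
  then have "(norm (T x))\<^sup>2 = (s * norm x)\<^sup>2"
    by (simp only: of_real_eq_iff)
  then show ?thesis
    using s by simp
qed

lemma sv_eigenspace_orthogonal:
  assumes T: "T \<in> bounded_ops" and x: "x \<in> sv_eigenspace T s" and y: "y \<in> sv_eigenspace T t"
    and st: "s > 0" "t > 0" "s \<noteq> t"
  shows "cinner x y = 0"
proof -
  have "cinner (T x) (T y) = complex_of_real (s\<^sup>2) * cinner x y"
    using x sv_eigenspace_iff[OF T] by blast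
  moreover have "cinner (T y) (T x) = complex_of_real (t\<^sup>2) * cinner y x"
    using y sv_eigenspace_iff[OF T] by blast
  then have "cnj (cinner (T y) (T x)) = complex_of_real (t\<^sup>2) * cnj (cinner y x)"
    by simp
  then have "cinner (T x) (T y) = complex_of_real (t\<^sup>2) * cinner x y"
    by (simp only: cinner_commute[symmetric])
  ultimately have "complex_of_real (s\<^sup>2) * cinner x y = complex_of_real (t\<^sup>2) * cinner x y"
    by metis
  moreover have "s\<^sup>2 \<noteq> t\<^sup>2"
    using st by (simp add: power2_eq_iff)
  ultimately show ?thesis
    by (metis mult_cancel_right of_real_eq_iff)
qed

text \<open>Pairwise orthogonal images of norm at least \<open>s\<close> are at distance at least
  \<open>s\<close> from each other, so a ball of radius \<open>s / 2\<close> contains at most one of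
  them. The size of a finite cover of the image of the unit ball by such balls serves as
  \<open>k\<close>.\<close>

lemma compact_ops_card_bound:
  fixes T :: "'a::complex_hilbert_space \<Rightarrow>\<^sub>L 'a"
  assumes T: "T \<in> compact_ops" and s: "s > 0"
  obtains k where "\<And>B. finite B \<Longrightarrow> (\<And>b. b \<in> B \<Longrightarrow> norm b = 1 \<and> s \<le> norm (T b)) \<Longrightarrow>
    (\<And>b c. b \<in> B \<Longrightarrow> c \<in> B \<Longrightarrow> b \<noteq> c \<Longrightarrow> cinner (T b) (T c) = 0) \<Longrightarrow> card B \<le> k"
proof -
  have "compact (closure (blinfun_apply T ` cball 0 1))"
    using T by (simp add: compact_ops_def)
  then obtain D where D: "finite D"
    "closure (blinfun_apply T ` cball 0 1) \<subseteq> (\<Union>x\<in>D. ball x (s / 2))"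
    using s unfolding compact_eq_totally_bounded by (meson half_gt_zero)
  have "card B \<le> card D" if B: "finite B" "\<And>b. b \<in> B \<Longrightarrow> norm b = 1 \<and> s \<le> norm (T b)"
    "\<And>b c. b \<in> B \<Longrightarrow> c \<in> B \<Longrightarrow> b \<noteq> c \<Longrightarrow> cinner (T b) (T c) = 0" for B
  proof -
    have "\<exists>d\<in>D. T b \<in> ball d (s / 2)" if "b \<in> B" for b
    proof -
      have "T b \<in> blinfun_apply T ` cball 0 1"
        using B(2)[OF that] by auto
      then show ?thesis
        using subsetD[OF D(2) subsetD[OF closure_subset]] by blast
    qed
    then obtain g where g: "\<And>b. b \<in> B \<Longrightarrow> g b \<in> D" "\<And>b. b \<in> B \<Longrightarrow> T b \<in> ball (g b) (s / 2)"
      by metis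
    have "inj_on g B"
    proof (rule inj_onI, rule ccontr)
      fix b c assume bc: "b \<in> B" "c \<in> B" "g b = g c" "b \<noteq> c"
      have "dist (T b) (T c) < s"
        using g(2)[OF bc(1)] g(2)[OF bc(2)] bc(3) dist_triangle_half_r[of "g c" "T b" s "T c"]
        by simp
      then have "(norm (T b - T c))\<^sup>2 < s\<^sup>2"
        using s by (simp add: dist_norm power_strict_mono)
      moreover have "(norm (T b - T c))\<^sup>2 = (norm (T b))\<^sup>2 + (norm (T c))\<^sup>2"
        using norm_add_orthogonal[of "T b" "- T c"] B(3)[OF bc(1,2,4)] by simp
      moreover have "s\<^sup>2 \<le> (norm (T b))\<^sup>2"
        using B(2)[OF bc(1)] s by (simp add: power_mono)
      ultimately show False
        by (smt (verit) zero_le_power2)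
    qed
    then show ?thesis
      using g(1) D(1) by (intro card_inj_on_le[of g]) auto
  qed
  then show thesis
    using that by blast
qed

text \<open>The eigenvalue equation in weak form shows that \<open>T\<close> maps orthogonal
  eigenvectors to orthogonal vectors, so the previous bound applies even when the values
  \<open>t\<close> differ.\<close>

lemma sv_eigenvectors_card_bound:
  fixes T :: "'a::complex_hilbert_space \<Rightarrow>\<^sub>L 'a"
  assumes T: "T \<in> compact_ops" and s: "s > 0"
  obtains k where "\<And>B. finite B \<Longrightarrow> orthonormal B \<Longrightarrow>
    (\<And>b. b \<in> B \<Longrightarrow> \<exists>t\<ge>s. b \<in> sv_eigenspace T t) \<Longrightarrow> card B \<le> k"
proof -
  have bT: "T \<in> bounded_ops"
    using T by (simp add: compact_ops_def)
  obtain k where k: "\<And>B. finite B \<Longrightarrow> (\<And>b. b \<in> B \<Longrightarrow> norm b = 1 \<and> s \<le> norm (T b)) \<Longrightarrow>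
    (\<And>b c. b \<in> B \<Longrightarrow> c \<in> B \<Longrightarrow> b \<noteq> c \<Longrightarrow> cinner (T b) (T c) = 0) \<Longrightarrow> card B \<le> k"
    by (rule compact_ops_card_bound[OF T s]) blast
  have "card B \<le> k" if B: "finite B" "orthonormal B"
    "\<And>b. b \<in> B \<Longrightarrow> \<exists>t\<ge>s. b \<in> sv_eigenspace T t" for B
  proof (rule k[OF B(1)])
    fix b assume b: "b \<in> B"
    then obtain t where t: "t \<ge> s" "b \<in> sv_eigenspace T t"
      using B(3) by blast
    have "norm b = 1"
      using B(2) b by (simp add: orthonormal_def)
    then show "norm b = 1 \<and> s \<le> norm (T b)"
      using norm_sv_eigenvector[OF bT t(2)] t(1) s by simp
    fix c assume "c \<in> B" "b \<noteq> c"
    then show "cinner (T b) (T c) = 0"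
      using t(2) sv_eigenspace_iff[OF bT, of b t] B(2) b by (simp add: orthonormal_def)
  qed
  then show thesis
    using that by blast
qed

text \<open>The cardinality bound provides an orthonormal system of maximal size, and any vector
  outside its span would enlarge it. Since \<open>dim\<close> is 0 on infinite-dimensional spaces,
  this has to be settled before \<open>dim\<close> can count multiplicities.\<close>

lemma finite_cdim_sv_eigenspace:
  fixes T :: "'a::complex_hilbert_space \<Rightarrow>\<^sub>L 'a"
  assumes T: "T \<in> compact_ops" and s: "s > 0"
  shows "finite_cdim (sv_eigenspace T s)"
proof -
  have bT: "T \<in> bounded_ops"
    using T by (simp add: compact_ops_def)
  define E where "E = sv_eigenspace T s"
  have E: "complex_vector.subspace E"
    unfolding E_def by (rule csubspace_sv_eigenspace[OF bT])
  obtain k where k: "\<And>B. finite B \<Longrightarrow> orthonormal B \<Longrightarrow>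
    (\<And>b. b \<in> B \<Longrightarrow> \<exists>t\<ge>s. b \<in> sv_eigenspace T t) \<Longrightarrow> card B \<le> k"
    using sv_eigenvectors_card_bound[OF T s] by blast
  define P where "P B \<longleftrightarrow> finite B \<and> orthonormal B \<and> B \<subseteq> E" for B
  have "card B < Suc k" if "P B" for B
    using k[of B] that by (force simp: P_def E_def intro: le_imp_less_Suc)
  moreover have "P {}"
    by (simp add: P_def orthonormal_def)
  ultimately obtain B where B: "P B" and max: "\<And>B'. P B' \<Longrightarrow> card B' \<le> card B"
    using ex_has_greatest_nat[of P "{}" card "Suc k"] by blast
  define M where "M = complex_vector.span B"
  have M: "closed M" "complex_vector.subspace M"
    unfolding M_def using closed_cspan[of B] B by (simp_all add: P_def)
  have ME: "M \<subseteq> E"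
    unfolding M_def using B E by (intro complex_vector.span_minimal) (auto simp: P_def)
  have "x \<in> M" if "x \<in> E" for x
  proof (rule ccontr)
    assume "x \<notin> M"
    define v where "v = x - cproj M x"
    define u where "u = complex_of_real (1 / norm v) *\<^sub>C v"
    have "v \<noteq> 0"
      using \<open>x \<notin> M\<close> cproj_in[OF M, of x] by (auto simp: v_def)
    have "v \<in> E"
      unfolding v_def using ME cproj_in[OF M, of x] that complex_vector.subspace_diff[OF E] by blast
    then have "u \<in> E"
      unfolding u_def by (rule complex_vector.subspace_scale[OF E])
    have "v \<in> orth_compl M"
      unfolding v_def by (rule cproj_orth[OF M])
    then have "u \<in> orth_compl M"
      unfolding u_def by (rule complex_vector.subspace_scale[OF csubspace_orth_compl])
    then have ub: "cinner b u = 0" "cinner u b = 0" if "b \<in> B" for b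
      using that cinner_eq_0_commute[of b u]
      by (auto simp: M_def orth_compl_def complex_vector.span_base)
    have "norm u = 1"
      using \<open>v \<noteq> 0\<close> by (simp add: u_def norm_scaleC norm_divide)
    then have "u \<notin> B"
      using ub(1)[of u] by auto
    have "P (insert u B)"
      using B ub \<open>norm u = 1\<close> \<open>u \<in> E\<close> by (auto simp: P_def orthonormal_def)
    then have "card (insert u B) \<le> card B"
      by (rule max)
    then show False
      using B \<open>u \<notin> B\<close> by (simp add: P_def)
  qed
  then have "E \<subseteq> M" by blast
  moreover have "finite_cdim M"
    unfolding M_def using B by (intro finite_cdim_span) (simp add: P_def)
  ultimately show ?thesis
    unfolding E_def[symmetric] using finite_cdim_subset by blast
qed

text \<open>This turns a sum of multiplicities into the dimension of a single span: bases of
  eigenspaces for different singular values are orthogonal to each other, hence disjoint.\<close>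

lemma sv_orthonormal_system:
  fixes T :: "'a::complex_hilbert_space \<Rightarrow>\<^sub>L 'a"
  assumes T: "T \<in> compact_ops" and J: "finite J" "J \<subseteq> singular_values T"
  obtains U where "finite U" "orthonormal U"
    "card U = (\<Sum>t\<in>J. complex_vector.dim (sv_eigenspace T t))"
    "\<And>b. b \<in> U \<Longrightarrow> \<exists>t\<in>J. b \<in> sv_eigenspace T t"
    "\<And>t. t \<in> J \<Longrightarrow> sv_eigenspace T t \<subseteq> complex_vector.span U"
proof -
  have bT: "T \<in> bounded_ops"
    using T by (simp add: compact_ops_def)
  have pos: "t > 0" if "t \<in> J" for t
    using J(2) that by (auto simp: singular_values_def)
  have "\<exists>B. finite B \<and> orthonormal B \<and> complex_vector.span B = sv_eigenspace T t \<and>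
    card B = complex_vector.dim (sv_eigenspace T t)" if "t \<in> J" for t
    using orthonormal_basis[OF finite_cdim_sv_eigenspace[OF T pos[OF that]]
        csubspace_sv_eigenspace[OF bT]] by metis
  then obtain B where B: "\<And>t. t \<in> J \<Longrightarrow> finite (B t)" "\<And>t. t \<in> J \<Longrightarrow> orthonormal (B t)"
    "\<And>t. t \<in> J \<Longrightarrow> complex_vector.span (B t) = sv_eigenspace T t"
    "\<And>t. t \<in> J \<Longrightarrow> card (B t) = complex_vector.dim (sv_eigenspace T t)"
    by metis
  have sub: "b \<in> sv_eigenspace T t" if "t \<in> J" "b \<in> B t" for b t
    using B(3)[OF that(1)] that(2) complex_vector.span_base by blast
  have orth: "cinner b c = 0" if "t \<in> J" "u \<in> J" "t \<noteq> u" "b \<in> B t" "c \<in> B u" for b c t u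
    using sv_eigenspace_orthogonal[OF bT sub[OF that(1,4)] sub[OF that(2,5)]] pos that by blast
  have norm: "norm b = 1" if "t \<in> J" "b \<in> B t" for b t
    using B(2)[OF that(1)] that(2) by (simp add: orthonormal_def)
  have "B t \<inter> B u = {}" if "t \<in> J" "u \<in> J" "t \<noteq> u" for t u
  proof -
    have False if "b \<in> B t" "b \<in> B u" for b
      using orth[OF \<open>t \<in> J\<close> \<open>u \<in> J\<close> \<open>t \<noteq> u\<close> that] norm[OF \<open>t \<in> J\<close> that(1)] by auto
    then show ?thesis by blast
  qed
  then have "card (\<Union>t\<in>J. B t) = (\<Sum>t\<in>J. card (B t))"
    using J(1) B(1) by (intro card_UN_disjoint) auto
  moreover have "orthonormal (\<Union>t\<in>J. B t)"
  proof -
    have "cinner b c = 0" if "t \<in> J" "u \<in> J" "b \<in> B t" "c \<in> B u" "b \<noteq> c" for b c t u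
      using orth[of t u b c] that B(2)[of t] by (cases "t = u") (auto simp: orthonormal_def)
    then show ?thesis
      using norm by (auto simp: orthonormal_def)
  qed
  moreover have "sv_eigenspace T t \<subseteq> complex_vector.span (\<Union>t\<in>J. B t)" if "t \<in> J" for t
    using complex_vector.span_mono[of "B t" "\<Union>t\<in>J. B t"] B(3)[OF that] that by blast
  moreover have "\<exists>t\<in>J. b \<in> sv_eigenspace T t" if "b \<in> (\<Union>t\<in>J. B t)" for b
    using that sub by blast
  ultimately show thesis
    using that[of "\<Union>t\<in>J. B t"] J(1) B(1,4) by simp
qed

text \<open>Every singular value contributes at least one vector to an orthonormal system of bounded
  size. The contribution is positive because the eigenspace is nonzero and finite-dimensional, so
  \<open>dim\<close> does not fall back to its default 0.\<close>

lemma finite_singular_values_ge: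
  fixes T :: "'a::complex_hilbert_space \<Rightarrow>\<^sub>L 'a"
  assumes T: "T \<in> compact_ops" and s: "s > 0"
  shows "finite {t \<in> singular_values T. s \<le> t}"
proof -
  obtain k where k: "\<And>B. finite B \<Longrightarrow> orthonormal B \<Longrightarrow>
    (\<And>b. b \<in> B \<Longrightarrow> \<exists>t\<ge>s. b \<in> sv_eigenspace T t) \<Longrightarrow> card B \<le> k"
    using sv_eigenvectors_card_bound[OF T s] by blast
  have "card J \<le> k" if J: "J \<subseteq> {t \<in> singular_values T. s \<le> t}" "finite J" for J
  proof -
    have J': "J \<subseteq> singular_values T"
      using J by blast
    obtain U where U: "finite U" "orthonormal U"
      "card U = (\<Sum>t\<in>J. complex_vector.dim (sv_eigenspace T t))"
      "\<And>b. b \<in> U \<Longrightarrow> \<exists>t\<in>J. b \<in> sv_eigenspace T t"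
      "\<And>t. t \<in> J \<Longrightarrow> sv_eigenspace T t \<subseteq> complex_vector.span U"
      by (rule sv_orthonormal_system[OF T J(2) J']) blast
    have "1 \<le> complex_vector.dim (sv_eigenspace T t)" if t: "t \<in> J" for t
    proof -
      obtain x where x: "x \<in> sv_eigenspace T t" "x \<noteq> 0" and "t > 0"
        using J' t by (auto simp: singular_values_def)
      then have "complex_vector.dim {x} \<le> complex_vector.dim (sv_eigenspace T t)"
        by (intro cdim_mono finite_cdim_sv_eigenspace T) auto
      moreover have "complex_vector.dim {x} = 1"
        using x(2) complex_vector.dim_eq_card_independent[of "{x}"] by simp
      ultimately show ?thesis by simp
    qed
    then have "(\<Sum>t\<in>J. 1) \<le> card U"
      unfolding U(3) by (intro sum_mono)
    moreover have "card U \<le> k"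
      using U(4) J(1) by (intro k U(1,2)) blast
    ultimately show ?thesis by simp
  qed
  then show ?thesis
    using finite_if_finite_subsets_card_bdd[of "{t \<in> singular_values T. s \<le> t}" k] by blast
qed

text \<open>By dimension, the orthogonal projection onto the span of \<open>G\<close> cannot be
  injective on the span of \<open>B\<close>; a nonzero vector in its kernel is orthogonal to
  \<open>G\<close>.\<close>

lemma orthonormal_annihilator:
  fixes B :: "'a::complex_hilbert_space set"
  assumes B: "finite B" "orthonormal B" and G: "finite G" "card G < card B"
  obtains x where "x \<in> complex_vector.span B" "x \<noteq> 0" "\<And>g. g \<in> G \<Longrightarrow> cinner g x = 0"
proof -
  define M where "M = complex_vector.span G"
  have M: "closed M" "complex_vector.subspace M"
    unfolding M_def using closed_cspan[OF G(1)] by simp_all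
  interpret c: Vector_Spaces.linear scaleC scaleC "cproj M"
    by (rule linear_cproj[OF M])
  have "\<not> inj_on (cproj M) (complex_vector.span B)"
  proof
    assume "inj_on (cproj M) (complex_vector.span B)"
    then have "complex_vector.dim (cproj M ` complex_vector.span B) = card B"
      using cdim_image_inj[OF linear_cproj[OF M] complex_vector.subspace_span, of B]
        complex_vector.dim_span_eq_card_independent[OF orthonormal_independent[OF B(2)]] by simp
    moreover have "complex_vector.dim (cproj M ` complex_vector.span B) \<le> card G"
      using cproj_in[OF M] by (intro complex_vector.dim_le_card G) (auto simp: M_def)
    ultimately show False
      using G(2) by simp
  qed
  then obtain x y where xy: "x \<in> complex_vector.span B" "y \<in> complex_vector.span B"
    "cproj M x = cproj M y" "x \<noteq> y"
    by (auto simp: inj_on_def)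
  have "cproj M (x - y) = 0"
    using xy(3) by (simp add: c.diff)
  then have "x - y \<in> orth_compl M"
    using cproj_orth[OF M, of "x - y"] by simp
  then have "x - y \<in> orth_compl G"
    by (simp add: M_def orth_compl_cspan)
  then show thesis
    using xy complex_vector.span_diff[of x B y] by (intro that[of "x - y"]) (auto simp: orth_compl_def)
qed

text \<open>A maximizing sequence for \<open>\<parallel>T x\<parallel>\<close> on the unit sphere of \<open>X\<close> consists of approximate eigenvectors of
  \<open>T\<^sup>*T\<close>; compactness of \<open>T\<close> makes a subsequence converge.\<close>

lemma compact_ops_norm_attained:
  fixes T :: "'a::complex_hilbert_space \<Rightarrow>\<^sub>L 'a"
  assumes T: "T \<in> compact_ops" and X: "closed X" "complex_vector.subspace X"
    and invariant: "\<And>x. x \<in> X \<Longrightarrow> cadjoint T (T x) \<in> X"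
    and x0: "x0 \<in> X" "x0 \<noteq> 0" "s * norm x0 \<le> norm (T x0)" and s: "s > 0"
  obtains c x where "c \<ge> s" "x \<in> X" "x \<noteq> 0" "x \<in> sv_eigenspace T c"
proof -
  have bT: "T \<in> bounded_ops"
    using T by (simp add: compact_ops_def)
  define Y where "Y = {x \<in> X. norm x = 1}"
  \<comment> \<open>The norm of \<open>T\<close> restricted to \<open>X\<close>. It is at least
    \<open>s\<close> because of \<open>x0\<close>, hence positive, which later permits division by
    \<open>c\<^sup>2\<close>.\<close>
  define c where "c = Sup ((\<lambda>x. norm (T x)) ` Y)"
  have bdd: "bdd_above ((\<lambda>x. norm (T x)) ` Y)"
  proof (rule bdd_aboveI2)
    show "norm (T x) \<le> norm T" if "x \<in> Y" for x
      using norm_blinfun[of T x] that by (simp add: Y_def)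
  qed
  have le_c: "norm (T x) \<le> c * norm x" if "x \<in> X" for x
  proof (cases "x = 0")
    case False
    define y where "y = complex_of_real (1 / norm x) *\<^sub>C x"
    have "y \<in> Y"
      using that complex_vector.subspace_scale[OF X(2)] False
      by (simp add: y_def Y_def norm_scaleC norm_divide)
    then have "norm (T y) \<le> c"
      unfolding c_def by (intro cSup_upper bdd imageI)
    then show ?thesis
      using False by (simp add: y_def bounded_opsD[OF bT] norm_scaleC norm_divide field_simps)
  qed simp
  have "s * norm x0 \<le> c * norm x0"
    using x0 le_c[of x0] by linarith
  then have "s \<le> c"
    using x0(2) by simp
  then have "c > 0"
    using s by simp
  have "Y \<noteq> {}"
  proof -
    have "complex_of_real (1 / norm x0) *\<^sub>C x0 \<in> Y"
      using x0 complex_vector.subspace_scale[OF X(2)] by (simp add: Y_def norm_scaleC norm_divide)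
    then show ?thesis by blast
  qed
  have "\<exists>x\<in>Y. c - 1 / real (Suc n) < norm (T x)" for n
    using less_cSup_iff[of "(\<lambda>x. norm (T x)) ` Y" "c - 1 / real (Suc n)"] bdd \<open>Y \<noteq> {}\<close>
    by (simp add: c_def[symmetric])
  then obtain x where x: "\<And>n. x n \<in> Y" "\<And>n. c - 1 / real (Suc n) < norm (T (x n))"
    by metis
  have lim_c: "(\<lambda>n. norm (T (x n))) \<longlonglongrightarrow> c"
  proof (rule tendsto_sandwich)
    show "(\<lambda>n. c - 1 / real (Suc n)) \<longlonglongrightarrow> c"
      using LIMSEQ_inverse_real_of_nat_add_minus[of c] by (simp add: inverse_eq_divide)
    show "\<forall>\<^sub>F n in sequentially. norm (T (x n)) \<le> c"
      using le_c x(1) by (intro always_eventually) (fastforce simp: Y_def)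
  qed (use x(2) less_imp_le in \<open>auto intro!: always_eventually\<close>)
  have "seq_compact (closure (blinfun_apply T ` cball 0 1))"
    using T by (simp add: compact_ops_def compact_eq_seq_compact_metric)
  moreover have "T (x n) \<in> closure (blinfun_apply T ` cball 0 1)" for n
    using x(1)[of n] by (intro subsetD[OF closure_subset] imageI) (simp add: Y_def)
  ultimately obtain y \<rho> where \<rho>: "strict_mono \<rho>" "((\<lambda>n. T (x n)) \<circ> \<rho>) \<longlonglongrightarrow> y"
    unfolding seq_compact_def by metis
  define u where "u n = x (\<rho> n)" for n
  have uX: "u n \<in> X" and u1: "norm (u n) = 1" for n
    using x(1) by (auto simp: u_def Y_def)
  have Tu: "(\<lambda>n. T (u n)) \<longlonglongrightarrow> y"
    using \<rho>(2) by (simp add: u_def o_def)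
  have Tu_c: "(\<lambda>n. norm (T (u n))) \<longlonglongrightarrow> c"
    using LIMSEQ_subseq_LIMSEQ[OF lim_c \<rho>(1)] by (simp add: u_def o_def)
  define S where "S = cadjoint T"
  \<comment> \<open>After expanding the square it remains to bound \<open>norm (S (T v))\<close> by
    \<open>c * c\<close>. Invariance of \<open>X\<close> enters here: it allows the bound
    \<open>le_c\<close> to be applied to \<open>S (T v)\<close>.\<close>
  have approx: "(norm (S (T (u n)) - c\<^sup>2 *\<^sub>R u n))\<^sup>2 \<le> 2 * c ^ 4 - 2 * c\<^sup>2 * (norm (T (u n)))\<^sup>2" for n
  proof -
    define v where "v = u n"
    have v: "v \<in> X" "norm v = 1"
      using uX u1 by (auto simp: v_def)
    have inner: "inner (S w) z = inner w (T z)" for w z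
      by (simp add: inner_eq_Re_cinner S_def cinner_cadjoint'[OF bT])
    have "norm (S (T v)) \<le> c * norm (T v)"
    proof (cases "S (T v) = 0")
      case False
      have "(norm (S (T v)))\<^sup>2 = inner (T v) (T (S (T v)))"
        by (simp add: power2_norm_eq_inner inner)
      also have "\<dots> \<le> norm (T v) * norm (T (S (T v)))"
        by (rule norm_cauchy_schwarz)
      also have "\<dots> \<le> norm (T v) * (c * norm (S (T v)))"
        using le_c[OF invariant[OF v(1)]] by (intro mult_left_mono) (auto simp: S_def)
      finally have "norm (S (T v)) * norm (S (T v)) \<le> (c * norm (T v)) * norm (S (T v))"
        by (simp add: power2_eq_square mult.assoc mult.left_commute)
      then show ?thesis
        by (rule mult_right_le_imp_le) (use False in simp)
    qed (use \<open>c > 0\<close> in simp)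
    also have "\<dots> \<le> c * c"
      using le_c[OF v(1)] v(2) \<open>c > 0\<close> by (intro mult_left_mono) auto
    finally have "(norm (S (T v)))\<^sup>2 \<le> (c * c)\<^sup>2"
      by (intro power_mono) auto
    moreover have "(norm (S (T v) - c\<^sup>2 *\<^sub>R v))\<^sup>2
        = (norm (S (T v)))\<^sup>2 - 2 * c\<^sup>2 * inner (S (T v)) v + (c\<^sup>2)\<^sup>2 * inner v v"
      unfolding power2_norm_eq_inner inner_diff_left inner_diff_right
      by (simp add: inner_commute power2_eq_square algebra_simps)
    moreover have "inner (S (T v)) v = (norm (T v))\<^sup>2"
      by (simp add: inner power2_norm_eq_inner)
    moreover have "inner v v = 1"
      using v(2) by (simp flip: power2_norm_eq_inner)
    ultimately show ?thesis
      by (simp add: v_def[symmetric] power_mult_distrib flip: power_mult power_add)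
  qed
  have "(\<lambda>n. (norm (S (T (u n)) - c\<^sup>2 *\<^sub>R u n))\<^sup>2) \<longlonglongrightarrow> 0"
  proof (rule tendsto_sandwich[OF _ _ tendsto_const])
    show "(\<lambda>n. 2 * c ^ 4 - 2 * c\<^sup>2 * (norm (T (u n)))\<^sup>2) \<longlonglongrightarrow> 0"
      by (rule tendsto_eq_intros Tu_c refl)+ (simp add: power2_eq_square power4_eq_xxxx)
  qed (use approx in auto)
  then have "(\<lambda>n. sqrt ((norm (S (T (u n)) - c\<^sup>2 *\<^sub>R u n))\<^sup>2)) \<longlonglongrightarrow> sqrt 0"
    by (rule tendsto_real_sqrt)
  then have "(\<lambda>n. norm (S (T (u n)) - c\<^sup>2 *\<^sub>R u n)) \<longlonglongrightarrow> 0"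
    by simp
  then have diff: "(\<lambda>n. S (T (u n)) - c\<^sup>2 *\<^sub>R u n) \<longlonglongrightarrow> 0"
    by (rule tendsto_norm_zero_cancel)
  have STu: "(\<lambda>n. S (T (u n))) \<longlonglongrightarrow> S y"
    by (intro tendsto_intros Tu)
  have "(\<lambda>n. (1 / c\<^sup>2) *\<^sub>R (S (T (u n)) - (S (T (u n)) - c\<^sup>2 *\<^sub>R u n))) \<longlonglongrightarrow> (1 / c\<^sup>2) *\<^sub>R (S y - 0)"
    by (intro tendsto_intros STu diff)
  \<comment> \<open>The images \<open>S (T (u n))\<close> converge by compactness and differ from
    \<open>c\<^sup>2 *\<^sub>R u n\<close> by a null sequence, so the vectors \<open>u n\<close>
    themselves converge in norm.\<close>
  then have u: "u \<longlonglongrightarrow> (1 / c\<^sup>2) *\<^sub>R S y"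
    using \<open>c > 0\<close> by simp
  define l where "l = (1 / c\<^sup>2) *\<^sub>R S y"
  have "l \<in> X"
    unfolding l_def by (rule closed_sequentially[OF X(1) uX u])
  have "(\<lambda>n. norm (u n)) \<longlonglongrightarrow> norm l"
    unfolding l_def by (intro tendsto_norm u)
  then have "norm l = 1"
    by (simp add: u1 LIMSEQ_const_iff)
  have "(\<lambda>n. S (T (u n))) \<longlonglongrightarrow> S (T l)"
    unfolding l_def by (intro tendsto_intros u)
  then have "S (T l) = S y"
    using STu LIMSEQ_unique by blast
  then have "S (T l) = c\<^sup>2 *\<^sub>R l"
    using \<open>c > 0\<close> by (simp add: l_def)
  then have "l \<in> sv_eigenspace T c"
    by (simp add: sv_eigenspace_def S_def scaleC_of_real del: of_real_power)
  then show thesis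
    using that \<open>s \<le> c\<close> \<open>l \<in> X\<close> \<open>norm l = 1\<close> by force
qed

text \<open>Pythagoras on both sides: orthogonal expansions of \<open>x\<close> and
  \<open>T x\<close> have the same coefficients, and each coefficient of \<open>T x\<close> is
  weighted by a norm of at least \<open>s\<close>.\<close>

lemma norm_lower_bound_cspan:
  fixes T :: "'a::complex_hilbert_space \<Rightarrow>\<^sub>L 'a"
  assumes T: "T \<in> bounded_ops" and "finite B" "orthonormal B"
    and "\<And>b c. b \<in> B \<Longrightarrow> c \<in> B \<Longrightarrow> b \<noteq> c \<Longrightarrow> cinner (T b) (T c) = 0"
    and "\<And>b. b \<in> B \<Longrightarrow> s \<le> norm (T b)" and s: "s \<ge> 0"
    and "x \<in> complex_vector.span B"
  shows "s * norm x \<le> norm (T x)"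
  using assms(2-5,7)
proof (induction B arbitrary: x)
  case (insert b B)
  obtain k where k: "x - k *\<^sub>C b \<in> complex_vector.span B"
    using insert.prems by (auto simp: complex_vector.span_insert)
  define y where "y = x - k *\<^sub>C b"
  have x: "x = y + k *\<^sub>C b"
    by (simp add: y_def)
  have "s * norm y \<le> norm (T y)"
    using insert.prems k by (intro insert.IH) (auto simp: y_def orthonormal_def)
  \<comment> \<open>The second membership expresses that \<open>T b\<close> is orthogonal to the
    images of all elements of \<open>B\<close>; in this form it extends from \<open>B\<close> to its
    span.\<close>
  have "b \<in> orth_compl B" "cadjoint T (T b) \<in> orth_compl B"
    using insert.prems insert.hyps
    by (auto simp: orth_compl_def orthonormal_def simp flip: cinner_cadjoint[OF T])
  then have "b \<in> orth_compl (complex_vector.span B)"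
    "cadjoint T (T b) \<in> orth_compl (complex_vector.span B)"
    by (simp_all only: orth_compl_cspan)
  then have "cinner y (k *\<^sub>C b) = 0" "cinner (T y) (k *\<^sub>C T b) = 0"
    using k by (auto simp: y_def orth_compl_def cinner_scaleC_right cinner_cadjoint[OF T])
  then have "(norm x)\<^sup>2 = (norm y)\<^sup>2 + (cmod k)\<^sup>2 * (norm b)\<^sup>2"
    "(norm (T x))\<^sup>2 = (norm (T y))\<^sup>2 + (cmod k)\<^sup>2 * (norm (T b))\<^sup>2"
    unfolding x blinfun.add_right bounded_opsD[OF T]
    by (simp_all add: norm_add_orthogonal norm_scaleC power_mult_distrib)
  moreover have "norm b = 1"
    using insert.prems by (simp add: orthonormal_def)
  moreover have "(s * norm y)\<^sup>2 \<le> (norm (T y))\<^sup>2"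
    using \<open>s * norm y \<le> norm (T y)\<close> s by (intro power_mono) auto
  moreover have "(cmod k)\<^sup>2 * s\<^sup>2 \<le> (cmod k)\<^sup>2 * (norm (T b))\<^sup>2"
    using insert.prems(3)[of b] s by (intro mult_left_mono power_mono) auto
  ultimately have "(s * norm x)\<^sup>2 \<le> (norm (T x))\<^sup>2"
    by (simp add: power_mult_distrib algebra_simps)
  then show ?case
    by (rule power2_le_imp_le) simp
qed simp

text \<open>A value \<open>F x\<close> lies in the span of a finite set \<open>B\<close>, so it
  vanishes once it is orthogonal to \<open>B\<close>. Moving \<open>F\<close> to the other side
  makes this finitely many linear conditions on \<open>x\<close>.\<close>

lemma finite_rank_annihilator:
  fixes F :: "'a::complex_hilbert_space \<Rightarrow>\<^sub>L 'a"
  assumes F: "F \<in> finite_rank_ops"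
  obtains G where "finite G" "\<And>x. (\<And>g. g \<in> G \<Longrightarrow> cinner g x = 0) \<Longrightarrow> F x = 0"
proof -
  have bF: "F \<in> bounded_ops"
    using F by (rule finite_rank_bounded_ops)
  obtain B where B: "finite B" "ran_op F \<subseteq> complex_vector.span B"
    using F by (auto simp: finite_rank_ops_def finite_cdim_def)
  show thesis
  proof (rule that[of "blinfun_apply (cadjoint F) ` B"])
    show "F x = 0" if *: "\<And>g. g \<in> blinfun_apply (cadjoint F) ` B \<Longrightarrow> cinner g x = 0" for x
    proof -
      have "cinner b (F x) = 0" if b: "b \<in> B" for b
        using *[OF imageI[OF b]] by (simp add: cinner_cadjoint'[OF bF])
      then have "F x \<in> orth_compl B"
        by (simp add: orth_compl_def)
      then have "F x \<in> orth_compl (complex_vector.span B)"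
        by (simp only: orth_compl_cspan)
      moreover have "F x \<in> complex_vector.span B"
        using B(2) by (auto simp: ran_op_def)
      ultimately show ?thesis
        using Int_orth_compl by blast
    qed
  qed (use B in simp)
qed

text \<open>Weyl's inequality \<open>s\<^bsub>k + r\<^esub>(T + F) \<le> s\<^bsub>k\<^esub>(T)\<close> for \<open>r = rank F\<close>, in terms of counting functions.\<close>

lemma singular_value_count:
  fixes T :: "'a::complex_hilbert_space \<Rightarrow>\<^sub>L 'a"
  assumes T: "T \<in> compact_ops" and F: "F \<in> finite_rank_ops"
  obtains r where "\<And>J s. finite J \<Longrightarrow> J \<subseteq> {t \<in> singular_values (T + F). s \<le> t} \<Longrightarrow> 0 < s \<Longrightarrow>
    (\<Sum>t\<in>J. complex_vector.dim (sv_eigenspace (T + F) t))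
      \<le> r + (\<Sum>u\<in>{u \<in> singular_values T. s \<le> u}. complex_vector.dim (sv_eigenspace T u))"
proof -
  define S where "S = T + F"
  have S: "S \<in> compact_ops"
    unfolding S_def by (rule compact_ops_add_finite_rank[OF T F])
  have bT: "T \<in> bounded_ops" and bS: "S \<in> bounded_ops"
    using T S by (auto simp: compact_ops_def)
  obtain G where G: "finite G" "\<And>x. (\<And>g. g \<in> G \<Longrightarrow> cinner g x = 0) \<Longrightarrow> F x = 0"
    using finite_rank_annihilator[OF F] by blast
  have "(\<Sum>t\<in>J. complex_vector.dim (sv_eigenspace S t))
      \<le> card G + (\<Sum>u\<in>{u \<in> singular_values T. s \<le> u}. complex_vector.dim (sv_eigenspace T u))"
    if J: "finite J" "J \<subseteq> {t \<in> singular_values S. s \<le> t}" and s: "s > 0" for J s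
  proof (rule ccontr)
    define K where "K = {u \<in> singular_values T. s \<le> u}"
    have K: "finite K" "K \<subseteq> singular_values T"
      unfolding K_def using finite_singular_values_ge[OF T s] by auto
    have J': "J \<subseteq> singular_values S"
      using J by blast
    assume "\<not> ?thesis"
    then have less: "card G + (\<Sum>u\<in>K. complex_vector.dim (sv_eigenspace T u))
        < (\<Sum>t\<in>J. complex_vector.dim (sv_eigenspace S t))"
      by (simp add: K_def)
    obtain U where U: "finite U" "orthonormal U"
      "card U = (\<Sum>t\<in>J. complex_vector.dim (sv_eigenspace S t))"
      "\<And>b. b \<in> U \<Longrightarrow> \<exists>t\<in>J. b \<in> sv_eigenspace S t"
      "\<And>t. t \<in> J \<Longrightarrow> sv_eigenspace S t \<subseteq> complex_vector.span U"
      by (rule sv_orthonormal_system[OF S J(1) J']) blast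
    obtain W where W: "finite W" "orthonormal W"
      "card W = (\<Sum>t\<in>K. complex_vector.dim (sv_eigenspace T t))"
      "\<And>b. b \<in> W \<Longrightarrow> \<exists>t\<in>K. b \<in> sv_eigenspace T t"
      "\<And>t. t \<in> K \<Longrightarrow> sv_eigenspace T t \<subseteq> complex_vector.span W"
      by (rule sv_orthonormal_system[OF T K]) blast
    \<comment> \<open>The assumed strict inequality leaves room for a nonzero \<open>x\<close> in
      the span of \<open>U\<close> orthogonal to both sets: orthogonality to \<open>G\<close> gives
      \<open>F x = 0\<close>, so the lower bound for \<open>S\<close> holds for \<open>T\<close>,
      and orthogonality to \<open>W\<close> removes the eigenspaces of \<open>T\<close> for values
      at least \<open>s\<close>.\<close>
    have GW: "finite (G \<union> W)" "card (G \<union> W) < card U"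
      using card_Un_le[of G W] less U(3) W(3) G(1) W(1) by (simp, linarith)
    obtain x where x: "x \<in> complex_vector.span U" "x \<noteq> 0"
      "\<And>g. g \<in> G \<union> W \<Longrightarrow> cinner g x = 0"
      by (rule orthonormal_annihilator[OF U(1,2) GW]) blast
    have "s * norm x \<le> norm (S x)"
    proof (rule norm_lower_bound_cspan[OF bS U(1,2) _ _ _ x(1)])
      fix b assume b: "b \<in> U"
      then obtain t where t: "t \<in> J" "b \<in> sv_eigenspace S t"
        using U(4) by blast
      then have "s \<le> t"
        using J by blast
      have "norm b = 1"
        using U(2) b by (simp add: orthonormal_def)
      then show "s \<le> norm (S b)"
        using norm_sv_eigenvector[OF bS t(2)] \<open>s \<le> t\<close> s by simp
      fix c assume "c \<in> U" "b \<noteq> c"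
      then show "cinner (S b) (S c) = 0"
        using t(2) sv_eigenspace_iff[OF bS, of b t] U(2) b by (simp add: orthonormal_def)
    qed (use s in simp)
    moreover have "F x = 0"
      using G(2) x(3) by blast
    ultimately have sT: "s * norm x \<le> norm (T x)"
      by (simp add: S_def blinfun.add_left)
    \<comment> \<open>Every eigenspace is invariant under the self-adjoint
      \<open>T\<^sup>*T\<close>, hence so is \<open>X\<close>. Maximizing on \<open>X\<close> yields
      an eigenvector for a value at least \<open>s\<close>; it lies in one of the removed
      eigenspaces and is therefore orthogonal to itself.\<close>
    define X where "X = orth_compl (\<Union>u\<in>K. sv_eigenspace T u)"
    have "x \<in> orth_compl W"
      using x(3) by (auto simp: orth_compl_def)
    then have "x \<in> orth_compl (complex_vector.span W)"
      by (simp only: orth_compl_cspan)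
    then have "x \<in> X"
      using W(5) by (auto simp: X_def orth_compl_def)
    have "cadjoint T (T v) \<in> X" if "v \<in> X" for v
      using that by (auto simp: X_def orth_compl_def sv_eigenspace_iff[OF bT]
          simp flip: cinner_cadjoint[OF bT])
    then obtain c y where c: "c \<ge> s" "y \<in> X" "y \<noteq> 0" "y \<in> sv_eigenspace T c"
      using compact_ops_norm_attained[OF T, of X x s] sT x(2) \<open>x \<in> X\<close> s
        closed_orth_compl csubspace_orth_compl unfolding X_def by metis
    then have "c \<in> K"
      using s by (auto simp: K_def singular_values_def)
    then have "cinner y y = 0"
      using c(2,4) by (auto simp: X_def orth_compl_def)
    then show False
      using c(3) by simp
  qed
  then show thesis
    using that unfolding S_def by blast
qed

section \<open>Summation by parts and the Schatten classes\<close>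

lemma increment_decomposition:
  fixes h :: "'a::linorder \<Rightarrow> real"
  assumes "finite J" "\<And>t. t \<in> J \<Longrightarrow> 0 \<le> h t" "\<And>t u. t \<in> J \<Longrightarrow> u \<in> J \<Longrightarrow> t \<le> u \<Longrightarrow> h t \<le> h u"
  obtains d where "\<And>s. s \<in> J \<Longrightarrow> 0 \<le> d s" "\<And>t. t \<in> J \<Longrightarrow> (\<Sum>s | s \<in> J \<and> s \<le> t. d s) = h t"
proof -
  have "\<exists>d. (\<forall>s\<in>J. 0 \<le> d s) \<and> (\<forall>t\<in>J. (\<Sum>s | s \<in> J \<and> s \<le> t. d s) = h t)"
    using assms
  proof (induction J rule: finite_linorder_max_induct)
    case (insert b J)
    have "\<exists>d. (\<forall>s\<in>J. 0 \<le> d s) \<and> (\<forall>t\<in>J. (\<Sum>s | s \<in> J \<and> s \<le> t. d s) = h t)"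
      using insert.prems by (intro insert.IH) auto
    then obtain d where d: "\<forall>s\<in>J. 0 \<le> d s" "\<forall>t\<in>J. (\<Sum>s | s \<in> J \<and> s \<le> t. d s) = h t"
      by blast
    \<comment> \<open>The new largest element receives the increment of \<open>h\<close> over the
      previous maximum. With no previous element that value counts as 0, so the smallest element
      carries \<open>h\<close> itself.\<close>
    define d' where "d' = d(b := h b - (if J = {} then 0 else h (Max J)))"
    have b: "b \<notin> J"
      using insert.hyps by blast
    have "(if J = {} then 0 else h (Max J)) \<le> h b"
    proof (cases "J = {}")
      case False
      then have "Max J \<in> J"
        using insert.hyps by simp
      then show ?thesis
        using insert.prems(2)[of "Max J" b] insert.hyps False by (simp add: less_imp_le)
    qed (use insert.prems in simp)
    then have "0 \<le> d' s" if "s \<in> insert b J" for s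
      using that d(1) by (auto simp: d'_def)
    moreover have "(\<Sum>s | s \<in> insert b J \<and> s \<le> t. d' s) = h t" if "t \<in> insert b J" for t
    proof (cases "t = b")
      case True
      have "{s. s \<in> insert b J \<and> s \<le> b} = insert b J"
        using insert.hyps by auto
      moreover have "(\<Sum>s\<in>J. d' s) = (\<Sum>s\<in>J. d s)"
        using b by (intro sum.cong) (auto simp: d'_def)
      moreover have "(\<Sum>s\<in>J. d s) = (if J = {} then 0 else h (Max J))"
      proof (cases "J = {}")
        case False
        then have "{s. s \<in> J \<and> s \<le> Max J} = J" "Max J \<in> J"
          using insert.hyps by auto
        then show ?thesis
          using d(2) False by force
      qed simp
      ultimately show ?thesis
        using b insert.hyps by (simp add: True d'_def)
    next
      case False
      then have "t \<in> J"
        using that by simp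
      then have "{s. s \<in> insert b J \<and> s \<le> t} = {s. s \<in> J \<and> s \<le> t}"
        using insert.hyps by auto
      moreover have "(\<Sum>s | s \<in> J \<and> s \<le> t. d' s) = (\<Sum>s | s \<in> J \<and> s \<le> t. d s)"
        using b by (intro sum.cong) (auto simp: d'_def)
      ultimately show ?thesis
        using d(2) \<open>t \<in> J\<close> by simp
    qed
    ultimately show ?case by blast
  qed simp
  then show thesis
    using that by blast
qed

text \<open>Abel summation: writing \<open>h\<close> as a sum of increments \<open>d\<close> and
  exchanging the sums reduces the claim to the counting inequality, weighted by the nonnegative
  \<open>d s\<close>. The constant \<open>r\<close> is multiplied by the total increment, which is
  at most \<open>b\<close>.\<close>

lemma weighted_sum_le_of_count_le:
  fixes h m m' :: "'a::linorder \<Rightarrow> real"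
  assumes J: "finite J" and K: "finite K"
    and h0: "\<And>t. t \<in> J \<union> K \<Longrightarrow> 0 \<le> h t"
    and mono: "\<And>t u. t \<in> J \<Longrightarrow> u \<in> J \<union> K \<Longrightarrow> t \<le> u \<Longrightarrow> h t \<le> h u"
    and m': "\<And>u. u \<in> K \<Longrightarrow> 0 \<le> m' u" and r: "0 \<le> r" and b: "0 \<le> b" "\<And>t. t \<in> J \<Longrightarrow> h t \<le> b"
    and count: "\<And>s. s \<in> J \<Longrightarrow>
      (\<Sum>t | t \<in> J \<and> s \<le> t. m t) \<le> r + (\<Sum>u | u \<in> K \<and> s \<le> u. m' u)"
  shows "(\<Sum>t\<in>J. m t * h t) \<le> r * b + (\<Sum>u\<in>K. m' u * h u)"
proof -
  obtain d where d: "\<And>s. s \<in> J \<Longrightarrow> 0 \<le> d s" "\<And>t. t \<in> J \<Longrightarrow> (\<Sum>s | s \<in> J \<and> s \<le> t. d s) = h t"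
    by (rule increment_decomposition[OF J, of h]) (use h0 mono in auto)
  \<comment> \<open>Increments are taken along \<open>J\<close> only, so at a point \<open>u\<close>
    of \<open>K\<close> they add up to \<open>h\<close> at the largest element of \<open>J\<close>
    below \<open>u\<close>, or to 0 if there is none. On this side an inequality suffices.\<close>
  have dK: "(\<Sum>s | s \<in> J \<and> s \<le> u. d s) \<le> h u" if u: "u \<in> K" for u
  proof (cases "{s. s \<in> J \<and> s \<le> u} = {}")
    case True
    show ?thesis
      unfolding True using h0 u by simp
  next
    case False
    define t where "t = Max {s. s \<in> J \<and> s \<le> u}"
    have t: "t \<in> J" "t \<le> u"
      using Max_in[of "{s. s \<in> J \<and> s \<le> u}"] False J by (auto simp: t_def)
    have "{s. s \<in> J \<and> s \<le> u} = {s. s \<in> J \<and> s \<le> t}"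
      using t J by (auto simp: t_def)
    then show ?thesis
      using d(2)[OF t(1)] mono[OF t(1) _ t(2)] u by simp
  qed
  have dJ: "(\<Sum>s\<in>J. d s) \<le> b"
  proof (cases "J = {}")
    case False
    then have "{s. s \<in> J \<and> s \<le> Max J} = J" "Max J \<in> J"
      using J by auto
    then show ?thesis
      using d(2) b(2) by force
  qed (use b in simp)
  have "(\<Sum>t\<in>J. m t * h t) = (\<Sum>t\<in>J. \<Sum>s | s \<in> J \<and> s \<le> t. m t * d s)"
    by (intro sum.cong) (simp_all add: d(2) flip: sum_distrib_left)
  also have "\<dots> = (\<Sum>s\<in>J. \<Sum>t | t \<in> J \<and> s \<le> t. m t * d s)"
    by (rule sum.swap_restrict[OF J J])
  also have "\<dots> = (\<Sum>s\<in>J. (\<Sum>t | t \<in> J \<and> s \<le> t. m t) * d s)"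
    by (simp add: sum_distrib_right)
  also have "\<dots> \<le> (\<Sum>s\<in>J. (r + (\<Sum>u | u \<in> K \<and> s \<le> u. m' u)) * d s)"
    by (intro sum_mono mult_right_mono count d)
  also have "\<dots> = r * (\<Sum>s\<in>J. d s) + (\<Sum>s\<in>J. \<Sum>u | u \<in> K \<and> s \<le> u. m' u * d s)"
    by (simp add: sum_distrib_left sum_distrib_right sum.distrib distrib_right)
  also have "(\<Sum>s\<in>J. \<Sum>u | u \<in> K \<and> s \<le> u. m' u * d s) = (\<Sum>u\<in>K. \<Sum>s | s \<in> J \<and> s \<le> u. m' u * d s)"
    by (rule sum.swap_restrict[OF J K])
  also have "\<dots> = (\<Sum>u\<in>K. m' u * (\<Sum>s | s \<in> J \<and> s \<le> u. d s))"
    by (simp add: sum_distrib_left)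
  also have "r * (\<Sum>s\<in>J. d s) + \<dots> \<le> r * b + (\<Sum>u\<in>K. m' u * h u)"
    by (intro add_mono sum_mono mult_left_mono dJ dK m' r)
  finally show ?thesis .
qed

text \<open>For finite \<open>p\<close>, all finite partial sums for \<open>T + F\<close> are
  bounded by the full sum for \<open>T\<close> plus a constant. The latter is the counting defect
  times \<open>norm S powr q\<close>, as no singular value exceeds the norm. For
  \<open>p = \<infinity>\<close>, compactness of the sum is the whole claim.\<close>

lemma schatten_ops_add_finite_rank:
  fixes T :: "'a::complex_hilbert_space \<Rightarrow>\<^sub>L 'a"
  assumes p: "0 \<le> p" and T: "T \<in> schatten_ops p" and F: "F \<in> finite_rank_ops"
  shows "T + F \<in> schatten_ops p"
proof -
  define S where "S = T + F"
  have cT: "T \<in> compact_ops"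
    using T by (simp add: schatten_ops_def)
  then have cS: "S \<in> compact_ops"
    unfolding S_def using F by (rule compact_ops_add_finite_rank)
  then have bS: "S \<in> bounded_ops"
    by (simp add: compact_ops_def)
  define q where "q = real_of_ereal p"
  have q: "q \<ge> 0"
    using p by (simp add: q_def real_of_ereal_pos)
  define m where "m R s = real (complex_vector.dim (sv_eigenspace R s))" for R :: "'a \<Rightarrow>\<^sub>L 'a" and s
  obtain r where r: "\<And>J s. finite J \<Longrightarrow> J \<subseteq> {t \<in> singular_values S. s \<le> t} \<Longrightarrow> 0 < s \<Longrightarrow>
    (\<Sum>t\<in>J. complex_vector.dim (sv_eigenspace S t))
      \<le> r + (\<Sum>u\<in>{u \<in> singular_values T. s \<le> u}. complex_vector.dim (sv_eigenspace T u))"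
    using singular_value_count[OF cT F] unfolding S_def by blast
  have "(\<lambda>s. m S s * s powr q) summable_on singular_values S"
    if summ: "(\<lambda>s. m T s * s powr q) summable_on singular_values T"
  proof (rule nonneg_bdd_above_summable_on)
    show "0 \<le> m S s * s powr q" for s
      by (simp add: m_def)
    show "bdd_above (sum (\<lambda>s. m S s * s powr q) ` {J. J \<subseteq> singular_values S \<and> finite J})"
    proof (rule bdd_aboveI2)
      fix J assume "J \<in> {J. J \<subseteq> singular_values S \<and> finite J}"
      then have J: "J \<subseteq> singular_values S" "finite J"
        by auto
      have pos: "t > 0" if "t \<in> J" for t
        using J that by (auto simp: singular_values_def)
      \<comment> \<open>The counting inequality is used at thresholds in \<open>J\<close> only.
        Keeping just the singular values of \<open>T\<close> above some such threshold makes the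
        comparison set finite, since all thresholds are positive.\<close>
      define K where "K = {u \<in> singular_values T. \<exists>t\<in>J. t \<le> u}"
      have K: "finite K"
      proof -
        have "K = (\<Union>t\<in>J. {u \<in> singular_values T. t \<le> u})"
          by (auto simp: K_def)
        then show ?thesis
          using J(2) pos finite_singular_values_ge[OF cT] by simp
      qed
      have "t \<le> norm S" if t: "t \<in> J" for t
      proof -
        obtain x where x: "x \<in> sv_eigenspace S t" "x \<noteq> 0"
          using J(1) t by (auto simp: singular_values_def)
        have "t * norm x \<le> norm S * norm x"
          using norm_blinfun[of S x] norm_sv_eigenvector[OF bS x(1)] pos[OF t] by simp
        then show ?thesis
          using x(2) by simp
      qed
      then have "(\<Sum>t\<in>J. m S t * t powr q) \<le> real r * norm S powr q + (\<Sum>u\<in>K. m T u * u powr q)"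
      proof (intro weighted_sum_le_of_count_le J K)
        fix s assume s: "s \<in> J"
        have "(\<Sum>t | t \<in> J \<and> s \<le> t. complex_vector.dim (sv_eigenspace S t))
          \<le> r + (\<Sum>u\<in>{u \<in> singular_values T. s \<le> u}. complex_vector.dim (sv_eigenspace T u))"
          using J by (intro r pos s) auto
        moreover have "{u \<in> singular_values T. s \<le> u} = {u. u \<in> K \<and> s \<le> u}"
          using s by (auto simp: K_def)
        ultimately have "real (\<Sum>t | t \<in> J \<and> s \<le> t. complex_vector.dim (sv_eigenspace S t))
          \<le> real (r + (\<Sum>u | u \<in> K \<and> s \<le> u. complex_vector.dim (sv_eigenspace T u)))"
          by (simp only: of_nat_le_iff)
        then show "(\<Sum>t | t \<in> J \<and> s \<le> t. m S t) \<le> real r + (\<Sum>u | u \<in> K \<and> s \<le> u. m T u)"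
          by (simp add: m_def)
      qed (use q pos in \<open>auto simp: m_def intro: powr_mono2 less_imp_le\<close>)
      also have "(\<Sum>u\<in>K. m T u * u powr q) \<le> (\<Sum>\<^sub>\<infinity>u\<in>singular_values T. m T u * u powr q)"
        by (intro finite_sum_le_infsum summ K) (auto simp: K_def m_def)
      finally show "(\<Sum>t\<in>J. m S t * t powr q)
        \<le> real r * norm S powr q + (\<Sum>\<^sub>\<infinity>u\<in>singular_values T. m T u * u powr q)"
        by simp
    qed
  qed
  then show ?thesis
    using T cS by (simp add: schatten_ops_def m_def q_def S_def)
qed

section \<open>The reduction step\<close>

lemma inverse_laurentI:
  fixes A :: "complex \<Rightarrow> 'h::complex_hilbert_space \<Rightarrow>\<^sub>L 'h"
  assumes cont: "isCont A z0" and pole: "inverse_pole_of_order A z0 n" and n: "n \<ge> 1"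
    and Q: "Q \<in> bounded_ops" "ran_op Q \<subseteq> ran_op (A z0)" "id_blinfun - Q \<in> finite_rank_ops"
  obtains r C where "C 0 \<noteq> 0" "inverse_laurent A z0 n r C Q"
proof -
  obtain r1 C where r1: "r1 > 0" "C 0 \<noteq> 0" "\<And>z. z \<in> ball z0 r1 - {z0} \<Longrightarrow>
      (\<lambda>k. (z - z0) powi (int k - int n) *\<^sub>C C k) sums inverse_op (A z)"
    using pole n unfolding inverse_pole_of_order_def pole_of_order_def by auto
  obtain r2 where r2: "r2 > 0" "\<And>z. z \<in> ball z0 r2 - {z0} \<Longrightarrow> boundedly_invertible (A z)"
    using pole unfolding inverse_pole_of_order_def eventually_at by (auto simp: dist_commute)
  have "inverse_laurent A z0 n (min r1 r2) C Q"
    using r1 r2 by unfold_locales (use cont n Q in auto)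
  then show thesis
    using that r1(2) by blast
qed

context inverse_laurent
begin

text \<open>Multiplication by \<open>Q - (z - z0) *\<^sub>C P\<close> moves the \<open>P\<close>
  part of the expansion up by one power, while the \<open>Q\<close> part has no leading term because
  \<open>C 0 o\<^sub>L Q = 0\<close>. Hence the new expansion starts one power later, with
  coefficients \<open>D k\<close>.\<close>

lemma reduced_pole:
  assumes C0: "C 0 \<noteq> 0" and QQ: "Q o\<^sub>L Q = Q" and P: "P = id_blinfun - Q"
    and B: "\<And>z. z \<in> ball z0 r - {z0} \<Longrightarrow> B z = inverse_op (A z) o\<^sub>L (Q - (z - z0) *\<^sub>C P)"
  shows "pole_of_order B z0 (n - 1)"
proof -
  define D where "D k = (C (Suc k) o\<^sub>L Q) - (C k o\<^sub>L P)" for k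
  have sums: "(\<lambda>k. (z - z0) powi (int k - int (n - 1)) *\<^sub>C D k) sums B z"
    if z: "z \<in> ball z0 r - {z0}" for z
  proof -
    define w where "w = z - z0"
    have w: "w \<noteq> 0"
      using z by (simp add: w_def)
    have comp: "(\<lambda>k. w powi (int k - int n) *\<^sub>C (C k o\<^sub>L L)) sums (inverse_op (A z) o\<^sub>L L)" for L
      using bounded_linear.sums[OF bounded_bilinear.bounded_linear_left[OF
            bounded_bilinear_blinfun_compose] laurent[OF z], of L]
      by (simp add: w_def blinfun_compose_scaleC_left)
    have "(\<lambda>k. w powi (int (Suc k) - int n) *\<^sub>C (C (Suc k) o\<^sub>L Q)) sums (inverse_op (A z) o\<^sub>L Q)"
      using comp[of Q] by (subst sums_Suc_iff) (simp add: C_0_Q)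
    moreover have "(\<lambda>k. w *\<^sub>C (w powi (int k - int n) *\<^sub>C (C k o\<^sub>L P)))
        sums (w *\<^sub>C (inverse_op (A z) o\<^sub>L P))"
      by (rule bounded_linear.sums[OF bounded_bilinear.bounded_linear_right[OF
            bounded_bilinear_scaleC] comp])
    moreover have "w * w powi (int k - int n) = w powi (int (Suc k) - int n)" for k
      using power_int_add_1'[OF disjI1[OF w], of "int k - int n"] by (simp add: algebra_simps)
    ultimately have "(\<lambda>k. w powi (int (Suc k) - int n) *\<^sub>C (C (Suc k) o\<^sub>L Q)
        - w powi (int (Suc k) - int n) *\<^sub>C (C k o\<^sub>L P))
        sums ((inverse_op (A z) o\<^sub>L Q) - w *\<^sub>C (inverse_op (A z) o\<^sub>L P))"
      by (intro sums_diff) (simp_all add: scaleC_scaleC)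
    moreover have "B z = (inverse_op (A z) o\<^sub>L Q) - w *\<^sub>C (inverse_op (A z) o\<^sub>L P)"
      using B[OF z] boundedly_invertible_inverse_op(1)[OF invertible[OF z]]
      by (simp add: blinfun_compose_simps blinfun_compose_scaleC_right w_def)
    moreover have exponent: "int k - int (n - 1) = int (Suc k) - int n" for k
      using n by (simp add: of_nat_diff)
    ultimately show ?thesis
      unfolding exponent D_def scaleC_diff_right w_def by simp
  qed
  \<comment> \<open>Composing \<open>D 0\<close> with \<open>P\<close> isolates
    \<open>- (C 0 o\<^sub>L P)\<close>, which equals \<open>- C 0\<close>; so the order drops by
    exactly one.\<close>
  have "D 0 \<noteq> 0"
  proof
    assume "D 0 = 0"
    then have "(D 0 o\<^sub>L P) = 0"
      by (simp add: blinfun_compose_simps)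
    moreover have "Q o\<^sub>L P = 0" "P o\<^sub>L P = P"
      by (simp_all add: P blinfun_compose_simps QQ)
    ultimately have "C 0 o\<^sub>L P = 0"
      by (simp add: D_def blinfun_compose_simps)
    then show False
      using C_0_Q C0 by (simp add: P blinfun_compose_simps)
  qed
  \<comment> \<open>For \<open>n = 1\<close> the target order is 0, which asks for an analytic
    extension instead of a nonzero leading coefficient; the expansion is then a power series with
    value \<open>D 0\<close> at \<open>z0\<close>.\<close>
  show ?thesis
  proof (cases "n - 1 = 0")
    case False
    have "\<exists>r>0. \<exists>C. C 0 \<noteq> 0 \<and> (\<forall>z\<in>ball z0 r - {z0}.
        (\<lambda>k. (z - z0) powi (int k - int (n - 1)) *\<^sub>C C k) sums B z)"
      using sums \<open>D 0 \<noteq> 0\<close> r by blast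
    then show ?thesis
      unfolding pole_of_order_def if_not_P[OF False] .
  next
    case True
    define g where "g z = (if z = z0 then D 0 else B z)" for z
    have "(\<lambda>k. (z - z0) ^ k *\<^sub>C D k) sums g z" if z: "z \<in> ball z0 r" for z
    proof (cases "z = z0")
      case True
      have "(\<lambda>k. (z - z0) ^ k *\<^sub>C D k) = (\<lambda>k. if k = 0 then D k else 0)"
        by (auto simp: True)
      then show ?thesis
        using sums_single[of 0 D] True by (simp add: g_def)
    next
      case False
      then show ?thesis
        using sums[of z] z True by (simp add: g_def)
    qed
    then have "vec_analytic_on g (ball z0 r)"
      by (rule vec_analytic_on_power_series)
    then show ?thesis
      using r unfolding pole_of_order_def if_P[OF True]
      by (intro exI[of _ r] conjI exI[of _ g]) (auto simp: g_def)
  qed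
qed

end

text \<open>Index zero turns deficiencies into nullities, which can be compared by an inclusion of
  kernels.\<close>

lemma def_op_eq_dim_ker:
  fixes T :: "'h::complex_hilbert_space \<Rightarrow>\<^sub>L 'h"
  assumes "T \<in> bounded_ops" "ind_op T = 0"
  shows "def_op T = complex_vector.dim (ker_op T)"
  using assms by (simp add: def_op_def ind_op_def ker_cadjoint)

theorem theorem3p4:
  fixes A :: "complex \<Rightarrow> ('h::complex_hilbert_space \<Rightarrow>\<^sub>L 'h)"
    and \<Omega> :: "complex set" and z0 :: complex
    and Q1 P1 :: "'h \<Rightarrow>\<^sub>L 'h"
  assumes separable: "\<exists>D :: 'h set. countable D \<and> closure D = UNIV"
    and "open \<Omega>" and "connected \<Omega>"
    and "vec_analytic_on A \<Omega>"
    and "\<And>z. z \<in> \<Omega> \<Longrightarrow> A z \<in> fredholm_ops"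
    and "\<exists>z\<in>\<Omega>. boundedly_invertible (A z)"
    and "z0 \<in> \<Omega>" and "inverse_pole A z0"
    and "projection_onto Q1 (ran_op (A z0))"
    and "P1 = id_blinfun - Q1"
  shows "\<exists>A1 :: complex \<Rightarrow> ('h \<Rightarrow>\<^sub>L 'h).
      (\<forall>z\<in>\<Omega>. A z = (Q1 - (z - z0) *\<^sub>C P1) o\<^sub>L A1 z) \<and>
      vec_analytic_on A1 \<Omega> \<and>
      (\<forall>z\<in>\<Omega>. A1 z \<in> fredholm_ops) \<and>
      (\<exists>\<epsilon>>0. \<forall>z\<in>\<Omega>. cmod (z - z0) < \<epsilon> \<longrightarrow> ind_op (A z) = 0 \<and> ind_op (A1 z) = 0) \<and>
      def_op (A1 z0) \<le> def_op (A z0) \<and>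
      (\<forall>n0\<ge>1. inverse_pole_of_order A z0 n0 \<longrightarrow> inverse_pole_of_order A1 z0 (n0 - 1)) \<and>
      ((\<forall>z\<in>\<Omega>. id_blinfun - A z \<in> finite_rank_ops) \<longleftrightarrow>
        (\<forall>z\<in>\<Omega>. id_blinfun - A1 z \<in> finite_rank_ops)) \<and>
      (\<forall>p::ereal. 1 \<le> p \<longrightarrow>
        ((\<forall>z\<in>\<Omega>. id_blinfun - A z \<in> schatten_ops p) \<longleftrightarrow>
         (\<forall>z\<in>\<Omega>. id_blinfun - A1 z \<in> schatten_ops p)))"
proof -
  note open\<Omega> = assms(2) and analytic = assms(4) and fredholm = assms(5) and z0 = assms(7)
    and P1 = assms(10)
  obtain n where n: "n \<ge> 1" "inverse_pole_of_order A z0 n"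
    using \<open>inverse_pole A z0\<close> by (auto simp: inverse_pole_def)
  have bA: "A z \<in> bounded_ops" if "z \<in> \<Omega>" for z
    using fredholm[OF that] by (simp add: fredholm_ops_def)
  have Q1: "Q1 \<in> bounded_ops" "Q1 o\<^sub>L Q1 = Q1" "ran_op Q1 = ran_op (A z0)"
    using assms(9) by (auto simp: projection_onto_def)
  have bP1: "P1 \<in> bounded_ops"
    unfolding P1 using Q1 by blast
  have PQ: "Q1 o\<^sub>L P1 = 0" "P1 o\<^sub>L Q1 = 0" "P1 o\<^sub>L P1 = P1"
    by (simp_all add: P1 blinfun_compose_simps Q1)
  have finP1: "P1 \<in> finite_rank_ops"
    unfolding P1 by (rule finite_rank_complementary_projection[OF fredholm[OF z0] assms(9)])
  have QA: "Q1 o\<^sub>L A z0 = A z0"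
  proof (rule blinfun_eqI)
    fix x
    obtain y where "A z0 x = Q1 y"
      using Q1(3) by (force simp: ran_op_def)
    then show "blinfun_apply (Q1 o\<^sub>L A z0) x = blinfun_apply (A z0) x"
      by simp (metis Q1(2) blinfun_apply_blinfun_compose)
  qed
  then have PA: "P1 o\<^sub>L A z0 = 0"
    by (simp add: P1 blinfun_compose_simps)
  have cont: "isCont A z0"
    using vec_analytic_on_isCont[OF analytic z0] .

  \<comment> \<open>As \<open>G\<close> vanishes at \<open>z0\<close>, dividing it by
    \<open>z - z0\<close> gives its difference quotient there, so the limit \<open>D\<close> is
    \<open>P1\<close> composed with the derivative of \<open>A\<close> at \<open>z0\<close>.\<close>
  define G where "G z = P1 o\<^sub>L A z" for z
  have G: "vec_analytic_on G \<Omega>" "G z0 = 0"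
    unfolding G_def using vec_analytic_on_compose_left[OF analytic bP1] PA by auto
  then obtain D where D: "((\<lambda>w. inverse (w - z0) *\<^sub>C G w) \<longlongrightarrow> D) (at z0)"
    using z0 unfolding vec_analytic_on_def by fastforce
  define A1 where
    "A1 z = (Q1 o\<^sub>L A z) - (if z = z0 then D else inverse (z - z0) *\<^sub>C G z)" for z
  have analytic1: "vec_analytic_on A1 \<Omega>"
    unfolding A1_def
    by (intro vec_analytic_on_diff vec_analytic_on_compose_left[OF analytic Q1(1)]
        vec_analytic_on_divide[OF G(1) open\<Omega> z0 G(2) D])

  have "D \<in> bounded_ops"
  proof (rule Lim_in_closed_set[OF closed_bounded_ops _ _ D])
    have "\<forall>\<^sub>F w in at z0. w \<in> \<Omega>"
      using open\<Omega> z0 by (rule eventually_at_in_open')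
    then show "\<forall>\<^sub>F w in at z0. inverse (w - z0) *\<^sub>C G w \<in> bounded_ops"
      unfolding G_def by eventually_elim (intro bounded_ops_intros bP1 bA)
  qed simp
  \<comment> \<open>The identity \<open>P1 o\<^sub>L G w = G w\<close> survives the limit and gives
    \<open>P1 o\<^sub>L D = D\<close>, whence \<open>D\<close> has finite rank.\<close>
  have "((\<lambda>w. P1 o\<^sub>L (inverse (w - z0) *\<^sub>C G w)) \<longlongrightarrow> P1 o\<^sub>L D) (at z0)"
    by (intro tendsto_intros D)
  moreover have "P1 o\<^sub>L (inverse (w - z0) *\<^sub>C G w) = inverse (w - z0) *\<^sub>C G w" for w
  proof -
    have "P1 o\<^sub>L G w = G w"
      unfolding G_def by (metis PQ(3) blinfun_compose_simps(11))
    then show ?thesis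
      by (simp add: blinfun_compose_scaleC_right[OF bP1])
  qed
  ultimately have PD: "P1 o\<^sub>L D = D"
    using D tendsto_unique trivial_limit_at by fastforce
  have finD: "D \<in> finite_rank_ops"
    using finite_rank_ops_compose_right[OF finP1 \<open>D \<in> bounded_ops\<close>] by (simp add: PD)

  have A1_z0: "A1 z0 = A z0 - D"
    by (simp add: A1_def QA)
  \<comment> \<open>On the complementary ranges of \<open>Q1\<close> and \<open>P1\<close> the
    operator \<open>U w\<close> acts as \<open>1\<close> and \<open>- w\<close>, so its inverse for
    \<open>w \<noteq> 0\<close> is \<open>U (inverse w)\<close>.\<close>
  define U where "U w = Q1 - w *\<^sub>C P1" for w
  have UU: "U w o\<^sub>L U (inverse w) = id_blinfun" if "w \<noteq> 0" for w
  proof -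
    have "U w o\<^sub>L U (inverse w) = Q1 + P1"
      using that by (simp add: U_def blinfun_compose_simps blinfun_compose_scaleC_left
          blinfun_compose_scaleC_right[OF Q1(1)] blinfun_compose_scaleC_right[OF bP1] Q1 PQ
          scaleC_scaleC)
    then show ?thesis
      by (simp add: P1)
  qed
  have bU: "U w \<in> bounded_ops" for w
    unfolding U_def using Q1 bP1 by blast
  have U: "boundedly_invertible (U w)" "inverse_op (U w) = U (inverse w)" if "w \<noteq> 0" for w
    using UU[OF that] UU[of "inverse w"] that bU
    by (auto simp: boundedly_invertible_def intro: inverse_op_eqI)
  have A1_U: "A1 z = U (inverse (z - z0)) o\<^sub>L A z" if "z \<noteq> z0" for z
    using that by (simp add: A1_def U_def G_def blinfun_compose_simps blinfun_compose_scaleC_left)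
  have factor: "A z = U (z - z0) o\<^sub>L A1 z" for z
  proof (cases "z = z0")
    case True
    have "Q1 o\<^sub>L D = 0"
      using PD PQ(1) by (metis blinfun_compose_simps(7,11))
    then show ?thesis
      by (simp add: True U_def A1_z0 blinfun_compose_simps QA)
  next
    case False
    then show ?thesis
      using UU[of "z - z0"] by (simp add: A1_U flip: blinfun_compose_simps(11))
        (simp add: blinfun_compose_simps)
  qed

  obtain V F where VF: "boundedly_invertible V" "F \<in> finite_rank_ops" "A z0 = V - F"
  proof -
    obtain r C where "C 0 \<noteq> 0" "inverse_laurent A z0 n r C Q1"
      using inverse_laurentI[OF cont n(2,1) Q1(1)] Q1(3) finP1 unfolding P1 by blast
    then show thesis
      using inverse_laurent.invertible_minus_finite_rank_center bA[OF z0] that by blast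
  qed
  \<comment> \<open>The same invertible \<open>V\<close> serves for \<open>A z0\<close> and
    \<open>A1 z0\<close>, since they differ by the finite rank operator \<open>D\<close>.\<close>
  have "A1 z0 = V - (F + D)"
    by (simp add: A1_z0 VF(3))
  then have center: "A1 z0 \<in> fredholm_ops" "ind_op (A1 z0) = 0" "ind_op (A z0) = 0"
    using invertible_minus_finite_rank[OF VF(1)] finite_rank_ops_add[OF VF(2) finD] VF(2,3) by auto
  have fredholm1: "A1 z \<in> fredholm_ops" if "z \<in> \<Omega>" for z
  proof (cases "z = z0")
    case False
    then show ?thesis
      unfolding A1_U[OF False]
      by (intro fredholm_compose_invertible U fredholm that) simp
  qed (use center in simp)
  then have bA1: "A1 z \<in> bounded_ops" if "z \<in> \<Omega>" for z
    using that by (auto simp: fredholm_ops_def)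

  have invertible1: "boundedly_invertible (A1 z)"
    "inverse_op (A1 z) = inverse_op (A z) o\<^sub>L U (z - z0)"
    if "boundedly_invertible (A z)" "z \<noteq> z0" for z
    using boundedly_invertible_compose[OF U(1) that(1), of "inverse (z - z0)"]
      U(2)[of "inverse (z - z0)"] that(2) by (simp_all add: A1_U)
  \<comment> \<open>In a punctured disc around \<open>z0\<close> both operators are invertible,
    hence of index zero; \<open>center\<close> covers the point \<open>z0\<close>.\<close>
  have index: "\<exists>\<epsilon>>0. \<forall>z\<in>\<Omega>. cmod (z - z0) < \<epsilon> \<longrightarrow> ind_op (A z) = 0 \<and> ind_op (A1 z) = 0"
  proof -
    have "\<forall>\<^sub>F z in at z0. boundedly_invertible (A z)"
      using n(2) by (simp add: inverse_pole_of_order_def)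
    then obtain \<epsilon> where "\<epsilon> > 0"
      "\<And>z. z \<noteq> z0 \<Longrightarrow> dist z z0 < \<epsilon> \<Longrightarrow> boundedly_invertible (A z)"
      unfolding eventually_at by auto
    then show ?thesis
      using center invertible1(1) boundedly_invertible_ind_0 by (metis dist_norm)
  qed

  \<comment> \<open>At \<open>z = z0\<close> the left factor is \<open>Q1\<close> alone, so
    \<open>A1 z0 x = 0\<close> forces \<open>A z0 x = 0\<close>.\<close>
  have "ker_op (A1 z0) \<subseteq> ker_op (A z0)"
    using factor[of z0] by (auto simp: ker_op_def)
  then have deficiency: "def_op (A1 z0) \<le> def_op (A z0)"
    using center bA[OF z0] bA1[OF z0] fredholm[OF z0]
    by (simp add: def_op_eq_dim_ker cdim_mono fredholm_ops_def)

  have order: "inverse_pole_of_order A1 z0 (m - 1)"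
    if m: "m \<ge> 1" "inverse_pole_of_order A z0 m" for m
  proof -
    obtain r C where C: "C 0 \<noteq> 0" "inverse_laurent A z0 m r C Q1"
      using inverse_laurentI[OF cont m(2,1) Q1(1)] Q1(3) finP1 unfolding P1 by blast
    interpret inverse_laurent A z0 m r C Q1
      by (rule C(2))
    have "pole_of_order (\<lambda>z. inverse_op (A1 z)) z0 (m - 1)"
      by (rule reduced_pole[OF C(1) Q1(2) P1])
        (use invertible invertible1(2) in \<open>auto simp: U_def\<close>)
    moreover have "\<forall>\<^sub>F z in at z0. boundedly_invertible (A1 z)"
      using eventually_punctured by eventually_elim (use invertible invertible1(1) in auto)
    ultimately show ?thesis
      by (simp add: inverse_pole_of_order_def)
  qed

  \<comment> \<open>The difference is \<open>(I - U (z - z0)) A1(z)\<close>, and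
    \<open>I - U w\<close> equals \<open>(1 + w) P1\<close> because
    \<open>I - Q1 = P1\<close>.\<close>
  have diff: "A1 z - A z \<in> finite_rank_ops" if "z \<in> \<Omega>" for z
  proof -
    have "A1 z - A z = (1 + (z - z0)) *\<^sub>C (P1 o\<^sub>L A1 z)"
      by (subst factor) (simp add: U_def P1 blinfun_compose_simps blinfun_compose_scaleC_left
          scaleC_add_left scaleC_diff_right)
    then show ?thesis
      using finite_rank_ops_scaleC finite_rank_ops_compose_right finP1 bA1[OF that] by metis
  qed
  \<comment> \<open>All ideal statements have one proof: any class stable under adding finite rank
    operators contains \<open>I - A z\<close> exactly if it contains \<open>I - A1 z\<close>,
    pointwise in \<open>z\<close>.\<close>
  have perturb: "(\<forall>z\<in>\<Omega>. id_blinfun - A z \<in> I) \<longleftrightarrow> (\<forall>z\<in>\<Omega>. id_blinfun - A1 z \<in> I)"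
    if I: "\<And>T F. T \<in> I \<Longrightarrow> F \<in> finite_rank_ops \<Longrightarrow> T + F \<in> I" for I
  proof -
    have "id_blinfun - A z \<in> I \<longleftrightarrow> id_blinfun - A1 z \<in> I" if z: "z \<in> \<Omega>" for z
    proof
      assume "id_blinfun - A z \<in> I"
      from I[OF this finite_rank_ops_uminus[OF diff[OF z]]] show "id_blinfun - A1 z \<in> I"
        by simp
    next
      assume "id_blinfun - A1 z \<in> I"
      from I[OF this diff[OF z]] show "id_blinfun - A z \<in> I"
        by simp
    qed
    then show ?thesis by blast
  qed
  have ideals: "(\<forall>z\<in>\<Omega>. id_blinfun - A z \<in> schatten_ops p)
      \<longleftrightarrow> (\<forall>z\<in>\<Omega>. id_blinfun - A1 z \<in> schatten_ops p)" if "1 \<le> p" for p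
  proof (rule perturb)
    have "0 \<le> p"
      using that by (rule order_trans[rotated]) simp
    then show "T + F \<in> schatten_ops p" if "T \<in> schatten_ops p" "F \<in> finite_rank_ops"
      for T F :: "'h \<Rightarrow>\<^sub>L 'h"
      using schatten_ops_add_finite_rank that by blast
  qed
  show ?thesis
    using factor analytic1 fredholm1 index deficiency order perturb[OF finite_rank_ops_add] ideals
    unfolding U_def by (intro exI[of _ A1]) simp
qed

end
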